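(* Let $E=\{\xi\in\mathbb{R}^{3\times3}:(\lambda_1(\xi),\lambda_2(\xi),\lambda_3(\xi))\in\Lambda_E,\ \det\xi>0\}$, where $\Lambda_E\subseteq\{(x_1,x_2,x_3)\in\mathbb{R}^3:0<x_1\le x_2\le x_3\}$, and assume that $$\Gamma:=\{(a_1+t(b_1-a_1),a_2+t(b_2-a_2),a_3+t(b_3-a_3)):\ t\in[0,1]\}\subseteq\Lambda_E,$$ with $a_1<b_1$, $a_2<b_2$, $a_3<b_3$ and either $a_1<a_2<a_3$ or $b_1<b_2<b_3$. Let $$K:=\{\xi\in\mathbb{R}^{3\times3}:(\lambda_1(\xi),\lambda_2(\xi),\lambda_3(\xi))\in\Lambda_K,\ \det\xi>0\},$$ where $$\Lambda_K:=\bigcup_{(\alpha_1,\alpha_2,\alpha_3)\in\mathrm{rel\,int}\,\Gamma}\{(x_1,x_2,x_3)\in\mathbb{R}^3:\ x_1x_2x_3=\alpha_1\alpha_2\alpha_3,\ 0<x_1\le x_2\le x_3<\alpha_3,\ x_2x_3<\alpha_2\alpha_3\}$$ and $\mathrm{rel\,int}\,\Gamma:=\{(a_1+t(b_1-a_1),a_2+t(b_2-a_2),a_3+t(b_3-a_3)):\ t\in(0,1)\}$. Let $\Omega\subset\mathbb{R}^3$ be a bounded open set and let $\varphi\in C^1_{piec}(\overline\Omega,\mathbb{R}^3)$ be such that $D\varphi(x)\in E\cup K$ for a.e. $x$ in $\Omega$. Then there exists a map $u\in\varphi+W^{1,\infty}_0(\Omega,\mathbb{R}^3)$ such that $Du(x)\in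 E$ for a.e. $x$ in $\Omega$.
   Context: For $\xi\in\mathbb{R}^{3\times 3}$, $0\le\lambda_1(\xi)\le\lambda_2(\xi)\le\lambda_3(\xi)$ denote the singular values of $\xi$, i.e. the eigenvalues of $\sqrt{\xi\xi^t}$. Conventions: $C^1_{piec}(\overline\Omega,\mathbb{R}^N)$ is the set of piecewise $C^1$ maps, i.e. maps $u\in W^{1,\infty}(\Omega;\mathbb{R}^N)\cap C(\overline\Omega;\mathbb{R}^N)$ for which there are countably many disjoint open sets $\Omega_k\subset\Omega$ with $\operatorname{meas}(\Omega\setminus\bigcup_k\Omega_k)=0$ such that $u\in C^1(\overline{\Omega_k};\mathbb{R}^N)$ for each $k$. $W^{1,\infty}_0(\Omega;\mathbb{R}^N)=W^{1,\infty}(\Omega;\mathbb{R}^N)\cap W^{1,1}_0(\Omega;\mathbb{R}^N)$. *)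

theory Defs
  imports "HOL-Analysis.Analysis"
begin

definition psd :: "real^'n^'n \<Rightarrow> bool" where
  "psd A \<longleftrightarrow> transpose A = A \<and> (\<forall>x. 0 \<le> x \<bullet> (A *v x))"

definition psd_sqrt :: "real^'n^'n \<Rightarrow> real^'n^'n" where
  "psd_sqrt A = (THE S. psd S \<and> S ** S = A)"

text \<open>Eigenvalues in nondecreasing order, repeated according to multiplicity (as roots of the
  characteristic polynomial). Only meaningful when all three are real, e.g. for symmetric \<open>A\<close>.\<close>

definition eigenvalues3 :: "real^3^3 \<Rightarrow> real \<times> real \<times> real" where
  "eigenvalues3 A = (THE (l1, l2, l3). l1 \<le> l2 \<and> l2 \<le> l3 \<and>
     (\<forall>t. det (mat t - A) = (t - l1) * (t - l2) * (t - l3)))"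

definition singular_values3 :: "real^3^3 \<Rightarrow> real \<times> real \<times> real" where
  "singular_values3 \<xi> = eigenvalues3 (psd_sqrt (\<xi> ** transpose \<xi>))"

definition isotropic_set :: "(real \<times> real \<times> real) set \<Rightarrow> (real^3^3) set" where
  "isotropic_set \<Lambda> = {\<xi>. singular_values3 \<xi> \<in> \<Lambda> \<and> 0 < det \<xi>}"

text \<open>Maps are represented by total functions; only their values on \<open>\<Omega>\<close> (or its closure, for
  \<open>C1_closure\<close> and \<open>C1_piec\<close>) matter. The entry \<open>U x $ i $ j\<close> of a gradient is the partial
  derivative of the \<open>i\<close>-th component in the direction of the \<open>j\<close>-th coordinate.\<close>

primrec C_k :: "nat \<Rightarrow> ('a::real_normed_vector \<Rightarrow> 'b::real_normed_vector) \<Rightarrow> bool" where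
  "C_k 0 f \<longleftrightarrow> continuous_on UNIV f"
| "C_k (Suc k) f \<longleftrightarrow> (\<forall>x. f differentiable (at x)) \<and>
     (\<forall>h. C_k k (\<lambda>x. frechet_derivative f (at x) h))"

definition test_functions ::
  "'a::euclidean_space set \<Rightarrow> ('a \<Rightarrow> 'b::real_normed_vector) set" where
  "test_functions \<Omega> = {\<psi>. (\<forall>k. C_k k \<psi>) \<and>
     compact (closure {x. \<psi> x \<noteq> 0}) \<and> closure {x. \<psi> x \<noteq> 0} \<subseteq> \<Omega>}"

definition locally_integrable ::
  "'a::euclidean_space set \<Rightarrow> ('a \<Rightarrow> 'b::euclidean_space) \<Rightarrow> bool" where
  "locally_integrable \<Omega> f \<longleftrightarrow> (\<forall>S. compact S \<and> S \<subseteq> \<Omega> \<longrightarrow> integrable (lebesgue_on S) f)"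

definition has_weak_gradient ::
  "(real^'n) set \<Rightarrow> (real^'n \<Rightarrow> real^'m) \<Rightarrow> (real^'n \<Rightarrow> real^'n^'m) \<Rightarrow> bool" where
  "has_weak_gradient \<Omega> u U \<longleftrightarrow> locally_integrable \<Omega> u \<and> locally_integrable \<Omega> U \<and>
     (\<forall>\<psi>::real^'n \<Rightarrow> real. \<psi> \<in> test_functions \<Omega> \<longrightarrow> (\<forall>i j.
        (LINT x|lebesgue_on \<Omega>. u x $ i * frechet_derivative \<psi> (at x) (axis j 1)) =
        - (LINT x|lebesgue_on \<Omega>. U x $ i $ j * \<psi> x)))"

definition L_inf :: "'a::euclidean_space set \<Rightarrow> ('a \<Rightarrow> 'b::euclidean_space) set" where
  "L_inf \<Omega> = {f. f \<in> borel_measurable (lebesgue_on \<Omega>) \<and>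
     (\<exists>C. AE x in lebesgue_on \<Omega>. norm (f x) \<le> C)}"

definition W1_inf :: "(real^'n) set \<Rightarrow> (real^'n \<Rightarrow> real^'m) set" where
  "W1_inf \<Omega> = {u. u \<in> L_inf \<Omega> \<and> (\<exists>U. has_weak_gradient \<Omega> u U \<and> U \<in> L_inf \<Omega>)}"

text \<open>The closure of the test functions in the norm of \<open>W\<^sup>1\<^sup>,\<^sup>1(\<Omega>)\<close>.\<close>

definition W11_0 :: "(real^'n) set \<Rightarrow> (real^'n \<Rightarrow> real^'m) set" where
  "W11_0 \<Omega> = {v. integrable (lebesgue_on \<Omega>) v \<and>
     (\<exists>V. has_weak_gradient \<Omega> v V \<and> integrable (lebesgue_on \<Omega>) V \<and>
       (\<exists>\<psi>. (\<forall>n::nat. \<psi> n \<in> test_functions \<Omega>) \<and>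
          (\<lambda>n. (LINT x|lebesgue_on \<Omega>. norm (\<psi> n x - v x)) +
               (LINT x|lebesgue_on \<Omega>. norm (jacobian (\<psi> n) (at x) - V x))) \<longlonglongrightarrow> 0))}"

definition W1_inf_0 :: "(real^'n) set \<Rightarrow> (real^'n \<Rightarrow> real^'m) set" where
  "W1_inf_0 \<Omega> = W1_inf \<Omega> \<inter> W11_0 \<Omega>"

text \<open>\<open>C\<^sup>1\<close> up to the boundary: the derivative on the open set \<open>S\<close> extends continuously to the
  closure.\<close>

definition C1_closure :: "(real^'n) set \<Rightarrow> (real^'n \<Rightarrow> real^'m) set" where
  "C1_closure S = {u. continuous_on (closure S) u \<and>
     (\<exists>G. continuous_on (closure S) G \<and>
        (\<forall>x\<in>S. (u has_derivative (\<lambda>h. G x *v h)) (at x)))}"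

text \<open>The pieces may be empty, so finite families are included.\<close>

definition C1_piec :: "(real^'n) set \<Rightarrow> (real^'n \<Rightarrow> real^'m) set" where
  "C1_piec \<Omega> = {u. u \<in> W1_inf \<Omega> \<and> continuous_on (closure \<Omega>) u \<and>
     (\<exists>\<omega>::nat \<Rightarrow> (real^'n) set. (\<forall>k. open (\<omega> k) \<and> \<omega> k \<subseteq> \<Omega> \<and> u \<in> C1_closure (\<omega> k)) \<and>
        disjoint_family \<omega> \<and> \<Omega> - (\<Union>k. \<omega> k) \<in> null_sets lebesgue)}"

end

theory Submission
  imports Defs
begin

text \<open>For \<open>x1 x2 x3 = \<alpha>1 \<alpha>2 \<alpha>3\<close> the condition \<open>x2 x3 < \<alpha>2 \<alpha>3\<close> says \<open>\<alpha>1 < x1\<close>. Hence \<open>K\<close> is the bounded open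
  set of matrices whose determinant is \<open>\<alpha>1 \<alpha>2 \<alpha>3\<close> at some parameter \<open>t\<close> in \<open>(0,1)\<close> and which stretch
  every unit vector by a factor strictly between \<open>\<alpha>1\<close> and \<open>\<alpha>3\<close>. If one of these two bounds holds with a
  margin \<open>\<delta>\<close>, a shear in the plane of two neighbouring singular directions preserves the determinant and
  stays in \<open>K\<close> in both directions up to a length proportional to \<open>\<delta>\<close>; without margin, all three
  singular values lie on \<open>\<Gamma>\<close>.

  Along such a rank-one segment a map can be perturbed by a fast oscillating wave of tiny
  amplitude, keeping the gradient in \<open>K\<close> and increasing its Dirichlet energy by a fixed multiple of the
  squared length of the segment times the measure. Choose perturbations of nearly maximal
  energy whose amplitudes decrease so fast that their gradients are almost orthogonal in \<open>L\<^sup>2\<close>. As \<open>K\<close> is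
  bounded, the energies are summable, so the gradients converge in \<open>L\<^sup>2\<close>, and since the possible gain
  tends to zero, almost every limit gradient has no margin left, that is, it lies in \<open>E\<close>.

  On the pieces where \<open>\<phi>\<close> is \<open>C\<^sup>1\<close>, the set where its gradient lies in the open set \<open>K\<close> is open, and only
  there \<open>\<phi>\<close> is modified.\<close>

subsection \<open>Smooth functions\<close>

text \<open>Everything rests on \<open>K\<close> being open. For one fixed value of the parameter
  the determinant is prescribed, and the admissible matrices form part of a hypersurface, which a
  plane wave generally leaves as soon as it is cut off. Letting the parameter run through an
  interval removes this obstacle: all three coordinates increase strictly along \<Gamma>, so the
  determinant determines the parameter, and a small change of the determinant is paid for by a small
  shift of the parameter. The error that a cut-off adds to a gradient is then harmless if the wave
  is fast enough.

  A shear drives the two singular values of its plane apart while keeping their product. Its plane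
  must therefore contain the singular direction whose bound has the margin, and the other singular
  value of that plane must have room as well.

  The limit gradients may leave the open set \<open>K\<close>, and room for oscillation does not
  pass to limits. Its absence is therefore recorded along the approximating gradients, with a length
  tending to zero, and evaluated in the limit by compactness of the parameter interval.\<close>

lemma C_k_SucI:
  assumes "\<And>x. (f has_derivative f' x) (at x)" "\<And>h. C_k k (\<lambda>x. f' x h)"
  shows "C_k (Suc k) f"
proof -
  have "frechet_derivative f (at x) = f' x" for x
    using frechet_derivative_at[OF assms(1)] by simp
  then show ?thesis using assms by (auto simp: differentiable_def)
qed

lemma C_k_Suc_has_derivative:
  "C_k (Suc k) f \<Longrightarrow> (f has_derivative frechet_derivative f (at x)) (at x)"
  by (auto simp: frechet_derivative_works)

lemma C_k_SucD: "C_k (Suc k) f \<Longrightarrow> C_k k f"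
proof (induction k arbitrary: f)
  case 0
  then have "isCont f x" for x
    by (auto intro: differentiable_imp_continuous_within)
  then show ?case by (simp add: continuous_at_imp_continuous_on)
next
  case (Suc k)
  then show ?case by auto
qed

lemma C_k_continuous: "C_k k f \<Longrightarrow> continuous_on UNIV f"
proof (induction k)
  case (Suc k)
  then show ?case using C_k_SucD by blast
qed simp

lemma C_k_zero: "C_k k (\<lambda>x. 0)"
proof (induction k)
  case (Suc k)
  then show ?case by (intro C_k_SucI[where f'="\<lambda>_ _. 0"] has_derivative_const)
qed simp

lemma C_k_const: "C_k k (\<lambda>x. c)"
proof (cases k)
  case (Suc k)
  show ?thesis
    unfolding Suc by (intro C_k_SucI[where f'="\<lambda>_ _. 0"] has_derivative_const C_k_zero)
qed simp

lemma C_k_bounded_linear_compose: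
  assumes L: "bounded_linear L" and "C_k k f"
  shows "C_k k (\<lambda>x. L (f x))"
  using assms(2)
proof (induction k arbitrary: f)
  case 0
  then show ?case using L by (auto intro: bounded_linear.continuous_on)
next
  case (Suc k)
  show ?case
  proof (rule C_k_SucI)
    show "((\<lambda>x. L (f x)) has_derivative (\<lambda>h. L (frechet_derivative f (at x) h))) (at x)" for x
      using bounded_linear.has_derivative[OF L C_k_Suc_has_derivative[OF Suc.prems]] .
    show "C_k k (\<lambda>x. L (frechet_derivative f (at x) h))" for h
      using Suc by auto
  qed
qed

lemma C_k_id: "C_k k (\<lambda>x. x)"
proof (cases k)
  case (Suc k)
  show ?thesis
    unfolding Suc by (intro C_k_SucI[where f'="\<lambda>_ h. h"] has_derivative_ident C_k_const)
qed simp

lemma C_k_add: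
  assumes "C_k k f" "C_k k g"
  shows "C_k k (\<lambda>x. f x + g x)"
  using assms
proof (induction k arbitrary: f g)
  case 0
  then show ?case by (simp add: continuous_on_add)
next
  case (Suc k)
  show ?case
  proof (rule C_k_SucI)
    show "((\<lambda>x. f x + g x) has_derivative
        (\<lambda>h. frechet_derivative f (at x) h + frechet_derivative g (at x) h)) (at x)" for x
      by (intro derivative_intros C_k_Suc_has_derivative) (fact Suc.prems)+
    show "C_k k (\<lambda>x. frechet_derivative f (at x) h + frechet_derivative g (at x) h)" for h
      using Suc by auto
  qed
qed

text \<open>By Leibniz the derivative is a sum of two such products, in which the undifferentiated
  factor is still of the lower class. Stating it for every bounded bilinear map covers the three
  products instantiated below.\<close>

lemma C_k_bilinear:
  assumes p: "bounded_bilinear p" and "C_k k f" "C_k k g"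
  shows "C_k k (\<lambda>x. p (f x) (g x))"
  using assms(2,3)
proof (induction k arbitrary: f g)
  case 0
  then show ?case by (auto intro: bounded_bilinear.continuous_on[OF p])
next
  case (Suc k)
  show ?case
  proof (rule C_k_SucI)
    show "((\<lambda>x. p (f x) (g x)) has_derivative
        (\<lambda>h. p (f x) (frechet_derivative g (at x) h) + p (frechet_derivative f (at x) h) (g x))) (at x)"
      for x
      by (intro bounded_bilinear.FDERIV[OF p] C_k_Suc_has_derivative) (fact Suc.prems)+
    show "C_k k (\<lambda>x. p (f x) (frechet_derivative g (at x) h) +
        p (frechet_derivative f (at x) h) (g x))" for h
      using Suc.IH Suc.prems C_k_SucD[OF Suc.prems(1)] C_k_SucD[OF Suc.prems(2)]
      by (intro C_k_add) auto
  qed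
qed

lemmas C_k_scaleR = C_k_bilinear[OF bounded_bilinear_scaleR]
lemmas C_k_mult = C_k_bilinear[OF bounded_bilinear_mult]
lemmas C_k_inner = C_k_bilinear[OF bounded_bilinear_inner]

text \<open>With a real inner function the chain rule is a product: a partial derivative of
  \<open>q\<close> times the composition of g' with \<open>q\<close>. Both are of the lower class,
  so the induction closes with scalar multiplication alone.\<close>

lemma C_k_compose_real:
  fixes g :: "real \<Rightarrow> real"
  assumes "C_k k g" "C_k k q"
  shows "C_k k (\<lambda>x. g (q x))"
  using assms
proof (induction k arbitrary: g q)
  case 0
  then show ?case by (auto intro: continuous_on_compose2)
next
  case (Suc k)
  let ?g' = "\<lambda>t. frechet_derivative g (at t) 1"
  have lin: "frechet_derivative g (at t) s = s *\<^sub>R ?g' t" for t s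
    using linear_scale[OF has_derivative_linear[OF C_k_Suc_has_derivative[OF Suc.prems(1)]], of t s 1]
    by simp
  show ?case
  proof (rule C_k_SucI)
    show "((\<lambda>x. g (q x)) has_derivative
        (\<lambda>h. frechet_derivative q (at x) h *\<^sub>R ?g' (q x))) (at x)" for x
      using diff_chain_at[OF C_k_Suc_has_derivative[OF Suc.prems(2)]
          C_k_Suc_has_derivative[OF Suc.prems(1)], of x]
      unfolding o_def by (subst (asm) lin)
    have "C_k k (\<lambda>x. ?g' (q x))"
      using Suc.IH[of ?g' q] Suc.prems C_k_SucD[OF Suc.prems(2)] by auto
    then show "C_k k (\<lambda>x. frechet_derivative q (at x) h *\<^sub>R ?g' (q x))" for h
      using Suc.prems by (intro C_k_scaleR) auto
  qed
qed

text \<open>Each function is, up to sign, the derivative of the other, so the induction carries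
  both.\<close>

lemma C_k_sin_cos:
  "C_k k (sin :: real \<Rightarrow> real)" "C_k k (cos :: real \<Rightarrow> real)"
proof (induction k)
  case (Suc k)
  show "C_k (Suc k) (sin :: real \<Rightarrow> real)"
  proof (rule C_k_SucI)
    show "(sin has_derivative (\<lambda>h. cos x * h)) (at x)" for x :: real
      by (auto intro!: derivative_eq_intros)
    show "C_k k (\<lambda>x. cos x * h)" for h :: real
      using Suc by (intro C_k_mult C_k_const)
  qed
  show "C_k (Suc k) (cos :: real \<Rightarrow> real)"
  proof (rule C_k_SucI)
    show "(cos has_derivative (\<lambda>h. sin x * (- h))) (at x)" for x :: real
      by (auto intro!: derivative_eq_intros)
    show "C_k k (\<lambda>x. sin x * (- h))" for h :: real
      using Suc by (intro C_k_mult C_k_const)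
  qed
qed (auto intro: continuous_on_sin continuous_on_cos)

text \<open>The powers of \<open>1/t\<close> make the family closed under differentiation.\<close>

definition flat_exp :: "nat \<Rightarrow> real \<Rightarrow> real" where
  "flat_exp m t = (if t \<le> 0 then 0 else exp (- inverse t) * inverse t ^ m)"

text \<open>One term of the exponential series is at most the whole sum.\<close>

lemma power_le_fact_mult_exp: "0 \<le> x \<Longrightarrow> x ^ n \<le> fact n * exp (x::real)"
proof -
  assume "0 \<le> x"
  have "(\<Sum>i\<in>{n}. inverse (fact i) *\<^sub>R x ^ i) \<le> (\<Sum>i. inverse (fact i) *\<^sub>R x ^ i)"
    by (intro sum_le_suminf summable_exp_generic) (use \<open>0 \<le> x\<close> in auto)
  then show ?thesis by (simp add: exp_def field_simps)
qed

text \<open>The factor exp(-1/t) beats every power of 1/t. Spending two powers more than present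
  leaves a quadratic bound, which makes the difference quotients at 0 tend to 0.\<close>

lemma flat_exp_bound: "\<bar>flat_exp m t\<bar> \<le> fact (m + 2) * t\<^sup>2"
proof (cases "t \<le> 0")
  case False
  then have "inverse t ^ (m + 2) \<le> fact (m + 2) * exp (inverse t)"
    by (intro power_le_fact_mult_exp) auto
  then have "exp (- inverse t) * inverse t ^ (m + 2) \<le> exp (- inverse t) * (fact (m + 2) * exp (inverse t))"
    by (intro mult_left_mono) auto
  also have "\<dots> = fact (m + 2)" by (simp add: exp_minus)
  finally have "exp (- inverse t) * inverse t ^ m * inverse t ^ 2 \<le> fact (m + 2)"
    by (simp only: power_add mult.assoc)
  then have "exp (- inverse t) * inverse t ^ m \<le> fact (m + 2) * t\<^sup>2"
    using False by (simp add: field_simps)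
  then show ?thesis using False by (simp add: flat_exp_def)
qed (simp add: flat_exp_def)

lemma flat_exp_has_derivative:
  "(flat_exp m has_real_derivative (flat_exp (m + 2) t - m * flat_exp (m + 1) t)) (at t)"
proof -
  consider "t > 0" | "t < 0" | "t = 0" by linarith
  then show ?thesis
  proof cases
    case 1
    have *: "m * inverse t ^ (m - Suc 0) * (inverse t)\<^sup>2 = m * inverse t ^ (m + 1)"
      by (cases m) (auto simp: power2_eq_square)
    have "((\<lambda>t. exp (- inverse t) * inverse t ^ m) has_real_derivative
       (exp (- inverse t) * (inverse t)\<^sup>2 * inverse t ^ m +
        m * inverse t ^ (m - Suc 0) * (- ((inverse t)\<^sup>2)) * exp (- inverse t))) (at t)"
      by (rule derivative_eq_intros refl | use 1 in \<open>simp add: power2_eq_square\<close>)+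
    also have "exp (- inverse t) * (inverse t)\<^sup>2 * inverse t ^ m +
        m * inverse t ^ (m - Suc 0) * (- ((inverse t)\<^sup>2)) * exp (- inverse t) =
       flat_exp (m + 2) t - m * flat_exp (m + 1) t"
      using * 1 by (simp add: flat_exp_def power_add power2_eq_square)
    finally have "((\<lambda>t. exp (- inverse t) * inverse t ^ m) has_real_derivative
       (flat_exp (m + 2) t - m * flat_exp (m + 1) t)) (at t)" .
    then show ?thesis
      by (rule has_field_derivative_transform_within_open[where S="{0<..}"])
        (use 1 in \<open>auto simp: flat_exp_def\<close>)
  next
    case 2
    have "((\<lambda>t. 0) has_real_derivative (flat_exp (m + 2) t - m * flat_exp (m + 1) t)) (at t)"
      using 2 by (auto simp: flat_exp_def)
    then show ?thesis
      by (rule has_field_derivative_transform_within_open[where S="{..<0}"])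
        (use 2 in \<open>auto simp: flat_exp_def\<close>)
  next
    case 3
    have "((\<lambda>h. flat_exp m h / h) \<longlongrightarrow> 0) (at 0)"
    proof (rule Lim_null_comparison)
      show "\<forall>\<^sub>F h in at 0. norm (flat_exp m h / h) \<le> fact (m + 2) * \<bar>h\<bar>"
      proof (intro always_eventually allI)
        fix h :: real
        show "norm (flat_exp m h / h) \<le> fact (m + 2) * \<bar>h\<bar>"
          using flat_exp_bound[of m h]
          by (cases "h = 0") (auto simp: divide_simps power2_eq_square abs_mult)
      qed
      have "((\<lambda>h::real. fact (m + 2) * \<bar>h\<bar>) \<longlongrightarrow> fact (m + 2) * \<bar>0\<bar>) (at 0)"
        by (intro tendsto_intros)
      then show "((\<lambda>h::real. fact (m + 2) * \<bar>h\<bar>) \<longlongrightarrow> 0) (at 0)" by simp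
    qed
    then show ?thesis using 3 by (simp add: DERIV_def flat_exp_def)
  qed
qed

lemma C_k_flat_exp: "C_k k (flat_exp m)"
proof (induction k arbitrary: m)
  case 0
  have "isCont (flat_exp m) t" for t
    using DERIV_isCont[OF flat_exp_has_derivative] .
  then show ?case by (simp add: continuous_at_imp_continuous_on)
next
  case (Suc k)
  show ?case
  proof (rule C_k_SucI)
    show "(flat_exp m has_derivative
        (\<lambda>h. (flat_exp (m + 2) t + (- real m) * flat_exp (m + 1) t) * h)) (at t)" for t
      using flat_exp_has_derivative[of m t] by (simp add: has_field_derivative_def)
    show "C_k k (\<lambda>t. (flat_exp (m + 2) t + (- real m) * flat_exp (m + 1) t) * h)" for h
      by (intro C_k_mult C_k_add C_k_const Suc)
  qed
qed

subsection \<open>Integration by parts\<close>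

lemma integrable_compact_support:
  fixes f :: "'a::euclidean_space \<Rightarrow> 'b::{banach, second_countable_topology}"
  assumes "continuous_on UNIV f" "compact S" "\<And>x. x \<notin> S \<Longrightarrow> f x = 0"
  shows "integrable lebesgue f"
proof -
  have "integrable lborel (\<lambda>x. indicator S x *\<^sub>R f x)"
    using assms by (intro borel_integrable_compact) (auto intro: continuous_on_subset)
  also have "(\<lambda>x. indicator S x *\<^sub>R f x) = f"
    using assms(3) by (auto simp: indicator_def)
  finally show ?thesis
    using borel_measurable_continuous_onI[OF assms(1)] by (simp add: integrable_completion)
qed

lemma bounded_compact_support:
  fixes f :: "'a::euclidean_space \<Rightarrow> 'b::real_normed_vector"
  assumes "continuous_on UNIV f" "compact S" "\<And>x. x \<notin> S \<Longrightarrow> f x = 0"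
  obtains M where "M > 0" "\<And>x. norm (f x) \<le> M"
proof -
  have "bounded (f ` S)"
    using assms by (intro compact_imp_bounded compact_continuous_image) (auto intro: continuous_on_subset)
  then obtain M where "M > 0" "\<And>x. x \<in> S \<Longrightarrow> norm (f x) \<le> M"
    by (auto simp: bounded_pos)
  then show ?thesis using assms(3) that[of M] by (metis norm_zero order_less_le)
qed

lemma integral_lebesgue_translation:
  fixes f :: "'a::euclidean_space \<Rightarrow> real"
  assumes "continuous_on UNIV f"
  shows "(LINT x|lebesgue. f (x + h)) = (LINT x|lebesgue. f x)"
proof -
  have m: "f \<in> borel_measurable borel" using assms by (rule borel_measurable_continuous_onI)
  have "(LINT x|lborel. f x) = (LINT x|distr lborel borel ((+) h). f x)"
    by (simp add: lborel_distr_plus)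
  also have "\<dots> = (LINT x|lborel. f (h + x))"
    using m by (intro integral_distr) auto
  finally have "(LINT x|lborel. f x) = (LINT x|lborel. f (x + h))" by (simp add: add.commute)
  moreover have "(LINT x|lebesgue. f x) = (LINT x|lborel. f x)"
    using m by (intro integral_completion) auto
  moreover have "(LINT x|lebesgue. f (x + h)) = (LINT x|lborel. f (x + h))"
    using m by (intro integral_completion) auto
  ultimately show ?thesis by simp
qed

text \<open>Difference quotients in direction \<open>h\<close> have integral zero by translation
  invariance, and dominated convergence passes this on to the derivative. Working along a single
  direction avoids iterated integrals.\<close>

lemma integral_partial_derivative_eq_0:
  fixes f :: "'a::euclidean_space \<Rightarrow> real"
  assumes f: "\<And>x. (f has_derivative f' x) (at x)" and f': "continuous_on UNIV (\<lambda>x. f' x h)"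
    and S: "compact S" "\<And>x. x \<notin> S \<Longrightarrow> f x = 0"
  shows "(LINT x|lebesgue. f' x h) = 0"
proof -
  have cont: "continuous_on UNIV f"
    using f by (intro continuous_at_imp_continuous_on) (auto intro: has_derivative_continuous)
  have f'0: "f' x h = 0" if "x \<notin> S" for x
  proof -
    have "((\<lambda>x. 0) has_derivative f' x) (at x)"
      by (rule has_derivative_transform_within_open[OF f open_Compl[of S]])
        (use S that compact_imp_closed in auto)
    then have "f' x = (\<lambda>_. 0)"
      using has_derivative_const has_derivative_unique by blast
    then show ?thesis by simp
  qed
  obtain M where M: "M > 0" "\<And>x. norm (f' x h) \<le> M"
    using bounded_compact_support[OF f' S(1) f'0] by blast
  \<comment> \<open>\<open>S\<close> swept backwards along \<open>h\<close>: outside this compact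
    set no point x + s h with s in [0,1] meets \<open>S\<close>, so one integrable bound serves all
    quotients with step at most 1.\<close>
  define S' where "S' = (\<lambda>(x, s). x - s *\<^sub>R h) ` (S \<times> {0..1::real})"
  have "compact S'"
    unfolding S'_def using S(1)
    by (intro compact_continuous_image compact_Times)
      (auto intro!: continuous_intros simp: case_prod_beta)
  define t where "t = (\<lambda>n. inverse (real (Suc n)))"
  have t: "0 < t n" "t n \<le> 1" for n by (auto simp: t_def field_simps)
  define d where "d = (\<lambda>n x. (f (x + t n *\<^sub>R h) - f x) / t n)"
  have along: "((\<lambda>s. f (x + s *\<^sub>R h)) has_real_derivative f' (x + s *\<^sub>R h) h) (at s)" for x s
  proof -
    have "((\<lambda>s. f (x + s *\<^sub>R h)) has_derivative (\<lambda>r. f' (x + s *\<^sub>R h) (r *\<^sub>R h))) (at s)"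
      by (rule has_derivative_compose[OF _ f]) (auto intro!: derivative_eq_intros)
    then show ?thesis
      using linear_scale[OF has_derivative_linear[OF f[of "x + s *\<^sub>R h"]]]
      by (simp add: has_field_derivative_def mult_commute_abs)
  qed
  have bound: "norm (d n x) \<le> M * indicator S' x" for n x
  proof (cases "x \<in> S'")
    case True
    obtain z where "f (x + t n *\<^sub>R h) - f (x + 0 *\<^sub>R h) = (t n - 0) * f' (x + z *\<^sub>R h) h"
      using MVT2[of 0 "t n" "\<lambda>s. f (x + s *\<^sub>R h)" "\<lambda>s. f' (x + s *\<^sub>R h) h"] along t(1)[of n]
      by auto
    then show ?thesis using M(2) t(1)[of n] True by (simp add: d_def)
  next
    case False
    have "x + s *\<^sub>R h \<notin> S" if "0 \<le> s" "s \<le> 1" for s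
    proof
      assume "x + s *\<^sub>R h \<in> S"
      then have "(x + s *\<^sub>R h) - s *\<^sub>R h \<in> S'"
        unfolding S'_def using that by force
      then show False using False by simp
    qed
    from this[of 0] this[of "t n"] show ?thesis
      using t[of n] S(2) False by (simp add: d_def indicator_def)
  qed
  have lim: "(\<lambda>n. d n x) \<longlonglongrightarrow> f' x h" for x
  proof -
    have "((\<lambda>s. (f (x + s *\<^sub>R h) - f x) / s) \<longlongrightarrow> f' x h) (at 0)"
      using along[of x 0] by (simp add: DERIV_def)
    moreover have "filterlim t (at 0) sequentially"
      using t(1) LIMSEQ_inverse_real_of_nat unfolding filterlim_at t_def
      by (simp add: less_imp_neq[symmetric] del: of_nat_Suc)
    ultimately show ?thesis
      unfolding d_def by (rule filterlim_compose)
  qed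
  have int: "integrable lebesgue (\<lambda>x. f (x + c))" for c
  proof (rule integrable_compact_support)
    show "continuous_on UNIV (\<lambda>x. f (x + c))"
      using cont by (intro continuous_on_compose2[OF cont]) (auto intro!: continuous_intros)
    show "compact ((\<lambda>x. x - c) ` S)"
      using S by (intro compact_continuous_image) (auto intro!: continuous_intros)
    show "f (x + c) = 0" if "x \<notin> (\<lambda>x. x - c) ` S" for x
      using that S(2)[of "x + c"] by force
  qed
  have zero: "(LINT x|lebesgue. d n x) = 0" for n
    using int[of "t n *\<^sub>R h"] int[of 0] integral_lebesgue_translation[OF cont, of "t n *\<^sub>R h"]
    by (simp add: d_def)
  have "(\<lambda>n. LINT x|lebesgue. d n x) \<longlonglongrightarrow> (LINT x|lebesgue. f' x h)"
  proof (rule integral_dominated_convergence)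
    show "(\<lambda>x. f' x h) \<in> borel_measurable lebesgue"
      using integrable_compact_support[OF f' S(1) f'0] by auto
    show "d n \<in> borel_measurable lebesgue" for n
      using int[of "t n *\<^sub>R h"] int[of 0] unfolding d_def by simp
    show "integrable lebesgue (\<lambda>x. M * indicator S' x :: real)"
      using lmeasurable_compact[OF \<open>compact S'\<close>]
      by (intro integrable_mult_right) (simp add: lmeasurable_iff_integrable)
  qed (use bound lim in auto)
  then show ?thesis by (simp add: zero LIMSEQ_const_iff)
qed

lemma integral_by_parts:
  fixes f g :: "'a::euclidean_space \<Rightarrow> real"
  assumes f: "\<And>x. (f has_derivative f' x) (at x)" "continuous_on UNIV (\<lambda>x. f' x h)"
    and g: "\<And>x. (g has_derivative g' x) (at x)" "continuous_on UNIV (\<lambda>x. g' x h)"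
    and S: "compact S" "\<And>x. x \<notin> S \<Longrightarrow> g x = 0" "\<And>x. x \<notin> S \<Longrightarrow> g' x h = 0"
  shows "(LINT x|lebesgue. f x * g' x h) = - (LINT x|lebesgue. f' x h * g x)"
proof -
  have cf: "continuous_on UNIV f"
    using f by (intro continuous_at_imp_continuous_on) (auto intro: has_derivative_continuous)
  have cg: "continuous_on UNIV g"
    using g by (intro continuous_at_imp_continuous_on) (auto intro: has_derivative_continuous)
  have "(LINT x|lebesgue. f x * g' x h + f' x h * g x) = 0"
  proof (rule integral_partial_derivative_eq_0[where f="\<lambda>x. f x * g x" and h=h and S=S])
    show "((\<lambda>x. f x * g x) has_derivative (\<lambda>h. f x * g' x h + f' x h * g x)) (at x)" for x
      using f(1) g(1) by (intro has_derivative_mult)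
    show "continuous_on UNIV (\<lambda>x. f x * g' x h + f' x h * g x)"
      using cf cg f g by (intro continuous_intros)
  qed (use S in auto)
  moreover have "integrable lebesgue (\<lambda>x. f x * g' x h)"
    by (rule integrable_compact_support[OF _ S(1)]) (use cf g S in \<open>auto intro!: continuous_intros\<close>)
  moreover have "integrable lebesgue (\<lambda>x. f' x h * g x)"
    by (rule integrable_compact_support[OF _ S(1)]) (use cg f S in \<open>auto intro!: continuous_intros\<close>)
  ultimately show ?thesis by simp
qed

section \<open>Test functions and their Jacobians\<close>

lemma test_functionsI:
  assumes "\<And>k. C_k k f" "compact S" "S \<subseteq> \<Omega>" "\<And>x. x \<notin> S \<Longrightarrow> f x = 0"
  shows "f \<in> test_functions \<Omega>"
proof -
  have "closure {x. f x \<noteq> 0} \<subseteq> S"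
    using assms by (intro closure_minimal compact_imp_closed) auto
  then show ?thesis
    using assms(1,3) compact_Int_closed[OF assms(2), of "closure {x. f x \<noteq> 0}"]
    by (auto simp: test_functions_def Int_absorb1)
qed

lemma test_functions_zero: "(\<lambda>x. 0) \<in> test_functions \<Omega>"
  by (rule test_functionsI[where S="{}"]) (auto intro: C_k_zero)

lemma test_functions_mono: "\<Omega> \<subseteq> \<Omega>' \<Longrightarrow> f \<in> test_functions \<Omega> \<Longrightarrow> f \<in> test_functions \<Omega>'"
  by (auto simp: test_functions_def)

lemma test_functions_C_k: "f \<in> test_functions \<Omega> \<Longrightarrow> C_k k f"
  by (simp add: test_functions_def)

lemma test_functions_continuous: "f \<in> test_functions \<Omega> \<Longrightarrow> continuous_on UNIV f"
  using test_functions_C_k C_k_continuous by blast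

lemma test_functions_has_derivative:
  "f \<in> test_functions \<Omega> \<Longrightarrow> (f has_derivative frechet_derivative f (at x)) (at x)"
  using test_functions_C_k C_k_Suc_has_derivative by blast

lemma jacobian_eqI:
  fixes f :: "real^'n \<Rightarrow> real^'m"
  shows "(f has_derivative (\<lambda>h. A *v h)) (at x) \<Longrightarrow> jacobian f (at x) = A"
  unfolding jacobian_def by (simp add: frechet_derivative_at[symmetric])

lemma test_functions_has_jacobian:
  fixes f :: "real^'n \<Rightarrow> real^'m"
  assumes "f \<in> test_functions \<Omega>"
  shows "(f has_derivative (\<lambda>h. jacobian f (at x) *v h)) (at x)"
  using test_functions_has_derivative[OF assms] jacobian_works differentiable_def by blast

lemma jacobian_nth:
  fixes f :: "real^'n \<Rightarrow> real^'m"
  shows "jacobian f (at x) $ i $ j = frechet_derivative f (at x) (axis j 1) $ i"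
  by (simp add: jacobian_def matrix_def)

text \<open>Off the closed support the function vanishes on an open set, hence so does its
  derivative. One compact set thus serves the function and its derivatives in every
  integral.\<close>

lemma test_functions_support:
  assumes "f \<in> test_functions \<Omega>"
  obtains S where "compact S" "S \<subseteq> \<Omega>" "\<And>x. x \<notin> S \<Longrightarrow> f x = 0"
    "\<And>x h. x \<notin> S \<Longrightarrow> frechet_derivative f (at x) h = 0"
proof -
  define S where "S = closure {x. f x \<noteq> 0}"
  have S: "compact S" "S \<subseteq> \<Omega>"
    using assms by (simp_all add: test_functions_def S_def)
  have f0: "f x = 0" if "x \<notin> S" for x
    using that closure_subset[of "{x. f x \<noteq> 0}"] unfolding S_def by blast
  have "open (- S)" using S(1) compact_imp_closed by blast
  have d0: "frechet_derivative f (at x) = (\<lambda>h. 0)" if "x \<notin> S" for x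
  proof -
    have "((\<lambda>x. 0) has_derivative frechet_derivative f (at x)) (at x)"
      by (rule has_derivative_transform_within_open[OF test_functions_has_derivative[OF assms]
            \<open>open (- S)\<close>]) (simp_all add: f0 that)
    then show ?thesis
      using has_derivative_const has_derivative_unique by blast
  qed
  show ?thesis
    by (rule that[OF S]) (simp_all add: f0 d0)
qed

lemma test_functions_jacobian_support:
  fixes f :: "real^'n \<Rightarrow> real^'m"
  assumes "f \<in> test_functions \<Omega>"
  obtains S where "compact S" "S \<subseteq> \<Omega>" "\<And>x. x \<notin> S \<Longrightarrow> f x = 0"
    "\<And>x. x \<notin> S \<Longrightarrow> jacobian f (at x) = 0"
proof -
  obtain S where "compact S" "S \<subseteq> \<Omega>" "\<And>x. x \<notin> S \<Longrightarrow> f x = 0"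
    "\<And>x h. x \<notin> S \<Longrightarrow> frechet_derivative f (at x) h = 0"
    using test_functions_support[OF assms] by blast
  then show ?thesis by (intro that[of S]) (simp_all add: vec_eq_iff jacobian_nth)
qed

lemma test_functions_partial:
  assumes "f \<in> test_functions \<Omega>"
  shows "(\<lambda>x. frechet_derivative f (at x) h) \<in> test_functions \<Omega>"
proof -
  obtain S where "compact S" "S \<subseteq> \<Omega>" "\<And>x h. x \<notin> S \<Longrightarrow> frechet_derivative f (at x) h = 0"
    using test_functions_support[OF assms] by metis
  moreover have "C_k k (\<lambda>x. frechet_derivative f (at x) h)" for k
    using test_functions_C_k[OF assms, of "Suc k"] by simp
  ultimately show ?thesis by (intro test_functionsI[where S=S]) auto
qed

lemma test_functions_bounded_linear:
  assumes "bounded_linear L" "f \<in> test_functions \<Omega>"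
  shows "(\<lambda>x. L (f x)) \<in> test_functions \<Omega>"
proof -
  obtain S where "compact S" "S \<subseteq> \<Omega>" "\<And>x h. x \<notin> S \<Longrightarrow> f x = 0"
    using test_functions_support[OF assms(2)] by metis
  then show ?thesis
    using assms by (intro test_functionsI[where S=S])
      (auto intro: C_k_bounded_linear_compose test_functions_C_k simp: linear_simps)
qed

lemma test_functions_jacobian_nth:
  fixes f :: "real^'n \<Rightarrow> real^'m"
  assumes "f \<in> test_functions \<Omega>"
  shows "(\<lambda>x. jacobian f (at x) $ i $ j) \<in> test_functions \<Omega>"
  unfolding jacobian_nth
  by (intro test_functions_bounded_linear[OF bounded_linear_vec_nth] test_functions_partial assms)

lemma test_functions_add:
  assumes "f \<in> test_functions \<Omega>" "g \<in> test_functions \<Omega>"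
  shows "(\<lambda>x. f x + g x) \<in> test_functions \<Omega>"
proof -
  obtain S T where "compact S" "S \<subseteq> \<Omega>" "\<And>x. x \<notin> S \<Longrightarrow> f x = 0"
    "compact T" "T \<subseteq> \<Omega>" "\<And>x. x \<notin> T \<Longrightarrow> g x = 0"
    using assms[THEN test_functions_support] by metis
  then show ?thesis
    using assms by (intro test_functionsI[where S="S \<union> T"]) (auto intro: C_k_add test_functions_C_k)
qed

lemma jacobian_add:
  fixes f g :: "real^'n \<Rightarrow> real^'m"
  assumes "f \<in> test_functions \<Omega>" "g \<in> test_functions \<Omega>"
  shows "jacobian (\<lambda>x. f x + g x) (at x) = jacobian f (at x) + jacobian g (at x)"
  unfolding jacobian_nth[abs_def]
  by (rule jacobian_eqI)
    (auto intro!: has_derivative_add test_functions_has_jacobian assms simp: matrix_vector_mult_add_rdistrib)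

lemma test_functions_continuous_jacobian:
  fixes f :: "real^'n \<Rightarrow> real^'m"
  assumes "f \<in> test_functions \<Omega>"
  shows "continuous_on UNIV (\<lambda>x. jacobian f (at x))"
proof -
  have "continuous_on UNIV (\<lambda>x. \<chi> i j. jacobian f (at x) $ i $ j)"
    by (intro continuous_on_vec_lambda test_functions_continuous[OF test_functions_jacobian_nth[OF assms]])
  then show ?thesis by simp
qed

lemma test_functions_integrable:
  fixes f :: "'a::euclidean_space \<Rightarrow> 'b::euclidean_space"
  assumes "f \<in> test_functions \<Omega>"
  shows "integrable lebesgue f"
  using test_functions_support[OF assms] integrable_compact_support[OF test_functions_continuous[OF assms]]
  by metis

lemma test_functions_jacobian_integrable:
  fixes f :: "real^'n \<Rightarrow> real^'m"
  assumes "f \<in> test_functions \<Omega>"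
  shows "integrable lebesgue (\<lambda>x. jacobian f (at x))"
  using test_functions_jacobian_support[OF assms]
    integrable_compact_support[OF test_functions_continuous_jacobian[OF assms]]
  by metis

lemma test_functions_inner_jacobian_integrable:
  fixes f g :: "real^'n \<Rightarrow> real^'m"
  assumes "f \<in> test_functions \<Omega>" "g \<in> test_functions \<Omega>'"
  shows "integrable lebesgue (\<lambda>x. jacobian f (at x) \<bullet> jacobian g (at x))"
proof -
  obtain S where "compact S" "\<And>x. x \<notin> S \<Longrightarrow> jacobian f (at x) = 0"
    using test_functions_jacobian_support[OF assms(1)] by metis
  then show ?thesis
    by (intro integrable_compact_support[where S=S] continuous_intros
        test_functions_continuous_jacobian[OF assms(1)] test_functions_continuous_jacobian[OF assms(2)]) auto
qed

lemma test_functions_by_parts: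
  fixes f :: "real^'n \<Rightarrow> real"
  assumes f: "\<And>x. (f has_derivative f' x) (at x)" "continuous_on UNIV (\<lambda>x. f' x h)"
    and \<psi>: "\<psi> \<in> test_functions \<Omega>"
  shows "(LINT x|lebesgue. f x * frechet_derivative \<psi> (at x) h) = - (LINT x|lebesgue. f' x h * \<psi> x)"
proof -
  obtain S where "compact S" "\<And>x. x \<notin> S \<Longrightarrow> \<psi> x = 0"
    "\<And>x h. x \<notin> S \<Longrightarrow> frechet_derivative \<psi> (at x) h = 0"
    using test_functions_support[OF \<psi>] by metis
  then show ?thesis
    by (intro integral_by_parts[where S=S] f test_functions_has_derivative[OF \<psi>]
        test_functions_continuous[OF test_functions_partial[OF \<psi>]]) auto
qed

lemma test_functions_jacobian_by_parts:
  fixes v :: "real^'n \<Rightarrow> real^'m"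
  assumes v: "v \<in> test_functions \<Omega>'" and \<psi>: "\<psi> \<in> test_functions \<Omega>"
  shows "(LINT x|lebesgue. v x $ i * frechet_derivative \<psi> (at x) (axis j 1)) =
    - (LINT x|lebesgue. jacobian v (at x) $ i $ j * \<psi> x)"
  unfolding jacobian_nth
  by (rule test_functions_by_parts[OF _ _ \<psi>])
    (intro bounded_linear.has_derivative[OF bounded_linear_vec_nth] test_functions_has_derivative[OF v]
      test_functions_continuous[OF test_functions_bounded_linear[OF bounded_linear_vec_nth
          test_functions_partial[OF v]]])+

lemma inner_matrix: "A \<bullet> B = (\<Sum>i\<in>UNIV. \<Sum>j\<in>UNIV. A $ i $ j * (B::real^'n^'m) $ i $ j)"
  by (simp add: inner_vec_def)

text \<open>Moving one derivative from \<open>w\<close> onto \<open>v\<close> leaves only the size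
  of \<open>w\<close>. The constant sums the L1 norms of second partial derivatives of
  \<open>v\<close>; it depends on \<open>v\<close> but not on \<open>w\<close>, so small amplitude
  alone makes the gradient of \<open>w\<close> nearly orthogonal to that of
  \<open>v\<close>.\<close>

lemma jacobian_inner_integral_bound:
  fixes v :: "real^'n \<Rightarrow> real^'m"
  assumes v: "v \<in> test_functions \<Omega>"
  obtains C where "C \<ge> 0"
    "\<And>w e. w \<in> test_functions \<Omega>' \<Longrightarrow> (\<And>x. norm (w x) \<le> e) \<Longrightarrow>
      \<bar>LINT x|lebesgue. jacobian v (at x) \<bullet> jacobian w (at x)\<bar> \<le> C * e"
proof -
  define D where "D = (\<lambda>i j x. frechet_derivative (\<lambda>x. jacobian v (at x) $ i $ j) (at x) (axis j 1))"
  define C where "C = (\<Sum>i\<in>UNIV. \<Sum>j\<in>UNIV. LINT x|lebesgue. \<bar>D i j x\<bar>)"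
  have tfD: "D i j \<in> test_functions \<Omega>" for i j
    unfolding D_def by (intro test_functions_partial test_functions_jacobian_nth v)
  have "C \<ge> 0" unfolding C_def by (intro sum_nonneg integral_nonneg_AE) auto
  moreover have "\<bar>LINT x|lebesgue. jacobian v (at x) \<bullet> jacobian w (at x)\<bar> \<le> C * e"
    if w: "w \<in> test_functions \<Omega>'" and e: "\<And>x. norm (w x) \<le> e" for w e
  proof -
    let ?p = "\<lambda>i j x. jacobian v (at x) $ i $ j * jacobian w (at x) $ i $ j"
    have wi: "(\<lambda>x. w x $ i) \<in> test_functions \<Omega>'" for i
      by (intro test_functions_bounded_linear[OF bounded_linear_vec_nth] w)
    have fw: "frechet_derivative (\<lambda>x. w x $ i) (at x) h = frechet_derivative w (at x) h $ i" for i x h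
      using frechet_derivative_at[OF bounded_linear.has_derivative[OF bounded_linear_vec_nth
          test_functions_has_derivative[OF w]], of x i]
      by (metis (no_types))
    have int: "integrable lebesgue (?p i j)" for i j
    proof -
      obtain S where "compact S" "\<And>x. x \<notin> S \<Longrightarrow> jacobian v (at x) = 0"
        using test_functions_jacobian_support[OF v] by metis
      then show ?thesis
        by (intro integrable_compact_support[where S=S] continuous_on_mult
            test_functions_continuous[OF test_functions_jacobian_nth[OF v]]
            test_functions_continuous[OF test_functions_jacobian_nth[OF w]]) auto
    qed
    have bnd: "\<bar>LINT x|lebesgue. ?p i j x\<bar> \<le> (LINT x|lebesgue. \<bar>D i j x\<bar>) * e" for i j
    proof -
      have "(LINT x|lebesgue. ?p i j x) = - (LINT x|lebesgue. D i j x * w x $ i)"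
        using test_functions_by_parts[OF test_functions_has_derivative[OF test_functions_jacobian_nth[OF v]]
            test_functions_continuous[OF test_functions_partial[OF test_functions_jacobian_nth[OF v]]] wi]
        unfolding D_def fw jacobian_nth[of w] .
      moreover have "\<bar>LINT x|lebesgue. D i j x * w x $ i\<bar> \<le> (LINT x|lebesgue. \<bar>D i j x\<bar> * e)"
      proof (rule order_trans[OF integral_abs_bound integral_mono])
        obtain S where "compact S" "\<And>x. x \<notin> S \<Longrightarrow> D i j x = 0"
          using test_functions_support[OF tfD] by metis
        then show "integrable lebesgue (\<lambda>x. \<bar>D i j x * w x $ i\<bar>)"
          by (intro integrable_compact_support[where S=S] continuous_intros
              test_functions_continuous[OF tfD] test_functions_continuous[OF wi]) auto
        show "integrable lebesgue (\<lambda>x. \<bar>D i j x\<bar> * e)"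
          using test_functions_integrable[OF tfD] by (intro integrable_mult_left) auto
        show "\<bar>D i j x * w x $ i\<bar> \<le> \<bar>D i j x\<bar> * e" for x
          using order_trans[OF component_le_norm_cart e, of x i]
          by (simp add: abs_mult mult_left_mono)
      qed
      ultimately show ?thesis by simp
    qed
    have "(LINT x|lebesgue. jacobian v (at x) \<bullet> jacobian w (at x)) =
        (\<Sum>i\<in>UNIV. \<Sum>j\<in>UNIV. LINT x|lebesgue. ?p i j x)"
      unfolding inner_matrix using int by (simp add: Bochner_Integration.integral_sum)
    also have "\<bar>\<dots>\<bar> \<le> (\<Sum>i\<in>UNIV. \<Sum>j\<in>UNIV. \<bar>LINT x|lebesgue. ?p i j x\<bar>)"
      by (intro order_trans[OF sum_abs] sum_mono sum_abs)
    also have "\<dots> \<le> (\<Sum>i\<in>UNIV. \<Sum>j\<in>UNIV. (LINT x|lebesgue. \<bar>D i j x\<bar>) * e)"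
      by (intro sum_mono bnd)
    also have "\<dots> = C * e" by (simp add: C_def sum_distrib_right)
    finally show ?thesis .
  qed
  ultimately show ?thesis using that by blast
qed

subsection \<open>Oscillating perturbations\<close>

definition rank_one :: "real^'m \<Rightarrow> real^'n \<Rightarrow> real^'n^'m" where
  "rank_one a n = (\<chi> i j. a $ i * n $ j)"

lemma rank_one_mult_vec: "rank_one a n *v h = (n \<bullet> h) *\<^sub>R a"
  by (simp add: rank_one_def vec_eq_iff matrix_vector_mult_def inner_vec_def sum_distrib_left
      sum_distrib_right mult_ac)

lemma inner_rank_one: "rank_one a n \<bullet> rank_one b m = (a \<bullet> b) * (n \<bullet> m)"
  unfolding inner_matrix rank_one_def inner_vec_def sum_product by (simp add: mult_ac)

lemma norm_rank_one: "norm (rank_one a n) = norm a * norm n"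
  by (simp add: norm_eq_sqrt_inner inner_rank_one real_sqrt_mult)

lemma rank_one_add_right: "rank_one a (n + m) = rank_one a n + rank_one a m"
  by (simp add: rank_one_def vec_eq_iff algebra_simps)

lemma rank_one_scaleR_right: "rank_one a (s *\<^sub>R n) = s *\<^sub>R rank_one a n"
  by (simp add: rank_one_def vec_eq_iff)

text \<open>Measures the room for oscillation. As \<open>n\<close> is a unit vector,
  \<open>norm a\<close> is half the length of the segment, and the segment is symmetric because the
  slope of a bounded wave takes both signs.\<close>

definition splits :: "(real^'n^'m) set \<Rightarrow> real \<Rightarrow> real^'n^'m \<Rightarrow> bool" where
  "splits K c \<xi> \<longleftrightarrow> (\<exists>a n. norm n = 1 \<and> c \<le> norm a \<and> (\<forall>s\<in>{-1..1}. \<xi> + s *\<^sub>R rank_one a n \<in> K))"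

definition energy :: "(real^'n \<Rightarrow> real^'m) \<Rightarrow> real" where
  "energy w = (LINT x|lebesgue. jacobian w (at x) \<bullet> jacobian w (at x))"

text \<open>A compact segment in an open set carries a tube of positive width. The width later
  absorbs both the variation of the gradient over a ball and the error of a cut-off.\<close>

lemma segment_neighbourhood:
  fixes \<xi> R :: "'a::euclidean_space"
  assumes "open K" "\<forall>s\<in>{-1..1}. \<xi> + s *\<^sub>R R \<in> K"
  obtains \<eta> where "\<eta> > 0" "\<And>\<zeta> s. dist \<zeta> \<xi> < \<eta> \<Longrightarrow> s \<in> {-1..1} \<Longrightarrow> \<zeta> + s *\<^sub>R R \<in> K"
proof -
  let ?A = "(\<lambda>s. \<xi> + s *\<^sub>R R) ` {-1..1}"
  have "compact ?A"
    by (intro compact_continuous_image continuous_intros) auto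
  then obtain \<eta> where \<eta>: "\<eta> > 0" "(\<Union>x\<in>?A. ball x \<eta>) \<subseteq> K"
    using compact_subset_open_imp_ball_epsilon_subset[of ?A K] assms by auto
  have "\<zeta> + s *\<^sub>R R \<in> K" if "dist \<zeta> \<xi> < \<eta>" "s \<in> {-1..1}" for \<zeta> s
  proof -
    have "\<zeta> + s *\<^sub>R R \<in> ball (\<xi> + s *\<^sub>R R) \<eta>"
      using that(1) by (simp add: dist_norm norm_minus_commute)
    then show ?thesis using \<eta>(2) that(2) by blast
  qed
  then show ?thesis using \<eta>(1) that by blast
qed

lemma open_splits:
  fixes K :: "(real^'n^'m) set"
  assumes "open K"
  shows "open {\<xi>. splits K c \<xi>}"
proof (subst open_dist, intro ballI)
  fix \<xi> assume "\<xi> \<in> {\<xi>. splits K c \<xi>}"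
  then obtain a n where an: "norm n = 1" "c \<le> norm a" "\<forall>s\<in>{-1..1}. \<xi> + s *\<^sub>R rank_one a n \<in> K"
    by (auto simp: splits_def)
  obtain \<eta> where "\<eta> > 0" "\<And>\<zeta> s. dist \<zeta> \<xi> < \<eta> \<Longrightarrow> s \<in> {-1..1} \<Longrightarrow> \<zeta> + s *\<^sub>R rank_one a n \<in> K"
    using segment_neighbourhood[OF assms an(3)] by blast
  then show "\<exists>e>0. \<forall>y. dist y \<xi> < e \<longrightarrow> y \<in> {\<xi>. splits K c \<xi>}"
    using an(1,2) unfolding splits_def by blast
qed

text \<open>The standard smooth mollifier profile, left unnormalised so that its values stay in
  [0,1].\<close>

definition bump :: "'a::euclidean_space \<Rightarrow> real \<Rightarrow> 'a \<Rightarrow> real" where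
  "bump x0 r x = flat_exp 0 (1 - (x - x0) \<bullet> (x - x0) / r\<^sup>2)"

lemma bump_nonneg: "0 \<le> bump x0 r x" and bump_le_1: "bump x0 r x \<le> 1"
  by (auto simp: bump_def flat_exp_def)

lemma bump_outside: "r > 0 \<Longrightarrow> x \<notin> ball x0 r \<Longrightarrow> bump x0 r x = 0"
proof -
  assume r: "r > 0" and "x \<notin> ball x0 r"
  then have "r\<^sup>2 \<le> (norm (x - x0))\<^sup>2"
    by (intro power_mono) (auto simp: dist_norm norm_minus_commute)
  then show ?thesis
    using r by (simp add: bump_def flat_exp_def power2_norm_eq_inner)
qed

lemma bump_outside_cball: "r > 0 \<Longrightarrow> x \<notin> cball x0 r \<Longrightarrow> bump x0 r x = 0"
  by (rule bump_outside) auto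

lemma bump_half_ball: "r > 0 \<Longrightarrow> x \<in> ball x0 (r / 2) \<Longrightarrow> exp (- 2) \<le> bump x0 r x"
proof -
  assume r: "r > 0" and x: "x \<in> ball x0 (r / 2)"
  then have "(norm (x - x0))\<^sup>2 \<le> (r / 2)\<^sup>2"
    by (intro power_mono) (auto simp: dist_norm norm_minus_commute)
  then have *: "(x - x0) \<bullet> (x - x0) / r\<^sup>2 \<le> 1/4"
    using r by (simp add: power2_norm_eq_inner field_simps)
  define u where "u = 1 - (x - x0) \<bullet> (x - x0) / r\<^sup>2"
  have u: "3/4 \<le> u" using * by (simp add: u_def)
  \<comment> \<open>The exponent is thus at least -4/3; \<open>exp (- 2)\<close> is a rounder lower
    bound.\<close>
  then have "inverse u \<le> inverse (3/4)"
    by (intro le_imp_inverse_le) auto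
  then show ?thesis using u unfolding bump_def u_def[symmetric] by (auto simp: flat_exp_def)
qed

lemma C_k_bump: "C_k k (bump x0 r)"
proof -
  have "C_k k (\<lambda>x. 1 + (- inverse (r\<^sup>2)) * ((x + - x0) \<bullet> (x + - x0)))"
    by (intro C_k_add C_k_mult C_k_const C_k_inner C_k_id)
  from C_k_compose_real[OF C_k_flat_exp[of k 0] this]
  show ?thesis
    unfolding bump_def[abs_def] by (simp add: divide_inverse mult.commute)
qed

lemma bump_test_function: "r > 0 \<Longrightarrow> bump x0 r \<in> test_functions (cball x0 r)"
  by (rule test_functionsI[where S="cball x0 r"]) (auto intro: C_k_bump bump_outside)

text \<open>The ball of half the radius has the fraction 1 / 2^n of the volume, and there the
  squared cut-off is at least exp(-4). The point is that this fraction does not depend on centre and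
  radius.\<close>

definition bump_mass :: "'n::finite itself \<Rightarrow> real" where
  "bump_mass _ = exp (- 4) / 2 ^ CARD('n)"

lemma bump_mass_pos: "bump_mass TYPE('n::finite) > 0"
  by (simp add: bump_mass_def)

lemma integral_bump_square:
  fixes x0 :: "real^'n"
  assumes "r > 0"
  shows "bump_mass TYPE('n) * measure lebesgue (cball x0 r) \<le> (LINT x|lebesgue. (bump x0 r x)\<^sup>2)"
proof -
  have "bump_mass TYPE('n) * measure lebesgue (cball x0 r) = exp (- 4) * measure lebesgue (ball x0 (r / 2))"
    using assms content_ball_conv_unit_ball[of "r/2" x0] content_ball_conv_unit_ball[of r x0] content_cball_conv_ball[of x0 r]
    by (simp add: bump_mass_def power_divide)
  also have "\<dots> = (LINT x|lebesgue. exp (- 4) * indicator (ball x0 (r / 2)) x)"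
    by simp
  also have "\<dots> \<le> (LINT x|lebesgue. (bump x0 r x)\<^sup>2)"
  proof (rule integral_mono)
    show "integrable lebesgue (\<lambda>x. exp (- 4) * indicat_real (ball x0 (r / 2)) x)"
      by (intro integrable_mult_right) (simp add: lmeasurable_iff_integrable[symmetric])
    show "integrable lebesgue (\<lambda>x. (bump x0 r x)\<^sup>2)"
      by (intro integrable_compact_support[where S="cball x0 r"] continuous_intros
          C_k_continuous[OF C_k_bump]) (simp_all add: bump_outside_cball[OF assms])
    show "exp (- 4) * indicat_real (ball x0 (r / 2)) x \<le> (bump x0 r x)\<^sup>2" for x
    proof (cases "x \<in> ball x0 (r / 2)")
      case True
      have "exp (- 4) = (exp (- 2 :: real))\<^sup>2" by (simp add: exp_double[symmetric])
      also have "\<dots> \<le> (bump x0 r x)\<^sup>2"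
        using bump_half_ball[OF assms True] by (intro power_mono) auto
      finally show ?thesis using True by simp
    qed simp
  qed
  finally show ?thesis .
qed

text \<open>The perturbation is a plane wave p(N n.x) / N in direction \<open>a\<close>, cut off by
  a bump. Its gradient is \<open>rank_one a n\<close> with a coefficient in [-1,1], plus a term of
  order 1 / N from the gradient of the cut-off. The coefficient stays on the segment, the other term
  fits into the tube, and the amplitude is of order 1 / N too.\<close>

lemma oscillation:
  fixes H :: "real^'n \<Rightarrow> real^'n^'m" and a :: "real^'m" and n :: "real^'n"
  assumes r: "r > 0" and n: "norm n = 1" and \<eta>: "\<eta> > 0" and e: "e > 0"
    and K: "\<And>x s \<zeta>. x \<in> cball x0 r \<Longrightarrow> s \<in> {-1..1} \<Longrightarrow> dist \<zeta> (H x) < \<eta> \<Longrightarrow>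
      \<zeta> + s *\<^sub>R rank_one a n \<in> K"
  obtains w where "w \<in> test_functions (cball x0 r)" "\<And>x. norm (w x) \<le> e"
    "\<And>x. x \<in> cball x0 r \<Longrightarrow> H x + jacobian w (at x) \<in> K"
    "bump_mass TYPE('n) / 4 * (norm a)\<^sup>2 * measure lebesgue (cball x0 r) \<le> energy w"
proof -
  let ?\<chi> = "bump x0 r" and ?B = "cball x0 r"
  note tf = bump_test_function[OF r, of x0]
  define g where "g = (\<lambda>x. \<chi> j. frechet_derivative ?\<chi> (at x) (axis j 1))"
  have g_cont: "continuous_on UNIV g"
    unfolding g_def by (intro continuous_on_vec_lambda test_functions_continuous[OF test_functions_partial[OF tf]])
  obtain S where S: "compact S" "S \<subseteq> ?B" "\<And>x h. x \<notin> S \<Longrightarrow> frechet_derivative ?\<chi> (at x) h = 0"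
    using test_functions_support[OF tf] by metis
  have g0: "g x = 0" if "x \<notin> S" for x
    using S(3)[OF that] by (simp add: g_def vec_eq_iff)
  obtain M where M: "M > 0" "\<And>x. norm (g x) \<le> M"
    using bounded_compact_support[OF g_cont S(1) g0] by blast
  have g: "(?\<chi> has_derivative (\<lambda>h. g x \<bullet> h)) (at x)" for x
  proof -
    have "frechet_derivative ?\<chi> (at x) h = g x \<bullet> h" for h
    proof -
      have lin: "linear (frechet_derivative ?\<chi> (at x))"
        using test_functions_has_derivative[OF tf] has_derivative_linear by blast
      have "frechet_derivative ?\<chi> (at x) h =
          frechet_derivative ?\<chi> (at x) (\<Sum>j\<in>UNIV. h $ j *\<^sub>R axis j 1)"
        using basis_expansion[of h] by (simp add: scalar_mult_eq_scaleR)
      also have "\<dots> = g x \<bullet> h"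
        by (simp add: linear_sum[OF lin] linear_scale[OF lin] g_def inner_vec_def mult.commute)
      finally show ?thesis .
    qed
    then show ?thesis
      using test_functions_has_derivative[OF tf, of x] ext[of "frechet_derivative ?\<chi> (at x)"] by metis
  qed
  \<comment> \<open>One summand per demand: amplitude at most \<open>e\<close>, cut-off error below
    \<eta>, loss of energy at most half of the bump mass. The summand 1 keeps \<open>N\<close>
    positive and makes the second bound strict.\<close>
  define N where "N = 1 + norm a / e + norm a * M / \<eta> + 8 * M / bump_mass TYPE('n)"
  have mass: "bump_mass TYPE('n) > 0" by (rule bump_mass_pos)
  have N: "N \<ge> 1" "norm a / e \<le> N" "norm a * M / \<eta> < N" "8 * M / bump_mass TYPE('n) \<le> N"
    using \<eta> e M(1) mass unfolding N_def by (simp_all add: add_pos_nonneg)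
  have N': "norm a / N \<le> e" "norm a * M / N < \<eta>" "4 * M / N \<le> bump_mass TYPE('n) / 2"
    using N \<eta> e mass by (simp_all add: field_simps)
  \<comment> \<open>Stated for any bounded phase \<open>p\<close> with bounded derivative
    \<open>q\<close>, because two phases are compared at the end.\<close>
  have wave: "\<exists>w. w \<in> test_functions ?B \<and> (\<forall>x. norm (w x) \<le> e) \<and>
      (\<forall>x\<in>?B. H x + jacobian w (at x) \<in> K) \<and>
      (LINT x|lebesgue. (norm a)\<^sup>2 * ((q (N * (n \<bullet> x)) * ?\<chi> x)\<^sup>2 - 2 * M / N * indicator ?B x)) \<le> energy w"
    if p: "\<And>k. C_k k p" "\<And>t. \<bar>p t\<bar> \<le> 1" and pq: "\<And>t. (p has_real_derivative q t) (at t)"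
      and q: "\<And>k. C_k k q" "\<And>t. \<bar>q t\<bar> \<le> 1" for p q :: "real \<Rightarrow> real"
  proof (intro exI conjI allI ballI)
    define w where "w = (\<lambda>x. (p (N * (n \<bullet> x)) / N * ?\<chi> x) *\<^sub>R a)"
    define d where "d = (\<lambda>x. (q (N * (n \<bullet> x)) * ?\<chi> x) *\<^sub>R n + (p (N * (n \<bullet> x)) / N) *\<^sub>R g x)"
    have Ck: "C_k k (\<lambda>x. N * (n \<bullet> x))" for k
      by (intro C_k_mult C_k_const C_k_inner C_k_id)
    have phase: "C_k k (\<lambda>x. p (N * (n \<bullet> x)))" "C_k k (\<lambda>x. q (N * (n \<bullet> x)))" for k
      using C_k_compose_real[OF p(1) Ck] C_k_compose_real[OF q(1) Ck] by auto
    show w: "w \<in> test_functions ?B"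
    proof (rule test_functionsI[where S="?B"])
      show "C_k k w" for k
        unfolding w_def divide_inverse
        by (intro C_k_scaleR C_k_mult C_k_const C_k_bump phase)
    qed (auto simp: w_def bump_outside_cball[OF r])
    have wn: "norm (w x) \<le> norm a / N" for x
    proof -
      have "\<bar>p (N * (n \<bullet> x))\<bar> * ?\<chi> x \<le> 1 * 1"
        by (intro mult_mono p(2) bump_le_1 bump_nonneg) auto
      then have "\<bar>p (N * (n \<bullet> x))\<bar> * ?\<chi> x * (norm a / N) \<le> 1 * (norm a / N)"
        using N(1) by (intro mult_right_mono) auto
      then show ?thesis
        using N(1) bump_nonneg[of x0 r x] by (simp add: w_def abs_mult)
    qed
    then show "norm (w x) \<le> e" for x
      using N'(1) order_trans by blast
    have jac: "jacobian w (at x) = rank_one a (d x)" for x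
    proof (rule jacobian_eqI)
      have "((\<lambda>x. p (N * (n \<bullet> x))) has_derivative (\<lambda>h. q (N * (n \<bullet> x)) * (N * (n \<bullet> h)))) (at x)"
        by (rule has_derivative_compose[OF _ pq[unfolded has_field_derivative_def]])
          (auto intro!: derivative_eq_intros)
      from bounded_linear.has_derivative[OF bounded_linear_divide[of N] this]
      have "(w has_derivative (\<lambda>h. (p (N * (n \<bullet> x)) / N * (g x \<bullet> h) +
          q (N * (n \<bullet> x)) * (N * (n \<bullet> h)) / N * ?\<chi> x) *\<^sub>R a)) (at x)"
        unfolding w_def by (intro has_derivative_scaleR_left has_derivative_mult g)
      moreover have "(\<lambda>h. (p (N * (n \<bullet> x)) / N * (g x \<bullet> h) +
          q (N * (n \<bullet> x)) * (N * (n \<bullet> h)) / N * ?\<chi> x) *\<^sub>R a) = (\<lambda>h. rank_one a (d x) *v h)"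
        using N(1) by (auto simp: rank_one_mult_vec d_def inner_add_left fun_eq_iff algebra_simps)
      ultimately show "(w has_derivative (\<lambda>h. rank_one a (d x) *v h)) (at x)" by simp
    qed
    show "H x + jacobian w (at x) \<in> K" if "x \<in> ?B" for x
    proof -
      let ?s = "q (N * (n \<bullet> x)) * ?\<chi> x" and ?R = "rank_one a ((p (N * (n \<bullet> x)) / N) *\<^sub>R g x)"
      have "\<bar>?s\<bar> \<le> 1 * 1"
        unfolding abs_mult by (intro mult_mono q(2)) (auto simp: bump_le_1 bump_nonneg)
      then have s: "?s \<in> {-1..1}" by (auto simp: abs_le_iff)
      have "norm ?R = norm a * norm (g x) * \<bar>p (N * (n \<bullet> x))\<bar> / N"
        using N(1) by (simp add: norm_rank_one)
      also have "\<dots> \<le> norm a * M * 1 / N"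
        using N(1) M by (intro divide_right_mono mult_mono p(2)) (auto intro: mult_nonneg_nonneg)
      also have "\<dots> < \<eta>" using N'(2) by simp
      finally have "dist (H x + ?R) (H x) < \<eta>" by (simp add: dist_norm)
      from K[OF that s this] show ?thesis
        by (simp add: jac d_def rank_one_add_right rank_one_scaleR_right add_ac)
    qed
    show "(LINT x|lebesgue. (norm a)\<^sup>2 * ((q (N * (n \<bullet> x)) * ?\<chi> x)\<^sup>2 - 2 * M / N * indicator ?B x)) \<le> energy w"
      unfolding energy_def
    proof (rule integral_mono)
      have "integrable lebesgue (\<lambda>x. (q (N * (n \<bullet> x)) * ?\<chi> x)\<^sup>2)"
        by (intro integrable_compact_support[where S="?B"] continuous_intros
            C_k_continuous[OF C_k_bump] C_k_continuous[OF phase(2)])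
          (simp_all add: bump_outside_cball[OF r])
      then show "integrable lebesgue (\<lambda>x. (norm a)\<^sup>2 *
          ((q (N * (n \<bullet> x)) * ?\<chi> x)\<^sup>2 - 2 * M / N * indicat_real ?B x))"
        by (intro integrable_mult_right integrable_diff) (simp_all add: lmeasurable_iff_integrable[symmetric])
      show "integrable lebesgue (\<lambda>x. jacobian w (at x) \<bullet> jacobian w (at x))"
        by (rule test_functions_inner_jacobian_integrable[OF w w])
      show "(norm a)\<^sup>2 * ((q (N * (n \<bullet> x)) * ?\<chi> x)\<^sup>2 - 2 * M / N * indicat_real ?B x)
          \<le> jacobian w (at x) \<bullet> jacobian w (at x)" for x
      proof -
        let ?s = "q (N * (n \<bullet> x)) * ?\<chi> x" and ?t = "p (N * (n \<bullet> x)) / N"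
        have nn: "n \<bullet> n = 1" using n by (simp add: norm_eq_1)
        \<comment> \<open>In the expanded square only the mixed term can be negative. It is at most
          M / N in absolute value and lives in the ball; the square of the error term is simply
          dropped.\<close>
        have "\<bar>?s * (?t * (n \<bullet> g x))\<bar> \<le> indicat_real ?B x * (1 / N * M)"
          unfolding abs_mult
        proof (rule mult_mono)
          show "\<bar>q (N * (n \<bullet> x))\<bar> * \<bar>?\<chi> x\<bar> \<le> indicat_real ?B x"
          proof (cases "x \<in> ?B")
            case True
            have "\<bar>q (N * (n \<bullet> x))\<bar> * \<bar>?\<chi> x\<bar> \<le> 1 * 1"
              by (intro mult_mono q(2)) (auto simp: bump_le_1 bump_nonneg)
            then show ?thesis using True by simp
          qed (simp add: bump_outside_cball[OF r])
          have "\<bar>n \<bullet> g x\<bar> \<le> M"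
            using Cauchy_Schwarz_ineq2[of n "g x"] n M(2)[of x] by simp
          then show "\<bar>?t\<bar> * \<bar>n \<bullet> g x\<bar> \<le> 1 / N * M"
            using N(1) p(2) by (intro mult_mono) (auto intro: divide_right_mono)
        qed auto
        then have "- (indicat_real ?B x * (1 / N * M)) \<le> ?s * (?t * (n \<bullet> g x))"
          by linarith
        moreover have "d x \<bullet> d x = ?s\<^sup>2 + 2 * (?s * (?t * (n \<bullet> g x))) + ?t\<^sup>2 * (g x \<bullet> g x)"
        proof -
          have "(s *\<^sub>R n + t *\<^sub>R g x) \<bullet> (s *\<^sub>R n + t *\<^sub>R g x) =
              s\<^sup>2 + 2 * (s * (t * (n \<bullet> g x))) + t\<^sup>2 * (g x \<bullet> g x)" for s t
            by (simp add: inner_add_left inner_add_right nn inner_commute[of "g x" n]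
                power2_eq_square algebra_simps)
          then show ?thesis unfolding d_def .
        qed
        moreover have "0 \<le> ?t\<^sup>2 * (g x \<bullet> g x)" by simp
        moreover have "2 * M / N * indicat_real ?B x = 2 * (indicat_real ?B x * (1 / N * M))" by simp
        ultimately have "?s\<^sup>2 - 2 * M / N * indicat_real ?B x \<le> d x \<bullet> d x" by linarith
        then show ?thesis
          unfolding jac inner_rank_one power2_norm_eq_inner by (intro mult_left_mono) auto
      qed
    qed
  qed
  \<comment> \<open>The squares of the two phases add up to the square of the cut-off, so one of them carries half of it.\<close>
  obtain w1 where w1: "w1 \<in> test_functions ?B" "\<forall>x. norm (w1 x) \<le> e"
      "\<forall>x\<in>?B. H x + jacobian w1 (at x) \<in> K"
      "(LINT x|lebesgue. (norm a)\<^sup>2 * ((cos (N * (n \<bullet> x)) * ?\<chi> x)\<^sup>2 - 2 * M / N * indicator ?B x)) \<le> energy w1"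
    using wave[of sin cos] by (auto simp: C_k_sin_cos DERIV_sin)
  have mcos: "C_k k (\<lambda>t. - sin t :: real)" for k
    using C_k_bounded_linear_compose[OF bounded_linear_minus[OF bounded_linear_ident] C_k_sin_cos(1)] .
  obtain w2 where w2: "w2 \<in> test_functions ?B" "\<forall>x. norm (w2 x) \<le> e"
      "\<forall>x\<in>?B. H x + jacobian w2 (at x) \<in> K"
      "(LINT x|lebesgue. (norm a)\<^sup>2 * ((- sin (N * (n \<bullet> x)) * ?\<chi> x)\<^sup>2 - 2 * M / N * indicator ?B x)) \<le> energy w2"
    using wave[of cos "\<lambda>t. - sin t"] by (auto simp: C_k_sin_cos mcos DERIV_cos)
  have cont: "continuous_on UNIV (\<lambda>x. cos (N * (n \<bullet> x)) * ?\<chi> x)" "continuous_on UNIV (\<lambda>x. - sin (N * (n \<bullet> x)) * ?\<chi> x)"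
    by (intro continuous_intros C_k_continuous[OF C_k_bump])+
  have int: "integrable lebesgue (\<lambda>x. (f x)\<^sup>2)"
    if "continuous_on UNIV f" "\<And>x. x \<notin> ?B \<Longrightarrow> f x = 0" for f :: "real^'n \<Rightarrow> real"
    using that by (intro integrable_compact_support[where S="?B"] continuous_intros) auto
  have intB: "integrable lebesgue (\<lambda>x. 2 * M / N * indicat_real ?B x)"
    by (simp add: lmeasurable_iff_integrable[symmetric])
  have "2 * (bump_mass TYPE('n) / 4 * (norm a)\<^sup>2 * measure lebesgue ?B) =
      (norm a)\<^sup>2 * ((bump_mass TYPE('n) - bump_mass TYPE('n) / 2) * measure lebesgue ?B)"
    by simp
  also have "\<dots> \<le> (norm a)\<^sup>2 * ((bump_mass TYPE('n) - 4 * M / N) * measure lebesgue ?B)"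
    using N'(3) by (intro mult_left_mono mult_right_mono) auto
  also have "\<dots> \<le> (norm a)\<^sup>2 * ((LINT x|lebesgue. (?\<chi> x)\<^sup>2) - 4 * M / N * measure lebesgue ?B)"
    using integral_bump_square[OF r, of x0] by (intro mult_left_mono) (auto simp: algebra_simps)
  also have "(LINT x|lebesgue. (?\<chi> x)\<^sup>2) =
      (LINT x|lebesgue. (cos (N * (n \<bullet> x)) * ?\<chi> x)\<^sup>2 + (- sin (N * (n \<bullet> x)) * ?\<chi> x)\<^sup>2)"
    by (intro Bochner_Integration.integral_cong refl)
      (simp add: power_mult_distrib flip: distrib_right)
  also have "\<dots> = (LINT x|lebesgue. (cos (N * (n \<bullet> x)) * ?\<chi> x)\<^sup>2) +
      (LINT x|lebesgue. (- sin (N * (n \<bullet> x)) * ?\<chi> x)\<^sup>2)"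
    by (intro Bochner_Integration.integral_add int cont) (auto simp: bump_outside_cball[OF r])
  also have "(norm a)\<^sup>2 * (\<dots> - 4 * M / N * measure lebesgue ?B) =
    (LINT x|lebesgue. (norm a)\<^sup>2 * ((cos (N * (n \<bullet> x)) * ?\<chi> x)\<^sup>2 - 2 * M / N * indicator ?B x)) +
    (LINT x|lebesgue. (norm a)\<^sup>2 * ((- sin (N * (n \<bullet> x)) * ?\<chi> x)\<^sup>2 - 2 * M / N * indicator ?B x))"
  proof -
    have "(LINT x|lebesgue. (norm a)\<^sup>2 * ((f x)\<^sup>2 - 2 * M / N * indicat_real ?B x)) =
        (norm a)\<^sup>2 * ((LINT x|lebesgue. (f x)\<^sup>2) - 2 * M / N * measure lebesgue ?B)"
      if "continuous_on UNIV f" "\<And>x. x \<notin> ?B \<Longrightarrow> f x = 0" for f :: "real^'n \<Rightarrow> real"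
      using int[OF that] intB by simp
    note J = this
    have J1: "(LINT x|lebesgue. (norm a)\<^sup>2 * ((cos (N * (n \<bullet> x)) * ?\<chi> x)\<^sup>2 - 2 * M / N * indicat_real ?B x)) =
        (norm a)\<^sup>2 * ((LINT x|lebesgue. (cos (N * (n \<bullet> x)) * ?\<chi> x)\<^sup>2) - 2 * M / N * measure lebesgue ?B)"
      by (rule J[OF cont(1)]) (simp add: bump_outside_cball[OF r])
    have J2: "(LINT x|lebesgue. (norm a)\<^sup>2 * ((- sin (N * (n \<bullet> x)) * ?\<chi> x)\<^sup>2 - 2 * M / N * indicat_real ?B x)) =
        (norm a)\<^sup>2 * ((LINT x|lebesgue. (- sin (N * (n \<bullet> x)) * ?\<chi> x)\<^sup>2) - 2 * M / N * measure lebesgue ?B)"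
      by (rule J[OF cont(2)]) (simp add: bump_outside_cball[OF r])
    show ?thesis unfolding J1 J2 by (simp add: algebra_simps)
  qed
  also have "\<dots> \<le> energy w1 + energy w2" using w1(4) w2(4) by simp
  finally have "bump_mass TYPE('n) / 4 * (norm a)\<^sup>2 * measure lebesgue ?B \<le> energy w1 \<or>
      bump_mass TYPE('n) / 4 * (norm a)\<^sup>2 * measure lebesgue ?B \<le> energy w2"
    by linarith
  then show thesis
    using that[of w1] that[of w2] w1(1-3) w2(1-3) by blast
qed

section \<open>Energy gained on finitely many disjoint balls\<close>

lemma energy_nonneg: "0 \<le> energy w"
  unfolding energy_def by (intro integral_nonneg_AE) auto

lemma energy_zero: "energy (\<lambda>x :: real^'n. 0 :: real^'m) = 0"
proof -
  have "jacobian (\<lambda>x. 0 :: real^'m) (at x) = 0" for x :: "real^'n"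
    by (rule jacobian_eqI) simp
  then show ?thesis by (simp add: energy_def)
qed

lemma test_functions_outside:
  fixes f :: "real^'n \<Rightarrow> real^'m"
  assumes "f \<in> test_functions \<Omega>" "x \<notin> \<Omega>"
  shows "f x = 0" "jacobian f (at x) = 0"
proof -
  obtain S where "compact S" and S: "S \<subseteq> \<Omega>" "\<And>x. x \<notin> S \<Longrightarrow> f x = 0"
      "\<And>x. x \<notin> S \<Longrightarrow> jacobian f (at x) = 0"
    by (rule test_functions_jacobian_support[OF assms(1)]) (rule that)
  have "x \<notin> S" using S(1) assms(2) by blast
  from S(2,3)[OF this] show "f x = 0" "jacobian f (at x) = 0" .
qed

lemma energy_add:
  fixes u w :: "real^'n \<Rightarrow> real^'m"
  assumes u: "u \<in> test_functions S" and w: "w \<in> test_functions T"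
  shows "energy (\<lambda>x. u x + w x) =
    energy u + 2 * (LINT x|lebesgue. jacobian u (at x) \<bullet> jacobian w (at x)) + energy w"
proof -
  note jac = jacobian_add[OF test_functions_mono[OF subset_UNIV u] test_functions_mono[OF subset_UNIV w]]
  have "jacobian (\<lambda>x. u x + w x) (at x) \<bullet> jacobian (\<lambda>x. u x + w x) (at x) =
      jacobian u (at x) \<bullet> jacobian u (at x) + 2 * (jacobian u (at x) \<bullet> jacobian w (at x)) +
      jacobian w (at x) \<bullet> jacobian w (at x)" for x
    unfolding jac inner_add_left inner_add_right by (simp add: inner_commute[of "jacobian w (at x)" "jacobian u (at x)"])
  then show ?thesis
    unfolding energy_def
    using test_functions_inner_jacobian_integrable[OF u u] test_functions_inner_jacobian_integrable[OF u w]
      test_functions_inner_jacobian_integrable[OF w w]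
    by simp
qed

text \<open>At each point at most one patch is nonzero. Hence the amplitude bound does not grow, the
  constraint is inherited ball by ball, and all mixed energies vanish.\<close>

lemma disjoint_patches:
  fixes w :: "'i \<Rightarrow> real^'n \<Rightarrow> real^'m"
  assumes "finite F" "pairwise (\<lambda>i j. disjnt (C i) (C j)) F"
    and "\<And>i. i \<in> F \<Longrightarrow> w i \<in> test_functions (C i)" "\<And>i x. i \<in> F \<Longrightarrow> norm (w i x) \<le> e"
    and "\<And>i x. i \<in> F \<Longrightarrow> x \<in> C i \<Longrightarrow> H x + jacobian (w i) (at x) \<in> K" and e: "0 \<le> e"
  shows "\<exists>u. u \<in> test_functions (\<Union>i\<in>F. C i) \<and> (\<forall>x. norm (u x) \<le> e) \<and>
    (\<forall>x\<in>(\<Union>i\<in>F. C i). H x + jacobian u (at x) \<in> K) \<and> energy u = (\<Sum>i\<in>F. energy (w i))"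
  using assms(1-5)
proof (induction F)
  case empty
  show ?case
    by (rule exI[where x="\<lambda>x. 0"]) (simp add: e test_functions_zero energy_zero)
next
  case (insert i F)
  let ?U = "\<Union>i\<in>F. C i"
  have "\<exists>u. u \<in> test_functions ?U \<and> (\<forall>x. norm (u x) \<le> e) \<and>
      (\<forall>x\<in>?U. H x + jacobian u (at x) \<in> K) \<and> energy u = (\<Sum>i\<in>F. energy (w i))"
    by (rule insert.IH) (use insert.prems in \<open>auto simp: pairwise_insert\<close>)
  then obtain u where u: "u \<in> test_functions ?U" "\<And>x. norm (u x) \<le> e"
      "\<And>x. x \<in> ?U \<Longrightarrow> H x + jacobian u (at x) \<in> K" "energy u = (\<Sum>i\<in>F. energy (w i))"
    by blast
  have wi: "w i \<in> test_functions (C i)" using insert.prems(2) by simp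
  have disj: "C i \<inter> ?U = {}"
    using insert.prems(1) insert.hyps(2) by (fastforce simp: pairwise_insert disjnt_def)
  have notU: "x \<notin> ?U" if "x \<in> C i" for x using disj that by blast
  note out_u = test_functions_outside[OF u(1)] and out_w = test_functions_outside[OF wi]
  have tf: "u \<in> test_functions (\<Union>i\<in>insert i F. C i)" "w i \<in> test_functions (\<Union>i\<in>insert i F. C i)"
    by (rule test_functions_mono[OF _ u(1)] test_functions_mono[OF _ wi]; auto)+
  note jac = jacobian_add[OF tf]
  show ?case
  proof (intro exI[where x="\<lambda>x. u x + w i x"] conjI allI ballI)
    show "(\<lambda>x. u x + w i x) \<in> test_functions (\<Union>i\<in>insert i F. C i)"
      by (intro test_functions_add tf)
    show "norm (u x + w i x) \<le> e" for x
    proof (cases "x \<in> C i")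
      case True
      then show ?thesis using out_u(1)[OF notU] insert.prems(3)[of i x] by simp
    qed (use out_w(1) u(2) in auto)
    show "H x + jacobian (\<lambda>x. u x + w i x) (at x) \<in> K" if "x \<in> (\<Union>i\<in>insert i F. C i)" for x
    proof (cases "x \<in> C i")
      case True
      from out_u(2)[OF notU[OF this]] show ?thesis
        using insert.prems(4)[of i x] True unfolding jac by simp
    next
      case False
      then have "x \<in> ?U" using that by blast
      from u(3)[OF this] show ?thesis unfolding jac by (simp add: out_w(2)[OF False])
    qed
    have "jacobian u (at x) \<bullet> jacobian (w i) (at x) = 0" for x
    proof (cases "x \<in> C i")
      case True
      then show ?thesis using out_u(2)[OF notU] by simp
    qed (simp add: out_w(2))
    then show "energy (\<lambda>x. u x + w i x) = (\<Sum>i\<in>insert i F. energy (w i))"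
      using energy_add[OF u(1) wi] insert.hyps u(4) by simp
  qed
qed

text \<open>All radii below \<open>\<rho> x\<close> are allowed, so the balls form a Vitali cover
  and a countable disjoint family fills \<open>P\<close> up to a null set. A finite part is kept so
  that the sum of the patches is again a test function; any fixed fraction of the measure would do,
  and one half is taken.\<close>

lemma vitali_half:
  fixes P :: "(real^'n) set"
  assumes P: "open P" "bounded P" and \<rho>: "\<And>x. x \<in> P \<Longrightarrow> 0 < \<rho> x" "\<And>x. x \<in> P \<Longrightarrow> cball x (\<rho> x) \<subseteq> P"
  obtains F where "finite F" "\<And>x r. (x, r) \<in> F \<Longrightarrow> x \<in> P \<and> 0 < r \<and> r \<le> \<rho> x"
    "pairwise (\<lambda>i j. disjnt (cball (fst i) (snd i)) (cball (fst j) (snd j))) F"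
    "measure lebesgue P / 2 \<le> (\<Sum>i\<in>F. measure lebesgue (cball (fst i) (snd i)))"
proof (cases "measure lebesgue P = 0")
  case True
  then show ?thesis using that[of "{}"] by simp
next
  case False
  then have pos: "measure lebesgue P / 2 > 0"
    by (simp add: zero_less_measure_iff)
  have lm: "P \<in> lmeasurable" using P by (simp add: lmeasurable_open)
  define I where "I = {(x, r). x \<in> P \<and> 0 < r \<and> r \<le> \<rho> x}"
  let ?b = "\<lambda>i. cball (fst i) (snd i)"
  have sub: "?b i \<subseteq> P" if "i \<in> I" for i
  proof -
    have "?b i \<subseteq> cball (fst i) (\<rho> (fst i))" using that by (intro subset_cball) (auto simp: I_def)
    also have "\<dots> \<subseteq> P" using that by (intro \<rho>(2)) (auto simp: I_def)
    finally show ?thesis .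
  qed
  have "0 < snd i" if "i \<in> I" for i using that by (auto simp: I_def)
  moreover have "\<exists>i. i \<in> I \<and> x \<in> ?b i \<and> snd i < d" if "x \<in> P" "0 < d" for x d
    using that \<rho>(1)[of x] by (intro exI[where x="(x, min (\<rho> x) (d/2))"]) (auto simp: I_def)
  ultimately obtain C where C: "countable C" "C \<subseteq> I"
      "pairwise (\<lambda>i j. disjnt (?b i) (?b j)) C" "negligible (P - (\<Union>i\<in>C. ?b i))"
    by (rule Vitali_covering_theorem_cballs)
  have CP: "(\<Union>i\<in>C. ?b i) \<subseteq> P" using C(2) sub by blast
  have inj: "inj_on ?b C"
  proof (rule inj_onI, rule ccontr)
    fix i j assume ij: "i \<in> C" "j \<in> C" "?b i = ?b j" "i \<noteq> j"
    have "disjnt (?b i) (?b j)" using pairwiseD[OF C(3) ij(1,2,4)] by simp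
    moreover have "fst i \<in> ?b i" using ij(1) C(2) by (auto simp: I_def)
    ultimately show False using ij(3) by (metis disjnt_iff)
  qed
  have "\<exists>D'. D' \<subseteq> ?b ` C \<and> finite D' \<and>
      measure lebesgue (\<Union>(?b ` C)) - measure lebesgue P / 2 < measure lebesgue (\<Union>D')"
  proof (rule measure_countable_Union_approachable[of "?b ` C" "measure lebesgue P / 2" "measure lebesgue P"])
    show "measure lebesgue (\<Union>D') \<le> measure lebesgue P" if "D' \<subseteq> ?b ` C" "finite D'" for D'
    proof (rule measure_mono_fmeasurable[OF _ _ lm])
      show "\<Union>D' \<subseteq> P" using that CP by blast
      show "\<Union>D' \<in> sets lebesgue" using that by (intro sets.finite_Union) auto
    qed
  next
    fix D' assume "D' \<subseteq> ?b ` C" "finite D'"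
      "measure lebesgue (\<Union>(?b ` C)) - measure lebesgue P / 2 < measure lebesgue (\<Union>D')"
    then show ?thesis by (intro exI[of _ D'] conjI)
  qed (use C(1) pos in auto)
  then obtain D' where D': "D' \<subseteq> ?b ` C" "finite D'"
      "measure lebesgue (\<Union>(?b ` C)) - measure lebesgue P / 2 < measure lebesgue (\<Union>D')"
    by blast
  obtain F where F: "F \<subseteq> C" "finite F" "D' = ?b ` F"
    by (rule exE[OF finite_subset_image[OF D'(2,1)]], elim conjE) (rule that)
  have "measure lebesgue (\<Union>(?b ` C)) = measure lebesgue P"
  proof (rule measure_negligible_symdiff[OF lm])
    show "negligible (P - \<Union>(?b ` C) \<union> (\<Union>(?b ` C) - P))"
      using C(4) CP Diff_eq_empty_iff[of "\<Union>(?b ` C)" P] by simp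
  qed
  then have "measure lebesgue P / 2 \<le> measure lebesgue (\<Union>i\<in>F. ?b i)"
    using D'(3) F(3) by simp
  also have "\<dots> = (\<Sum>i\<in>F. measure lebesgue (?b i))"
    using F C(3) by (intro measure_UNION' pairwise_subset[OF C(3)]) auto
  finally show ?thesis
    using F C by (intro that[of F] pairwise_subset[OF C(3)]) (auto simp: I_def)
qed

text \<open>Around every point where the gradient splits, all sufficiently small balls carry a wave,
  and waves on disjoint balls filling half of the splitting set are superposed. The factor 1/8 is
  the 1/4 of a single wave times this half.\<close>

lemma energy_gain:
  fixes H :: "real^'n \<Rightarrow> real^'n^'m"
  assumes K: "open K" and O: "open U" "bounded U" and H: "continuous_on U H" "H ` U \<subseteq> K"
    and c: "c > 0" and e: "e > 0"
  obtains w where "w \<in> test_functions U" "\<And>x. norm (w x) \<le> e"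
    "\<And>x. x \<in> U \<Longrightarrow> H x + jacobian w (at x) \<in> K"
    "bump_mass TYPE('n) / 8 * c\<^sup>2 * measure lebesgue {x\<in>U. splits K c (H x)} \<le> energy w"
proof -
  define P where "P = {x\<in>U. splits K c (H x)}"
  have "P = U \<inter> H -` {\<xi>. splits K c \<xi>}" by (auto simp: P_def)
  then have "open P"
    using continuous_open_preimage[OF H(1) O(1) open_splits[OF K, of c]] by simp
  have "bounded P" by (rule bounded_subset[OF O(2)]) (auto simp: P_def)
  define good where "good = (\<lambda>x r w. w \<in> test_functions (cball x r) \<and> (\<forall>y. norm (w y) \<le> e) \<and>
      (\<forall>y\<in>cball x r. H y + jacobian w (at y) \<in> K) \<and>
      bump_mass TYPE('n) / 4 * c\<^sup>2 * measure lebesgue (cball x r) \<le> energy w)"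
  have "\<exists>\<rho>>0. cball x \<rho> \<subseteq> P \<and> (\<forall>r. 0 < r \<and> r \<le> \<rho> \<longrightarrow> (\<exists>w. good x r w))" if x: "x \<in> P" for x
  proof -
    obtain a n where an: "norm n = 1" "c \<le> norm a" "\<forall>s\<in>{-1..1}. H x + s *\<^sub>R rank_one a n \<in> K"
      using x by (auto simp: P_def splits_def)
    obtain \<eta> where \<eta>: "\<eta> > 0"
        "\<And>\<zeta> s. dist \<zeta> (H x) < \<eta> \<Longrightarrow> s \<in> {-1..1} \<Longrightarrow> \<zeta> + s *\<^sub>R rank_one a n \<in> K"
      using segment_neighbourhood[OF K an(3)] by blast
    have "continuous_on P H" using H(1) by (rule continuous_on_subset) (auto simp: P_def)
    then have "isCont H x" using \<open>open P\<close> x continuous_on_eq_continuous_at by blast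
    \<comment> \<open>Half of the tube width is spent on the variation of \<open>H\<close> over the
      ball; the other half is left for the error of the wave.\<close>
    then obtain d where d: "d > 0" "\<And>y. dist y x < d \<Longrightarrow> dist (H y) (H x) < \<eta> / 2"
      using half_gt_zero[OF \<eta>(1)] unfolding continuous_at_eps_delta by blast
    obtain d' where d': "d' > 0" "cball x d' \<subseteq> P"
      using \<open>open P\<close> x open_contains_cball by blast
    define \<rho> where "\<rho> = min d' (d / 2)"
    have \<rho>: "\<rho> > 0" "\<rho> \<le> d'" "\<rho> < d" using d d' by (auto simp: \<rho>_def)
    have "\<exists>w. good x r w" if r: "0 < r" "r \<le> \<rho>" for r
    proof -
      have near: "\<zeta> + s *\<^sub>R rank_one a n \<in> K"
        if "y \<in> cball x r" "s \<in> {-1..1}" "dist \<zeta> (H y) < \<eta> / 2" for y s \<zeta>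
      proof (rule \<eta>(2)[OF _ that(2)])
        have "dist (H y) (H x) < \<eta> / 2" using that(1) r \<rho> by (intro d(2)) (auto simp: dist_commute)
        then show "dist \<zeta> (H x) < \<eta>" using that(3) dist_triangle[of \<zeta> "H x" "H y"] by simp
      qed
      obtain w where w: "w \<in> test_functions (cball x r)" "\<And>x. norm (w x) \<le> e"
          "\<And>y. y \<in> cball x r \<Longrightarrow> H y + jacobian w (at y) \<in> K"
          "bump_mass TYPE('n) / 4 * (norm a)\<^sup>2 * measure lebesgue (cball x r) \<le> energy w"
      proof (rule oscillation[where ?x0.0=x and H=H and a=a and K=K,
              OF r(1) an(1) half_gt_zero[OF \<eta>(1)] e])
        show "\<zeta> + s *\<^sub>R rank_one a n \<in> K"
          if "y \<in> cball x r" "s \<in> {-1..1}" "dist \<zeta> (H y) < \<eta> / 2" for y s \<zeta>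
          using that by (rule near)
      qed (rule that)
      have "bump_mass TYPE('n) / 4 * c\<^sup>2 * measure lebesgue (cball x r) \<le>
          bump_mass TYPE('n) / 4 * (norm a)\<^sup>2 * measure lebesgue (cball x r)"
        using an(2) c bump_mass_pos[where 'n='n] by (intro mult_right_mono mult_left_mono power_mono) auto
      then show ?thesis using w unfolding good_def by (meson order_trans)
    qed
    moreover have "cball x \<rho> \<subseteq> P" using d'(2) \<rho>(2) by (meson subset_cball order_trans)
    ultimately show ?thesis using \<rho>(1) by blast
  qed
  then obtain \<rho> where \<rho>: "\<And>x. x \<in> P \<Longrightarrow> 0 < \<rho> x" "\<And>x. x \<in> P \<Longrightarrow> cball x (\<rho> x) \<subseteq> P"
      "\<And>x r. x \<in> P \<Longrightarrow> 0 < r \<Longrightarrow> r \<le> \<rho> x \<Longrightarrow> \<exists>w. good x r w"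
    by metis
  obtain F where F: "finite F" "\<And>x r. (x, r) \<in> F \<Longrightarrow> x \<in> P \<and> 0 < r \<and> r \<le> \<rho> x"
    "pairwise (\<lambda>i j. disjnt (cball (fst i) (snd i)) (cball (fst j) (snd j))) F"
    "measure lebesgue P / 2 \<le> (\<Sum>i\<in>F. measure lebesgue (cball (fst i) (snd i)))"
    using vitali_half[OF \<open>open P\<close> \<open>bounded P\<close> \<rho>(1,2)] by blast
  have "\<exists>w. good (fst i) (snd i) w" if "i \<in> F" for i
    using F(2)[of "fst i" "snd i"] \<rho>(3) that by simp
  then obtain W where W: "\<And>i. i \<in> F \<Longrightarrow> good (fst i) (snd i) (W i)" by metis
  let ?V = "\<Union>i\<in>F. cball (fst i) (snd i)"
  have "\<exists>u. u \<in> test_functions ?V \<and> (\<forall>x. norm (u x) \<le> e) \<and>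
      (\<forall>x\<in>?V. H x + jacobian u (at x) \<in> K) \<and> energy u = (\<Sum>i\<in>F. energy (W i))"
    by (rule disjoint_patches[OF F(1,3)]) (use W e in \<open>auto simp: good_def\<close>)
  then obtain u where u: "u \<in> test_functions ?V" "\<And>x. norm (u x) \<le> e"
      "\<And>x. x \<in> ?V \<Longrightarrow> H x + jacobian u (at x) \<in> K" "energy u = (\<Sum>i\<in>F. energy (W i))"
    by blast
  have VU: "?V \<subseteq> U"
  proof (rule UN_least)
    fix i assume "i \<in> F"
    then have i: "fst i \<in> P" "snd i \<le> \<rho> (fst i)" using F(2)[of "fst i" "snd i"] by auto
    have "cball (fst i) (snd i) \<subseteq> cball (fst i) (\<rho> (fst i))" using i(2) by (rule subset_cball)
    also have "\<dots> \<subseteq> P" using i(1) by (rule \<rho>(2))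
    also have "\<dots> \<subseteq> U" by (auto simp: P_def)
    finally show "cball (fst i) (snd i) \<subseteq> U" .
  qed
  show thesis
  proof (rule that[of u])
    show "u \<in> test_functions U" using test_functions_mono[OF VU u(1)] .
    show "H x + jacobian u (at x) \<in> K" if "x \<in> U" for x
    proof (cases "x \<in> ?V")
      case False
      then show ?thesis using test_functions_outside(2)[OF u(1)] H(2) that by auto
    qed (rule u(3))
    have "bump_mass TYPE('n) / 8 * c\<^sup>2 * measure lebesgue P =
        bump_mass TYPE('n) / 4 * c\<^sup>2 * (measure lebesgue P / 2)" by simp
    also have "\<dots> \<le> bump_mass TYPE('n) / 4 * c\<^sup>2 * (\<Sum>i\<in>F. measure lebesgue (cball (fst i) (snd i)))"
      using bump_mass_pos[where 'n='n] by (intro mult_left_mono F(4)) auto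
    also have "\<dots> = (\<Sum>i\<in>F. bump_mass TYPE('n) / 4 * c\<^sup>2 * measure lebesgue (cball (fst i) (snd i)))"
      by (simp add: sum_distrib_left)
    also have "\<dots> \<le> (\<Sum>i\<in>F. energy (W i))"
      using W by (intro sum_mono) (auto simp: good_def)
    finally show "bump_mass TYPE('n) / 8 * c\<^sup>2 * measure lebesgue {x\<in>U. splits K c (H x)} \<le> energy u"
      by (simp add: u(4) P_def)
  qed (rule u(2))
qed

subsection \<open>Weak gradients\<close>

lemma integral_lebesgue_on_eq:
  fixes f :: "'a::euclidean_space \<Rightarrow> 'b::{banach, second_countable_topology}"
  assumes "\<Omega> \<in> sets lebesgue" "\<And>x. x \<notin> \<Omega> \<Longrightarrow> f x = 0"
  shows "integral\<^sup>L (lebesgue_on \<Omega>) f = integral\<^sup>L lebesgue f"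
    "integrable (lebesgue_on \<Omega>) f \<longleftrightarrow> integrable lebesgue f"
proof -
  have "(\<lambda>x. indicator \<Omega> x *\<^sub>R f x) = f" using assms(2) by (auto simp: indicator_def)
  then show "integral\<^sup>L (lebesgue_on \<Omega>) f = integral\<^sup>L lebesgue f"
    "integrable (lebesgue_on \<Omega>) f \<longleftrightarrow> integrable lebesgue f"
    using assms(1) integral_restrict_space[of \<Omega> lebesgue f] integrable_restrict_space[of \<Omega> lebesgue f] by auto
qed

lemma integrable_bounded_lebesgue_on:
  fixes f :: "'a::euclidean_space \<Rightarrow> 'b::{banach, second_countable_topology}"
  assumes "f \<in> borel_measurable lebesgue" "S \<in> lmeasurable" "AE x in lebesgue. norm (f x) \<le> B"
  shows "integrable (lebesgue_on S) f"
proof (rule finite_measure.integrable_const_bound[where B=B])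
  show "finite_measure (lebesgue_on S)" using assms(2) by (rule finite_measure_lebesgue_on)
  show "f \<in> borel_measurable (lebesgue_on S)" using assms(1) by (rule measurable_restrict_space1)
  show "AE x in lebesgue_on S. norm (f x) \<le> B"
    using assms(2,3) by (auto simp: AE_restrict_space_iff fmeasurableD elim: eventually_mono)
qed

lemma borel_measurable_vec_nth:
  fixes f :: "'a \<Rightarrow> 'b::topological_space^'n"
  assumes "f \<in> borel_measurable M"
  shows "(\<lambda>x. f x $ i) \<in> borel_measurable M"
  using measurable_compose[OF assms, of "\<lambda>y. y $ i"]
    borel_measurable_continuous_onI[of "\<lambda>y :: 'b^'n. y $ i"] by (simp add: continuous_on_component)

text \<open>Uniform bounds on a domain of finite measure supply integrable majorants, so the
  identity of integration by parts survives almost everywhere convergence of the gradients. The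
  sequence itself is the approximation demanded by \<open>W11_0\<close>, which is how the zero
  boundary values are obtained.\<close>

lemma limit_of_test_functions:
  fixes \<psi> :: "nat \<Rightarrow> real^'n \<Rightarrow> real^'m"
  assumes \<Omega>: "open \<Omega>" "bounded \<Omega>" and tf: "\<And>k. \<psi> k \<in> test_functions \<Omega>"
    and B: "\<And>k x. norm (\<psi> k x) \<le> B" "\<And>k x. norm (jacobian (\<psi> k) (at x)) \<le> B"
    and v: "\<And>x. (\<lambda>k. \<psi> k x) \<longlonglongrightarrow> v x"
    and V: "V \<in> borel_measurable lebesgue" "AE x in lebesgue. (\<lambda>k. jacobian (\<psi> k) (at x)) \<longlonglongrightarrow> V x"
  shows "has_weak_gradient \<Omega> v V" "v \<in> W1_inf_0 \<Omega>"
proof -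
  let ?M = "lebesgue_on \<Omega>"
  have lm: "\<Omega> \<in> lmeasurable" using \<Omega> by (simp add: lmeasurable_open)
  then have sets: "\<Omega> \<in> sets lebesgue" by (rule fmeasurableD)
  have AE_on: "AE x in ?M. Q x" if "AE x in lebesgue. Q x" for Q
    using that sets by (auto simp: AE_restrict_space_iff elim: eventually_mono)
  have vB: "norm (v x) \<le> B" for x
    using Lim_bounded[OF tendsto_norm[OF v[of x]], of 0 B] B(1) by blast
  have VB: "AE x in lebesgue. norm (V x) \<le> B"
    using V(2)
  proof eventually_elim
    case (elim x)
    show ?case using Lim_bounded[OF tendsto_norm[OF elim], of 0 B] B(2) by blast
  qed
  have m\<psi>: "\<psi> k \<in> borel_measurable lebesgue" for k
    using borel_measurable_integrable[OF test_functions_integrable[OF tf]] .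
  have mj: "(\<lambda>x. jacobian (\<psi> k) (at x)) \<in> borel_measurable lebesgue" for k
    using borel_measurable_integrable[OF test_functions_jacobian_integrable[OF tf]] .
  have mv: "v \<in> borel_measurable lebesgue"
    by (rule borel_measurable_LIMSEQ_metric[OF m\<psi>]) (rule v)
  have mon: "f \<in> borel_measurable ?M" if "f \<in> borel_measurable lebesgue" for f :: "real^'n \<Rightarrow> 'c::euclidean_space"
    using that by (rule measurable_restrict_space1)
  have intv: "integrable (lebesgue_on S) v" and intV: "integrable (lebesgue_on S) V" if "S \<in> lmeasurable" for S
    using integrable_bounded_lebesgue_on[OF mv that, of B] vB
      integrable_bounded_lebesgue_on[OF V(1) that VB] by auto
  have conv: "(\<lambda>k. LINT x|?M. f k x * g x) \<longlonglongrightarrow> (LINT x|?M. h x * g x)"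
    if "\<And>k. f k \<in> borel_measurable ?M" "h \<in> borel_measurable ?M" "integrable ?M g"
      "AE x in ?M. (\<lambda>k. f k x) \<longlonglongrightarrow> h x" "\<And>k x. \<bar>f k x\<bar> \<le> B" for f g h
  proof (rule integral_dominated_convergence[where w="\<lambda>x. B * \<bar>g x\<bar>"])
    show "(\<lambda>x. h x * g x) \<in> borel_measurable ?M" "(\<lambda>x. f k x * g x) \<in> borel_measurable ?M" for k
      using that by (auto intro!: borel_measurable_times borel_measurable_integrable)
    show "integrable ?M (\<lambda>x. B * \<bar>g x\<bar>)" using that(3) by (intro integrable_mult_right integrable_abs)
    show "AE x in ?M. (\<lambda>k. f k x * g x) \<longlonglongrightarrow> h x * g x"
      using that(4) by eventually_elim (intro tendsto_intros)
    show "AE x in ?M. norm (f k x * g x) \<le> B * \<bar>g x\<bar>" for k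
      using that(5)[of k] by (intro AE_I2) (simp add: abs_mult mult_right_mono)
  qed
  show weak: "has_weak_gradient \<Omega> v V"
    unfolding has_weak_gradient_def locally_integrable_def
  proof (intro conjI allI impI)
    show "integrable (lebesgue_on S) v" "integrable (lebesgue_on S) V" if "compact S \<and> S \<subseteq> \<Omega>" for S
      using intv intV lmeasurable_compact that by blast+
    fix \<zeta> :: "real^'n \<Rightarrow> real" and i :: 'm and j :: 'n
    assume \<zeta>: "\<zeta> \<in> test_functions \<Omega>"
    let ?d = "\<lambda>x. frechet_derivative \<zeta> (at x) (axis j 1)"
    obtain S where "compact S" and S: "S \<subseteq> \<Omega>" "\<And>x. x \<notin> S \<Longrightarrow> \<zeta> x = 0" "\<And>x h. x \<notin> S \<Longrightarrow> frechet_derivative \<zeta> (at x) h = 0"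
      by (rule test_functions_support[OF \<zeta>]) (rule that)
    have out: "\<zeta> x = 0" "?d x = 0" if "x \<notin> \<Omega>" for x
      using S(2,3)[of x] S(1) that by auto
    have i1: "integrable ?M \<zeta>" "integrable ?M ?d"
      using integral_lebesgue_on_eq(2)[OF sets, of \<zeta>] integral_lebesgue_on_eq(2)[OF sets, of ?d] out
        test_functions_integrable[OF \<zeta>] test_functions_integrable[OF test_functions_partial[OF \<zeta>]] by auto
    have "(\<lambda>k. LINT x|?M. \<psi> k x $ i * ?d x) \<longlonglongrightarrow> (LINT x|?M. v x $ i * ?d x)"
    proof (rule conv[OF _ _ i1(2)])
      show "(\<lambda>x. \<psi> k x $ i) \<in> borel_measurable ?M" for k
        by (intro borel_measurable_vec_nth mon m\<psi>)
      show "(\<lambda>x. v x $ i) \<in> borel_measurable ?M"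
        by (intro borel_measurable_vec_nth mon mv)
      show "AE x in ?M. (\<lambda>k. \<psi> k x $ i) \<longlonglongrightarrow> v x $ i"
        using v by (intro AE_I2 tendsto_vec_nth)
      show "\<bar>\<psi> k x $ i\<bar> \<le> B" for k x
        using order_trans[OF component_le_norm_cart B(1)] .
    qed
    moreover have "(\<lambda>k. LINT x|?M. jacobian (\<psi> k) (at x) $ i $ j * \<zeta> x) \<longlonglongrightarrow> (LINT x|?M. V x $ i $ j * \<zeta> x)"
    proof (rule conv[OF _ _ i1(1)])
      show "(\<lambda>x. jacobian (\<psi> k) (at x) $ i $ j) \<in> borel_measurable ?M" for k
        by (intro borel_measurable_vec_nth mon mj)
      show "(\<lambda>x. V x $ i $ j) \<in> borel_measurable ?M"
        by (intro borel_measurable_vec_nth mon V(1))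
      show "AE x in ?M. (\<lambda>k. jacobian (\<psi> k) (at x) $ i $ j) \<longlonglongrightarrow> V x $ i $ j"
        using AE_on[OF V(2)] by eventually_elim (intro tendsto_vec_nth)
      show "\<bar>jacobian (\<psi> k) (at x) $ i $ j\<bar> \<le> B" for k x
        using order_trans[OF component_le_norm_cart order_trans[OF Finite_Cartesian_Product.norm_nth_le B(2)]] .
    qed
    moreover have "(LINT x|?M. \<psi> k x $ i * ?d x) = - (LINT x|?M. jacobian (\<psi> k) (at x) $ i $ j * \<zeta> x)" for k
      using test_functions_jacobian_by_parts[OF tf \<zeta>, of k i j]
        integral_lebesgue_on_eq(1)[OF sets, of "\<lambda>x. \<psi> k x $ i * ?d x"]
        integral_lebesgue_on_eq(1)[OF sets, of "\<lambda>x. jacobian (\<psi> k) (at x) $ i $ j * \<zeta> x"] out by auto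
    ultimately show "(LINT x|?M. v x $ i * ?d x) = - (LINT x|?M. V x $ i $ j * \<zeta> x)"
      using LIMSEQ_unique tendsto_minus by (metis (no_types, lifting) ext)
  qed
  have conv0: "(\<lambda>k. LINT x|?M. norm (f k x - h x)) \<longlonglongrightarrow> 0"
    if "\<And>k. f k \<in> borel_measurable lebesgue" "h \<in> borel_measurable lebesgue"
      "AE x in ?M. (\<lambda>k. f k x) \<longlonglongrightarrow> h x" "\<And>k x. norm (f k x) \<le> B" "AE x in ?M. norm (h x) \<le> B"
    for f :: "nat \<Rightarrow> real^'n \<Rightarrow> 'c::euclidean_space" and h
  proof -
    have "(\<lambda>k. LINT x|?M. norm (f k x - h x)) \<longlonglongrightarrow> (LINT x|?M. 0)"
    proof (rule integral_dominated_convergence[where w="\<lambda>x. 2 * B"])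
      show "(\<lambda>x. norm (f k x - h x)) \<in> borel_measurable ?M" for k
        using mon[OF that(1)[of k]] mon[OF that(2)] by simp
      show "integrable ?M (\<lambda>x. 2 * B)"
        by (rule integrable_bounded_lebesgue_on[OF _ lm, where B="\<bar>2 * B\<bar>"]) auto
      show "AE x in ?M. (\<lambda>k. norm (f k x - h x)) \<longlonglongrightarrow> 0"
        using that(3) by eventually_elim (simp add: LIM_zero tendsto_norm_zero)
      show "AE x in ?M. norm (norm (f k x - h x)) \<le> 2 * B" for k
        using that(5)
      proof eventually_elim
        case (elim x)
        show ?case using norm_triangle_ineq4[of "f k x" "h x"] that(4)[of k x] elim by simp
      qed
    qed simp
    then show ?thesis by simp
  qed
  have "(\<lambda>k. (LINT x|?M. norm (\<psi> k x - v x)) + (LINT x|?M. norm (jacobian (\<psi> k) (at x) - V x))) \<longlonglongrightarrow> 0 + 0"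
    by (intro tendsto_add conv0 m\<psi> mv mj V(1) AE_on[OF V(2)] AE_on[OF VB] B) (use v vB in auto)
  then have "v \<in> W11_0 \<Omega>"
    unfolding W11_0_def using weak intv[OF lm] intV[OF lm] tf by auto
  moreover have "v \<in> W1_inf \<Omega>"
    unfolding W1_inf_def L_inf_def using weak mon[OF mv] mon[OF V(1)] vB AE_on[OF VB] by blast
  ultimately show "v \<in> W1_inf_0 \<Omega>" by (simp add: W1_inf_0_def)
qed

section \<open>The fundamental lemma of the calculus of variations\<close>

lemma integral_open_zero:
  fixes h :: "real^'n \<Rightarrow> real"
  assumes h: "integrable lebesgue h" and T: "open T"
    and zero: "\<And>y r. 0 < r \<Longrightarrow> cball y r \<subseteq> T \<Longrightarrow> (LINT x|lebesgue. indicator (ball y r) x * h x) = 0"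
  shows "(LINT x|lebesgue. indicator T x * h x) = 0"
proof -
  define I where "I = {i. 0 < snd i \<and> cball (fst i) (snd i) \<subseteq> T}"
  let ?b = "\<lambda>i. ball (fst i) (snd i)"
  have "\<exists>i. i \<in> I \<and> x \<in> ?b i \<and> snd i < d" if "x \<in> T" "0 < d" for x d
  proof -
    obtain e where "e > 0" "cball x e \<subseteq> T" using T \<open>x \<in> T\<close> open_contains_cball by blast
    moreover have "cball x (min e (d/2)) \<subseteq> cball x e" by (intro subset_cball) simp
    ultimately show ?thesis
      using \<open>0 < d\<close> by (intro exI[where x="(x, min e (d/2))"]) (auto simp: I_def)
  qed
  then obtain C where C: "countable C" "C \<subseteq> I" "pairwise (\<lambda>i j. disjnt (?b i) (?b j)) C"
      "negligible (T - (\<Union>i\<in>C. ?b i))"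
    by (rule Vitali_covering_theorem_balls)
  have sub: "?b i \<subseteq> T" if "i \<in> C" for i
  proof -
    have "cball (fst i) (snd i) \<subseteq> T" using subsetD[OF C(2) that] by (simp add: I_def)
    then show ?thesis using ball_subset_cball order_trans by blast
  qed
  show ?thesis
  proof (cases "C = {}")
    case True
    then have "T \<in> null_sets lebesgue" using C(4) by (simp add: negligible_iff_null_sets)
    then have "AE x in lebesgue. indicator T x * h x = 0"
      by (rule AE_mp[OF AE_not_in]) simp
    then show ?thesis by (rule integral_eq_zero_AE)
  next
    case False
    \<comment> \<open>The enumeration needs \<open>C\<close> nonempty, hence the case distinction.
      It may repeat members, but the images \<open>D n\<close> are finite, increase and exhaust
      \<open>C\<close>.\<close>
    define D where "D = (\<lambda>n. from_nat_into C ` {..<n})"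
    have D: "finite (D n)" "D n \<subseteq> C" for n
      using from_nat_into[OF False] by (auto simp: D_def)
    have fin: "(LINT x|lebesgue. indicator (\<Union>i\<in>D n. ?b i) x * h x) = 0" for n
    proof -
      have "disjoint_family_on ?b (D n)"
        using pairwise_subset[OF C(3) D(2)[of n]]
        by (auto simp: disjoint_family_on_def pairwise_def disjnt_def)
      from indicator_UN_disjoint[OF D(1) this]
      have "indicat_real (\<Union>i\<in>D n. ?b i) x = (\<Sum>i\<in>D n. indicat_real (?b i) x)" for x .
      then have "(LINT x|lebesgue. indicator (\<Union>i\<in>D n. ?b i) x * h x) =
          (LINT x|lebesgue. (\<Sum>i\<in>D n. indicator (?b i) x * h x))"
        by (intro Bochner_Integration.integral_cong refl) (simp add: sum_distrib_right)
      also have "\<dots> = (\<Sum>i\<in>D n. LINT x|lebesgue. indicator (?b i) x * h x)"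
        using integrable_mult_indicator[OF _ h] by (intro Bochner_Integration.integral_sum) simp
      also have "\<dots> = 0"
      proof (rule sum.neutral, rule ballI)
        fix i assume "i \<in> D n"
        then have "i \<in> I" using D(2) C(2) by blast
        then have "0 < snd i" "cball (fst i) (snd i) \<subseteq> T" by (simp_all add: I_def)
        then show "(LINT x|lebesgue. indicator (?b i) x * h x) = 0" by (rule zero)
      qed
      finally show ?thesis .
    qed
    have "(\<lambda>n. LINT x|lebesgue. indicator (\<Union>i\<in>D n. ?b i) x * h x) \<longlonglongrightarrow> (LINT x|lebesgue. indicator T x * h x)"
    proof (rule integral_dominated_convergence[where w="\<lambda>x. \<bar>h x\<bar>"])
      have "AE x in lebesgue. x \<notin> T - (\<Union>i\<in>C. ?b i)"
        using C(4) by (intro AE_not_in) (simp add: negligible_iff_null_sets)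
      then show "AE x in lebesgue. (\<lambda>n. indicator (\<Union>i\<in>D n. ?b i) x * h x) \<longlonglongrightarrow> indicator T x * h x"
      proof eventually_elim
        case (elim x)
        show ?case
        proof (cases "x \<in> T")
          case True
          then obtain i where i: "i \<in> C" "x \<in> ?b i" using elim by blast
          obtain m where m: "i = from_nat_into C m"
            using from_nat_into_surj[OF C(1) i(1)] by auto
          have "\<forall>\<^sub>F n in sequentially. indicator (\<Union>i\<in>D n. ?b i) x * h x = indicator T x * h x"
            using eventually_gt_at_top[of m]
          proof eventually_elim
            case (elim n)
            then have "i \<in> D n" using m by (auto simp: D_def)
            then show ?case using i(2) True by (auto simp: indicator_def)
          qed
          then show ?thesis by (rule tendsto_eventually)
        next
          case False
          then have "x \<notin> (\<Union>i\<in>D n. ?b i)" for n using sub D(2)[of n] by blast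
          then show ?thesis using False by simp
        qed
      qed
      show "AE x in lebesgue. norm (indicator (\<Union>i\<in>D n. ?b i) x * h x) \<le> \<bar>h x\<bar>" for n
        by (intro AE_I2) (simp add: indicator_def abs_mult)
      have "open (\<Union>i\<in>D n. ?b i)" for n by auto
      then have "(\<Union>i\<in>D n. ?b i) \<in> sets lebesgue" for n by (metis borel_open sets_completionI_sets sets_lborel)
      then show "(\<lambda>x. indicator (\<Union>i\<in>D n. ?b i) x * h x) \<in> borel_measurable lebesgue" for n
        using h by (intro borel_measurable_times borel_measurable_indicator borel_measurable_integrable)
      show "(\<lambda>x. indicator T x * h x) \<in> borel_measurable lebesgue"
        using h T by (intro borel_measurable_times borel_measurable_indicator borel_measurable_integrable) auto
    qed (use h in auto)
    then show ?thesis by (simp add: fin LIMSEQ_const_iff)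
  qed
qed

text \<open>Outer regularity takes the place of differentiating the integral. Up to a null set, the
  set where \<open>h\<close> is positive is a countable intersection of open sets, and over open
  sets the integral vanishes by filling them with balls. A positive function with zero integral over
  a set forces that set to be null.\<close>

lemma AE_nonpos_if_integral_balls_zero:
  fixes h :: "real^'n \<Rightarrow> real"
  assumes h: "integrable lebesgue h" and W: "open W"
    and zero: "\<And>y r. 0 < r \<Longrightarrow> cball y r \<subseteq> W \<Longrightarrow> (LINT x|lebesgue. indicator (ball y r) x * h x) = 0"
  shows "AE x in lebesgue. x \<in> W \<longrightarrow> h x \<le> 0"
proof -
  define P where "P = {x\<in>W. 0 < h x}"
  have mh: "h \<in> borel_measurable lebesgue" using h by (rule borel_measurable_integrable)
  have "P = W \<inter> {x\<in>space lebesgue. 0 < h x}" by (auto simp: P_def)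
  moreover have "{x\<in>space lebesgue. 0 < h x} \<in> sets lebesgue" using mh by measurable
  moreover have "W \<in> sets lebesgue" using W by auto
  ultimately have P: "P \<in> sets lebesgue" by (simp only: sets.Int)
  have "\<exists>T. open T \<and> P \<subseteq> T \<and> T - P \<in> lmeasurable \<and> emeasure lebesgue (T - P) < ennreal (1 / real (Suc n))" for n
    using sets_lebesgue_outer_open[OF P, of "1 / real (Suc n)"] by (metis of_nat_0_less_iff zero_less_Suc zero_less_divide_1_iff)
  then obtain T where T: "\<And>n. open (T n)" "\<And>n. P \<subseteq> T n" "\<And>n. T n - P \<in> lmeasurable"
      "\<And>n. emeasure lebesgue (T n - P) < ennreal (1 / real (Suc n))" by metis
  define N where "N = (\<Inter>n. T n) - P"
  have N: "N \<in> sets lebesgue" unfolding N_def using P T(1) by (intro sets.Diff sets.countable_INT) auto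
  have "emeasure lebesgue N \<le> 0"
  proof (rule ennreal_le_epsilon)
    fix e :: real assume "e > 0"
    then obtain n where n: "1 / real (Suc n) < e" using nat_approx_posE by blast
    have "emeasure lebesgue N \<le> emeasure lebesgue (T n - P)"
      using T(3)[of n] by (intro emeasure_mono) (auto simp: N_def fmeasurableD)
    also have "\<dots> \<le> ennreal e" using T(4)[of n] n by (meson ennreal_leI less_imp_le order_trans)
    finally show "emeasure lebesgue N \<le> 0 + ennreal e" by simp
  qed
  then have "N \<in> null_sets lebesgue" using N by (simp add: null_sets_def)
  \<comment> \<open>Finite intersections remain open and inside \<open>W\<close>, and they decrease
    to \<open>P\<close> up to the null set \<open>N\<close>.\<close>
  define B where "B = (\<lambda>n. W \<inter> (\<Inter>i\<in>{..n}. T i))"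
  have oB: "open (B n)" for n unfolding B_def using W T(1) by (intro open_Int open_INT) auto
  have zB: "(LINT x|lebesgue. indicator (B n) x * h x) = 0" for n
    by (rule integral_open_zero[OF h oB zero]) (auto simp: B_def)
  have "(\<lambda>n. LINT x|lebesgue. indicator (B n) x * h x) \<longlonglongrightarrow> (LINT x|lebesgue. indicator P x * h x)"
  proof (rule integral_dominated_convergence[where w="\<lambda>x. \<bar>h x\<bar>"])
    show "AE x in lebesgue. (\<lambda>n. indicator (B n) x * h x) \<longlonglongrightarrow> indicator P x * h x"
      using AE_not_in[OF \<open>N \<in> null_sets lebesgue\<close>]
    proof eventually_elim
      case (elim x)
      show ?case
      proof (cases "x \<in> P \<or> x \<notin> W")
        case True
        then have "x \<in> B n \<longleftrightarrow> x \<in> P" for n using T(2) by (auto simp: B_def P_def)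
        then show ?thesis by (simp add: indicator_def)
      next
        case False
        then obtain m where m: "x \<notin> T m" using elim by (auto simp: N_def)
        have "\<forall>\<^sub>F n in sequentially. indicator (B n) x * h x = indicator P x * h x"
          using eventually_ge_at_top[of m]
        proof eventually_elim
          case (elim n)
          then have "x \<notin> B n" using m by (auto simp: B_def)
          then show ?case using False by simp
        qed
        then show ?thesis by (rule tendsto_eventually)
      qed
    qed
    show "AE x in lebesgue. norm (indicator (B n) x * h x) \<le> \<bar>h x\<bar>" for n
      by (intro AE_I2) (simp add: indicator_def abs_mult)
    show "(\<lambda>x. indicator (B n) x * h x) \<in> borel_measurable lebesgue" for n
      using mh oB[of n] by (intro borel_measurable_times borel_measurable_indicator) auto
    show "(\<lambda>x. indicator P x * h x) \<in> borel_measurable lebesgue"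
      using mh P by (intro borel_measurable_times borel_measurable_indicator)
  qed (use h in auto)
  then have 0: "(LINT x|lebesgue. indicator P x * h x) = 0" by (simp add: zB LIMSEQ_const_iff)
  have "integrable lebesgue (\<lambda>x. indicator P x * h x)"
    using integrable_mult_indicator[OF P h] by simp
  then have "AE x in lebesgue. indicator P x * h x = 0"
    using 0 by (subst (asm) integral_nonneg_eq_0_iff_AE) (auto simp: P_def indicator_def)
  then show ?thesis
    by eventually_elim (auto simp: P_def indicator_def split: if_splits)
qed

lemma AE_zero_if_integral_balls_zero:
  fixes h :: "real^'n \<Rightarrow> real"
  assumes h: "integrable lebesgue h" and W: "open W"
    and zero: "\<And>y r. 0 < r \<Longrightarrow> cball y r \<subseteq> W \<Longrightarrow> (LINT x|lebesgue. indicator (ball y r) x * h x) = 0"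
  shows "AE x in lebesgue. x \<in> W \<longrightarrow> h x = 0"
proof -
  have "AE x in lebesgue. x \<in> W \<longrightarrow> h x \<le> 0"
    by (rule AE_nonpos_if_integral_balls_zero[OF h W zero])
  moreover have "AE x in lebesgue. x \<in> W \<longrightarrow> - h x \<le> 0"
    by (rule AE_nonpos_if_integral_balls_zero[OF _ W]) (use h zero in auto)
  ultimately show ?thesis by eventually_elim auto
qed

lemma flat_exp_0_bounds: "0 \<le> flat_exp 0 t" "flat_exp 0 t \<le> 1"
  by (auto simp: flat_exp_def)

text \<open>Test functions converging boundedly to the indicator of a ball turn the hypothesis into
  vanishing integrals over small balls. As \<open>g\<close> is only locally integrable, this is done
  inside one closed ball of \<open>W\<close> at a time, and countably many such balls cover almost
  all of \<open>W\<close>.\<close>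

lemma fundamental_lemma_variations:
  fixes g :: "real^'n \<Rightarrow> real"
  assumes W: "open W" and g: "locally_integrable W g"
    and zero: "\<And>\<zeta>. \<zeta> \<in> test_functions W \<Longrightarrow> (LINT x|lebesgue_on W. g x * \<zeta> x) = 0"
  shows "AE x in lebesgue. x \<in> W \<longrightarrow> g x = 0"
proof -
  have W': "W \<in> sets lebesgue" using W by auto
  have int: "integrable lebesgue (\<lambda>x. indicator (cball y s) x * g x)" if "cball y s \<subseteq> W" for y s
    using g that integrable_restrict_space[of "cball y s" lebesgue g]
    by (auto simp: locally_integrable_def)
  have loc: "AE x in lebesgue. x \<in> ball y s \<longrightarrow> g x = 0" if ys: "cball y s \<subseteq> W" for y s
  proof -
    let ?h = "\<lambda>x. indicator (cball y s) x * g x"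
    have ball0: "(LINT x|lebesgue. indicator (ball x0 r) x * ?h x) = 0"
      if r: "0 < r" "cball x0 r \<subseteq> ball y s" for x0 r
    proof -
      have sub: "cball x0 r \<subseteq> W" using r(2) ball_subset_cball[of y s] ys by blast
      \<comment> \<open>Stretching the argument by k + 1 gives exp(-1 / ((k + 1) u)), which
        increases to 1 inside the ball and stays 0 outside.\<close>
      define \<zeta> where "\<zeta> = (\<lambda>k x. flat_exp 0 (real (Suc k) * (1 - (x - x0) \<bullet> (x - x0) / r\<^sup>2)))"
      have pos: "0 < 1 - (x - x0) \<bullet> (x - x0) / r\<^sup>2 \<longleftrightarrow> x \<in> ball x0 r" for x
      proof -
        have "0 < 1 - (x - x0) \<bullet> (x - x0) / r\<^sup>2 \<longleftrightarrow> (norm (x - x0))\<^sup>2 < r\<^sup>2"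
          using r(1) by (simp add: power2_norm_eq_inner)
        also have "\<dots> \<longleftrightarrow> norm (x - x0) < r"
          using r(1) power_mono_iff[of r "norm (x - x0)" 2] by (simp add: not_le[symmetric])
        finally show ?thesis by (simp add: dist_norm norm_minus_commute)
      qed
      have out: "\<zeta> k x = 0" if "x \<notin> ball x0 r" for k x
      proof -
        have "1 - (x - x0) \<bullet> (x - x0) / r\<^sup>2 \<le> 0" using pos[of x] that by simp
        then have "real (Suc k) * (1 - (x - x0) \<bullet> (x - x0) / r\<^sup>2) \<le> 0"
          by (intro mult_nonneg_nonpos) auto
        then show ?thesis by (simp add: \<zeta>_def flat_exp_def)
      qed
      have tf: "\<zeta> k \<in> test_functions W" for k
      proof (rule test_functionsI[where S="cball x0 r"])
        fix m
        have "C_k m (\<lambda>x. x + - x0)" by (intro C_k_add C_k_id C_k_const)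
        then have "C_k m (\<lambda>x. real (Suc k) * (1 + (- inverse (r\<^sup>2)) * ((x + - x0) \<bullet> (x + - x0))))"
          by (intro C_k_mult C_k_const C_k_add[OF C_k_const] C_k_inner)
        from C_k_compose_real[OF C_k_flat_exp[of m 0] this] show "C_k m (\<zeta> k)"
          unfolding \<zeta>_def by (simp add: divide_inverse mult.commute del: of_nat_Suc)
        show "\<zeta> k x = 0" if "x \<notin> cball x0 r" for x
          using that by (intro out) auto
      qed (use sub in auto)
      have "(\<lambda>k. LINT x|lebesgue. ?h x * \<zeta> k x) \<longlonglongrightarrow> (LINT x|lebesgue. indicator (ball x0 r) x * ?h x)"
      proof (rule integral_dominated_convergence[where w="\<lambda>x. \<bar>?h x\<bar>"])
        have lim1: "(\<lambda>k. \<zeta> k x) \<longlonglongrightarrow> indicator (ball x0 r) x" for x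
        proof (cases "x \<in> ball x0 r")
          case True
          define u where "u = 1 - (x - x0) \<bullet> (x - x0) / r\<^sup>2"
          have u: "u > 0" using True pos[of x] by (simp add: u_def)
          have "(\<lambda>k. exp (- (inverse (real (Suc k)) * inverse u))) \<longlonglongrightarrow> exp (- (0 * inverse u))"
            by (intro tendsto_intros LIMSEQ_inverse_real_of_nat)
          moreover have "\<zeta> k x = exp (- (inverse (real (Suc k)) * inverse u))" for k
            using u unfolding \<zeta>_def u_def[symmetric]
            by (simp add: flat_exp_def mult_le_0_iff del: of_nat_Suc)
          ultimately show ?thesis using True by simp
        qed (simp add: out)
        show "AE x in lebesgue. (\<lambda>k. ?h x * \<zeta> k x) \<longlonglongrightarrow> indicator (ball x0 r) x * ?h x"
          using lim1 by (intro AE_I2) (auto intro!: tendsto_eq_intros simp: mult.commute)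
        show "AE x in lebesgue. norm (?h x * \<zeta> k x) \<le> \<bar>?h x\<bar>" for k
        proof (intro AE_I2)
          fix x
          have "\<bar>\<zeta> k x\<bar> \<le> 1" by (simp add: \<zeta>_def flat_exp_0_bounds abs_of_nonneg del: of_nat_Suc)
          then show "norm (?h x * \<zeta> k x) \<le> \<bar>?h x\<bar>"
            unfolding real_norm_def abs_mult by (intro mult_left_le) auto
        qed
        show "(\<lambda>x. ?h x * \<zeta> k x) \<in> borel_measurable lebesgue" for k
          using borel_measurable_integrable[OF int[OF ys]]
            borel_measurable_integrable[OF test_functions_integrable[OF tf]] by (rule borel_measurable_times)
        show "(\<lambda>x. indicator (ball x0 r) x * ?h x) \<in> borel_measurable lebesgue"
          by (rule borel_measurable_times[OF borel_measurable_indicator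
                borel_measurable_integrable[OF int[OF ys]]]) auto
      qed (use int[OF ys] in auto)
      moreover have "(LINT x|lebesgue. ?h x * \<zeta> k x) = 0" for k
      proof -
        have "(\<lambda>x. ?h x * \<zeta> k x) = (\<lambda>x. g x * \<zeta> k x)"
        proof (rule ext)
          show "?h x * \<zeta> k x = g x * \<zeta> k x" for x
          using out[of x k] r(2) by (cases "x \<in> ball x0 r") (auto simp: subset_iff less_imp_le)
        qed
        moreover have "(LINT x|lebesgue_on W. g x * \<zeta> k x) = (LINT x|lebesgue. g x * \<zeta> k x)"
          by (rule integral_lebesgue_on_eq(1)[OF W']) (use out subsetD[OF order_trans[OF ball_subset_cball sub]] in force)
        ultimately show ?thesis using zero[OF tf, of k] by (simp only:)
      qed
      ultimately show ?thesis
        by (simp add: LIMSEQ_const_iff)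
    qed
    have "AE x in lebesgue. x \<in> ball y s \<longrightarrow> ?h x = 0"
      by (rule AE_zero_if_integral_balls_zero[OF int[OF ys] open_ball ball0])
    then show ?thesis by eventually_elim auto
  qed
  have cov: "\<exists>i. i \<in> {i. cball (fst i) (snd i) \<subseteq> W} \<and> x \<in> ball (fst i) (snd i) \<and> snd i < d" if "x \<in> W" "0 < d" for x d
  proof -
    obtain e where "e > 0" "cball x e \<subseteq> W" using W \<open>x \<in> W\<close> open_contains_cball by blast
    moreover have "cball x (min e (d/2)) \<subseteq> cball x e" by (intro subset_cball) simp
    ultimately show ?thesis
      using \<open>0 < d\<close> by (intro exI[where x="(x, min e (d/2))"]) auto
  qed
  obtain C where C: "countable C" "C \<subseteq> {i. cball (fst i) (snd i) \<subseteq> W}"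
      "negligible (W - (\<Union>i\<in>C. ball (fst i) (snd i)))"
  proof (rule Vitali_covering_theorem_balls[of W "{i. cball (fst i) (snd i) \<subseteq> W}" fst snd])
    show "\<exists>i. i \<in> {i. cball (fst i) (snd i) \<subseteq> W} \<and> x \<in> ball (fst i) (snd i) \<and> snd i < d"
      if "x \<in> W" "0 < d" for x d
      using that by (rule cov)
  qed (rule that)
  have "AE x in lebesgue. \<forall>i\<in>C. x \<in> ball (fst i) (snd i) \<longrightarrow> g x = 0"
  proof (subst AE_ball_countable[OF C(1)], rule ballI)
    fix i assume "i \<in> C"
    then have "cball (fst i) (snd i) \<subseteq> W" using C(2) by blast
    then show "AE x in lebesgue. x \<in> ball (fst i) (snd i) \<longrightarrow> g x = 0" by (rule loc)
  qed
  moreover have "AE x in lebesgue. x \<notin> W - (\<Union>i\<in>C. ball (fst i) (snd i))"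
    using C(3) by (intro AE_not_in) (simp add: negligible_iff_null_sets)
  ultimately show ?thesis by eventually_elim blast
qed

lemma integrable_mult_compact_support:
  fixes f g :: "'a::euclidean_space \<Rightarrow> real"
  assumes S: "compact S" and f: "integrable (lebesgue_on S) f"
    and g: "continuous_on UNIV g" "\<And>x. x \<notin> S \<Longrightarrow> g x = 0"
  shows "integrable lebesgue (\<lambda>x. f x * g x)"
proof -
  have cut: "integrable lebesgue (\<lambda>x. indicator S x *\<^sub>R f x)"
    using f lmeasurable_compact[OF S] integrable_restrict_space[of S lebesgue f] by (simp add: fmeasurableD)
  obtain M where M: "M > 0" "\<And>x. norm (g x) \<le> M"
    using bounded_compact_support[OF g(1) S g(2)] by blast
  have "integrable lebesgue (\<lambda>x. indicator S x *\<^sub>R f x * g x)"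
  proof (rule Bochner_Integration.integrable_bound[where f="\<lambda>x. M * (indicator S x *\<^sub>R f x)"])
    show "integrable lebesgue (\<lambda>x. M * (indicator S x *\<^sub>R f x))"
      using cut by (rule integrable_mult_right)
    show "(\<lambda>x. indicator S x *\<^sub>R f x * g x) \<in> borel_measurable lebesgue"
      by (intro borel_measurable_times borel_measurable_integrable[OF cut]
          borel_measurable_integrable[OF integrable_compact_support[OF g(1) S g(2)]])
    show "AE x in lebesgue. norm (indicator S x *\<^sub>R f x * g x) \<le> norm (M * (indicator S x *\<^sub>R f x))"
    proof (intro AE_I2)
      fix x
      show "norm (indicator S x *\<^sub>R f x * g x) \<le> norm (M * (indicator S x *\<^sub>R f x))"
        using mult_right_mono[OF M(2)[of x], of "norm (indicator S x *\<^sub>R f x)"] M(1)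
        by (simp add: abs_mult mult_ac)
    qed
  qed
  moreover have "(\<lambda>x. indicator S x *\<^sub>R f x * g x) = (\<lambda>x. f x * g x)"
  proof (rule ext)
    show "indicator S x *\<^sub>R f x * g x = f x * g x" for x
      by (cases "x \<in> S") (simp_all add: g(2))
  qed
  ultimately show ?thesis by simp
qed

text \<open>\<open>u\<close> is known to be differentiable only on \<open>W\<close>, but its product
  with a test function supported in \<open>W\<close> is continuously differentiable on the whole
  space, so the classical integration by parts applies to the product. Comparison with the weak
  identity shows that the two gradients have the same integrals against all test functions on
  \<open>W\<close>.\<close>

lemma weak_gradient_eq_jacobian:
  fixes u :: "real^'n \<Rightarrow> real^'m"
  assumes w: "has_weak_gradient \<Omega> u V" and \<Omega>: "open \<Omega>" and W: "open W" "W \<subseteq> \<Omega>" and u: "u \<in> C1_closure W"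
  shows "AE x in lebesgue. x \<in> W \<longrightarrow> V x = jacobian u (at x)"
proof -
  obtain G where G0: "continuous_on (closure W) G" "\<And>x. x \<in> W \<Longrightarrow> (u has_derivative (\<lambda>h. G x *v h)) (at x)"
    using u by (auto simp: C1_closure_def)
  have G: "continuous_on W G" using G0(1) closure_subset continuous_on_subset by blast
  have cu: "continuous_on W u"
    using G0(2) W(1) by (intro continuous_at_imp_continuous_on) (blast intro: has_derivative_continuous)
  have locV: "locally_integrable \<Omega> V" and locu: "locally_integrable \<Omega> u"
    using w by (auto simp: has_weak_gradient_def)
  have sets: "\<Omega> \<in> sets lebesgue" "W \<in> sets lebesgue" using \<Omega> W(1) by auto
  have comp: "AE x in lebesgue. x \<in> W \<longrightarrow> V x $ i $ j - G x $ i $ j = 0" for i j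
  proof (rule fundamental_lemma_variations[OF W(1)])
    have cG: "continuous_on W (\<lambda>x. G x $ i $ j)" by (intro continuous_on_component G)
    have locG: "integrable (lebesgue_on S) (\<lambda>x. G x $ i $ j)" if "compact S" "S \<subseteq> W" for S
    proof -
      have "integrable lebesgue (\<lambda>x. indicator S x *\<^sub>R (G x $ i $ j))"
        using borel_integrable_compact[OF that(1) continuous_on_subset[OF cG that(2)]]
        by (subst integrable_completion) auto
      then show ?thesis
        using lmeasurable_compact[OF that(1)] by (subst integrable_restrict_space) (auto simp: fmeasurableD)
    qed
    have locVij: "integrable (lebesgue_on S) (\<lambda>x. V x $ i $ j)" if "compact S" "S \<subseteq> \<Omega>" for S
    proof -
      have "integrable (lebesgue_on S) V" using locV that by (auto simp: locally_integrable_def)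
      then have "integrable (lebesgue_on S) (\<lambda>x. V x $ i)"
        by (rule integrable_bounded_linear[OF bounded_linear_vec_nth])
      then show ?thesis by (rule integrable_bounded_linear[OF bounded_linear_vec_nth])
    qed
    show "locally_integrable W (\<lambda>x. V x $ i $ j - G x $ i $ j)"
      unfolding locally_integrable_def
      using locG locVij W(2) by (auto intro!: Bochner_Integration.integrable_diff)
    fix \<zeta> :: "real^'n \<Rightarrow> real" assume \<zeta>: "\<zeta> \<in> test_functions W"
    obtain S where S: "compact S" "S \<subseteq> W" "\<And>x. x \<notin> S \<Longrightarrow> \<zeta> x = 0" "\<And>x h. x \<notin> S \<Longrightarrow> frechet_derivative \<zeta> (at x) h = 0"
      by (rule test_functions_support[OF \<zeta>]) (rule that)
    let ?e = "axis j 1 :: real^'n"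
    let ?d = "\<lambda>x. frechet_derivative \<zeta> (at x)"
    have Gj: "(G x *v ?e) $ i = G x $ i $ j" for x
      by (simp add: matrix_vector_mul_component inner_axis)
    define f' where "f' = (\<lambda>x h. u x $ i * ?d x h + (G x *v h) $ i * \<zeta> x)"
    have zero: "(LINT x|lebesgue. f' x ?e) = 0"
    proof (rule integral_partial_derivative_eq_0[where f="\<lambda>x. u x $ i * \<zeta> x" and S=S and f'=f'])
      show "((\<lambda>x. u x $ i * \<zeta> x) has_derivative f' x) (at x)" for x
      proof (cases "x \<in> W")
        case True
        have "((\<lambda>x. u x $ i) has_derivative (\<lambda>h. (G x *v h) $ i)) (at x)"
          by (rule bounded_linear.has_derivative[OF bounded_linear_vec_nth G0(2)[OF True]])
        then show ?thesis
          unfolding f'_def by (intro has_derivative_mult test_functions_has_derivative[OF \<zeta>])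
      next
        case False
        then have x: "x \<in> - S" using S(2) by blast
        have "open (- S)" using S(1) compact_imp_closed by blast
        have "((\<lambda>x. 0) has_derivative (\<lambda>h. 0)) (at x)" by (rule has_derivative_const)
        then have "((\<lambda>x. u x $ i * \<zeta> x) has_derivative (\<lambda>h. 0)) (at x)"
          by (rule has_derivative_transform_within_open[OF _ \<open>open (- S)\<close> x]) (simp add: S(3))
        moreover have "f' x = (\<lambda>h. 0)" using x S(3,4) by (simp add: f'_def)
        ultimately show ?thesis by simp
      qed
      have "continuous_on W (\<lambda>x. f' x ?e)"
        unfolding f'_def Gj
        using continuous_on_subset[OF test_functions_continuous[OF \<zeta>] subset_UNIV]
          continuous_on_subset[OF test_functions_continuous[OF test_functions_partial[OF \<zeta>]] subset_UNIV]
        by (intro continuous_on_add continuous_on_mult cG continuous_on_component cu)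
      moreover have "continuous_on (- S) (\<lambda>x. f' x ?e)"
      proof (rule continuous_on_eq)
        show "continuous_on (- S) (\<lambda>x. 0 :: real)" by simp
        show "0 = f' x ?e" if "x \<in> - S" for x using that S(3,4) by (simp add: f'_def)
      qed
      \<comment> \<open>\<open>W\<close> and the complement of \<open>S\<close> are open and
        together cover the space, so continuity on each of them suffices.\<close>
      ultimately have "continuous_on (W \<union> - S) (\<lambda>x. f' x ?e)"
        using W(1) S(1) by (intro continuous_on_open_Un) (auto simp: compact_imp_closed)
      moreover have "W \<union> - S = UNIV" using S(2) by blast
      ultimately show "continuous_on UNIV (\<lambda>x. f' x ?e)" by simp
    qed (use S in auto)
    note prod = integrable_mult_compact_support[OF S(1)]
    have iu: "integrable lebesgue (\<lambda>x. u x $ i * ?d x ?e)"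
    proof (rule prod)
      have "integrable (lebesgue_on S) u" using locu S(1,2) W(2) by (auto simp: locally_integrable_def)
      then show "integrable (lebesgue_on S) (\<lambda>x. u x $ i)"
        by (rule integrable_bounded_linear[OF bounded_linear_vec_nth])
    qed (use S(4) test_functions_continuous[OF test_functions_partial[OF \<zeta>]] in auto)
    have iG: "integrable lebesgue (\<lambda>x. G x $ i $ j * \<zeta> x)"
      by (rule prod[OF locG[OF S(1,2)] test_functions_continuous[OF \<zeta>] S(3)])
    have iV: "integrable lebesgue (\<lambda>x. V x $ i $ j * \<zeta> x)"
      by (rule prod[OF locVij[OF S(1)] test_functions_continuous[OF \<zeta>] S(3)]) (use S(2) W(2) in auto)
    have 1: "(LINT x|lebesgue. u x $ i * ?d x ?e) + (LINT x|lebesgue. G x $ i $ j * \<zeta> x) = 0"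
      using zero iu iG unfolding f'_def Gj by simp
    have out: "\<zeta> x = 0" "?d x h = 0" if "x \<notin> W" for x h
      using S(2-4) that by blast+
    have "\<zeta> \<in> test_functions \<Omega>" using test_functions_mono[OF W(2) \<zeta>] .
    then have "(LINT x|lebesgue_on \<Omega>. u x $ i * ?d x ?e) = - (LINT x|lebesgue_on \<Omega>. V x $ i $ j * \<zeta> x)"
      using w by (auto simp: has_weak_gradient_def)
    moreover have "(LINT x|lebesgue_on \<Omega>. u x $ i * ?d x ?e) = (LINT x|lebesgue. u x $ i * ?d x ?e)"
      by (rule integral_lebesgue_on_eq(1)[OF sets(1)]) (use out W(2) in auto)
    moreover have "(LINT x|lebesgue_on \<Omega>. V x $ i $ j * \<zeta> x) = (LINT x|lebesgue. V x $ i $ j * \<zeta> x)"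
      by (rule integral_lebesgue_on_eq(1)[OF sets(1)]) (use out W(2) in auto)
    ultimately have "(LINT x|lebesgue. V x $ i $ j * \<zeta> x - G x $ i $ j * \<zeta> x) = 0"
      using 1 iV iG by simp
    moreover have "(LINT x|lebesgue_on W. (V x $ i $ j - G x $ i $ j) * \<zeta> x) =
        (LINT x|lebesgue. (V x $ i $ j - G x $ i $ j) * \<zeta> x)"
      by (rule integral_lebesgue_on_eq(1)[OF sets(2)]) (simp add: out)
    ultimately show "(LINT x|lebesgue_on W. (V x $ i $ j - G x $ i $ j) * \<zeta> x) = 0"
      by (simp add: left_diff_distrib)
  qed
  have "AE x in lebesgue. \<forall>i. \<forall>j. x \<in> W \<longrightarrow> V x $ i $ j - G x $ i $ j = 0"
    by (intro eventually_all_finite comp)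
  then show ?thesis
  proof eventually_elim
    case (elim x)
    show ?case
    proof
      assume "x \<in> W"
      then show "V x = jacobian u (at x)"
        using elim jacobian_eqI[OF G0(2)] by (simp add: vec_eq_iff)
    qed
  qed
qed

subsection \<open>Convex integration\<close>

lemma test_functions_diff:
  assumes "f \<in> test_functions \<Omega>" "g \<in> test_functions \<Omega>"
  shows "(\<lambda>x. f x - g x) \<in> test_functions \<Omega>"
  using test_functions_add[OF assms(1) test_functions_bounded_linear[OF _ assms(2), of uminus]]
  by (simp add: bounded_linear_minus[OF bounded_linear_ident])

lemma jacobian_diff:
  fixes f g :: "real^'n \<Rightarrow> real^'m"
  assumes "f \<in> test_functions \<Omega>" "g \<in> test_functions \<Omega>"
  shows "jacobian (\<lambda>x. f x - g x) (at x) = jacobian f (at x) - jacobian g (at x)"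
  using jacobian_add[OF test_functions_diff[OF assms] assms(2), of x] by simp

lemma splits_antimono: "splits K c \<xi> \<Longrightarrow> c' \<le> c \<Longrightarrow> splits K c' \<xi>"
  unfolding splits_def by force

text \<open>A supremum need not be attained, but half of a positive one is exceeded by some element,
  and if the supremum is 0 any element will do. The lost factor 2 only affects constants.\<close>

lemma half_maximal:
  fixes S :: "real set"
  assumes "x0 \<in> S" "\<And>x. x \<in> S \<Longrightarrow> 0 \<le> x" "\<And>x. x \<in> S \<Longrightarrow> x \<le> B"
  obtains x where "x \<in> S" "\<And>y. y \<in> S \<Longrightarrow> y \<le> 2 * x"
proof (cases "Sup S = 0")
  case True
  have "y \<le> 0" if "y \<in> S" for y
    using cSup_upper[OF that, of] assms(3) True by (auto simp: bdd_above_def)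
  then show ?thesis using that[of x0] assms(1,2) by fastforce
next
  case False
  have bdd: "bdd_above S" using assms(3) by (auto simp: bdd_above_def)
  have "0 \<le> Sup S" using cSup_upper[OF assms(1) bdd] assms(2)[OF assms(1)] by simp
  then have "Sup S / 2 < Sup S" using False by simp
  then obtain x where "x \<in> S" "Sup S / 2 < x"
    using less_cSup_iff[OF _ bdd, of "Sup S / 2"] assms(1) by auto
  then show ?thesis using that[of x] cSup_upper[OF _ bdd] by force
qed

lemma energy_bound:
  fixes w :: "real^'n \<Rightarrow> real^'m"
  assumes w: "w \<in> test_functions U" and U: "U \<in> lmeasurable" and B: "\<And>x. x \<in> U \<Longrightarrow> norm (jacobian w (at x)) \<le> B"
  shows "energy w \<le> B\<^sup>2 * measure lebesgue U"
proof -
  have "energy w \<le> (LINT x|lebesgue. B\<^sup>2 * indicator U x)"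
    unfolding energy_def
  proof (rule integral_mono)
    show "integrable lebesgue (\<lambda>x. jacobian w (at x) \<bullet> jacobian w (at x))"
      by (rule test_functions_inner_jacobian_integrable[OF w w])
    show "integrable lebesgue (\<lambda>x. B\<^sup>2 * indicat_real U x)"
      using U by (intro integrable_mult_right) (simp add: lmeasurable_iff_integrable)
    show "jacobian w (at x) \<bullet> jacobian w (at x) \<le> B\<^sup>2 * indicat_real U x" for x
    proof (cases "x \<in> U")
      case True
      then show ?thesis
        using power_mono[OF B[OF True] norm_ge_zero, of 2] by (simp add: power2_norm_eq_inner)
    qed (simp add: test_functions_outside(2)[OF w])
  qed
  also have "\<dots> = B\<^sup>2 * measure lebesgue U" by simp
  finally show ?thesis .
qed

text \<open>The half-maximal choice links the conclusions: a vanishing increment of energy means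
  that nothing much could have been gained, hence that the set still splitting at scale
  \<open>c\<close> is small. This holds for each \<open>c\<close> separately and without a rate, so
  the extraction of a subsequence is left to the passage to the limit.\<close>

lemma convex_integration_sequence:
  fixes G :: "real^'n \<Rightarrow> real^'n^'m"
  assumes K: "open K" "bounded K" and U: "open U" "bounded U" and G: "continuous_on U G" "G ` U \<subseteq> K"
  obtains v :: "nat \<Rightarrow> real^'n \<Rightarrow> real^'m" and B where
    "\<And>k. v k \<in> test_functions U" "\<And>k x. x \<in> U \<Longrightarrow> G x + jacobian (v k) (at x) \<in> K"
    "\<And>k x. norm (v k x) \<le> B" "\<And>k x. norm (jacobian (v k) (at x)) \<le> B"
    "\<And>k l x. k \<le> l \<Longrightarrow> norm (v l x - v k x) \<le> 2 / 2 ^ k"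
    "\<And>\<delta>. \<delta> > 0 \<Longrightarrow> \<exists>N. \<forall>k\<ge>N. \<forall>l\<ge>k. energy (\<lambda>x. v l x - v k x) < \<delta>"
    "\<And>c. c > 0 \<Longrightarrow> (\<lambda>k. measure lebesgue {x\<in>U. splits K c (G x + jacobian (v k) (at x))}) \<longlonglongrightarrow> 0"
proof -
  obtain R where R: "R > 0" "\<And>\<xi>. \<xi> \<in> K \<Longrightarrow> norm \<xi> \<le> R"
    using K(2) by (auto simp: bounded_pos)
  have lmU: "U \<in> lmeasurable" using U by (simp add: lmeasurable_open)
  define E where "E = (2 * R)\<^sup>2 * measure lebesgue U"
  define adm where "adm = (\<lambda>v e. {w. w \<in> test_functions U \<and> (\<forall>x. norm (w x) \<le> e) \<and>
      (\<forall>x\<in>U. G x + jacobian v (at x) + jacobian w (at x) \<in> K)})"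
  \<comment> \<open>The amplitude is paired with the map because it can be chosen only after it: the
    constant in the orthogonality estimate depends on the second derivatives of
    \<open>v\<close>.\<close>
  define P where "P = (\<lambda>k (s :: (real^'n \<Rightarrow> real^'m) \<times> real). case s of (v, e) \<Rightarrow>
      v \<in> test_functions U \<and> (\<forall>x\<in>U. G x + jacobian v (at x) \<in> K) \<and> 0 < e \<and> e \<le> 1 / 2 ^ k \<and>
      (\<forall>w\<in>test_functions U. (\<forall>x. norm (w x) \<le> 2 * e) \<longrightarrow>
        \<bar>LINT x|lebesgue. jacobian v (at x) \<bullet> jacobian w (at x)\<bar> \<le> 1 / 2 ^ k))"
  define Q where "Q = (\<lambda>s s' :: (real^'n \<Rightarrow> real^'m) \<times> real. snd s' \<le> snd s / 2 \<and>
      (\<exists>w\<in>adm (fst s) (snd s). fst s' = (\<lambda>x. fst s x + w x) \<and>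
        (\<forall>w'\<in>adm (fst s) (snd s). energy w' \<le> 2 * energy w)))"
  \<comment> \<open>Both matrices lie in the ball of radius \<open>R\<close>, so the gradient of any
    competitor is bounded by 2 * R. This gives the common bound \<open>E\<close> on
    energies.\<close>
  have jb: "norm (jacobian w (at x)) \<le> 2 * R"
    if "\<xi> \<in> K" "\<xi> + jacobian w (at x) \<in> K" for \<xi> and w :: "real^'n \<Rightarrow> real^'m" and x
    using norm_triangle_ineq4[of "\<xi> + jacobian w (at x)" \<xi>] R(2)[OF that(1)] R(2)[OF that(2)] by simp
  \<comment> \<open>All perturbations made after \<open>v\<close> add up to at most \<open>2 * e\<close>; integrating by parts, their gradients
    are then almost orthogonal to that of \<open>v\<close> in \<open>L\<^sup>2\<close>.\<close>
  have small: "\<exists>e. 0 < e \<and> e \<le> d \<and> P k (v, e)"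
    if v: "v \<in> test_functions U" "\<forall>x\<in>U. G x + jacobian v (at x) \<in> K" and d: "0 < d" "d \<le> 1 / 2 ^ k" for v d k
  proof -
    obtain C where C: "C \<ge> 0" "\<And>w e. w \<in> test_functions U \<Longrightarrow> (\<And>x. norm (w x) \<le> e) \<Longrightarrow>
        \<bar>LINT x|lebesgue. jacobian v (at x) \<bullet> jacobian w (at x)\<bar> \<le> C * e"
      using jacobian_inner_integral_bound[OF v(1), of U] by blast
    define D where "D = C + 1"
    have D: "D > 0" "C \<le> D" using C(1) by (auto simp: D_def)
    define e where "e = min d (1 / (2 ^ k * 2 * D))"
    have e: "0 < e" "e \<le> d" "e \<le> 1 / (2 ^ k * 2 * D)"
      using d D by (auto simp: e_def)
    have "C * (2 * e) \<le> D * (2 * (1 / (2 ^ k * 2 * D)))"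
      using C(1) D e by (intro mult_mono) auto
    also have "\<dots> = 1 / 2 ^ k" using D(1) by simp
    finally have Ce: "C * (2 * e) \<le> 1 / 2 ^ k" .
    have "P k (v, e)"
      unfolding P_def using v e d order_trans[OF C(2) Ce] by auto
    then show ?thesis using e by blast
  qed
  have base: "\<exists>s. P 0 s"
  proof -
    have "jacobian (\<lambda>x. 0 :: real^'m) (at x) = 0" for x :: "real^'n"
      by (rule jacobian_eqI) simp
    then have "\<exists>e. 0 < e \<and> e \<le> 1 \<and> P 0 (\<lambda>x. 0, e)"
      using G(2) by (intro small) (auto simp: test_functions_zero)
    then show ?thesis by blast
  qed
  have step: "\<exists>s'. P (Suc k) s' \<and> Q s s'" if s: "P k s" for k s
  proof -
    obtain v e where ve: "s = (v, e)" by (cases s)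
    have v: "v \<in> test_functions U" "\<forall>x\<in>U. G x + jacobian v (at x) \<in> K" "0 < e" "e \<le> 1 / 2 ^ k"
      using s by (auto simp: ve P_def)
    have "(\<lambda>x. 0) \<in> adm v e"
    proof -
      have "jacobian (\<lambda>x. 0 :: real^'m) (at x) = 0" for x :: "real^'n"
        by (rule jacobian_eqI) simp
      then show ?thesis using v by (simp add: adm_def test_functions_zero)
    qed
    moreover have "energy w \<le> E" if "w \<in> adm v e" for w
      unfolding E_def using that v(2) by (intro energy_bound[OF _ lmU] jb) (auto simp: adm_def)
    ultimately obtain w where w: "w \<in> adm v e" "\<And>w'. w' \<in> adm v e \<Longrightarrow> energy w' \<le> 2 * energy w"
    proof -
      assume zero: "(\<lambda>x. 0) \<in> adm v e" and bound: "\<And>w. w \<in> adm v e \<Longrightarrow> energy w \<le> E"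
      have "\<exists>m\<in>energy ` adm v e. \<forall>y\<in>energy ` adm v e. y \<le> 2 * m"
      proof (rule half_maximal)
        show "energy (\<lambda>x :: real^'n. 0 :: real^'m) \<in> energy ` adm v e" using zero by (rule imageI)
        show "0 \<le> m" if "m \<in> energy ` adm v e" for m using that by (auto simp: energy_nonneg)
        show "m \<le> E" if "m \<in> energy ` adm v e" for m using that bound by auto
      qed blast
      then show thesis using that by blast
    qed
    let ?v' = "\<lambda>x. v x + w x"
    have w': "w \<in> test_functions U" "\<forall>x\<in>U. G x + jacobian v (at x) + jacobian w (at x) \<in> K"
      using w(1) by (auto simp: adm_def)
    have "?v' \<in> test_functions U" "\<forall>x\<in>U. G x + jacobian ?v' (at x) \<in> K"
      using test_functions_add[OF v(1) w'(1)] w'(2) jacobian_add[OF v(1) w'(1)] by (simp_all add: add.assoc)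
    then obtain e' where "0 < e'" "e' \<le> e / 2" "P (Suc k) (?v', e')"
      using small[of ?v' "e / 2" "Suc k"] v(3,4) by auto
    then show ?thesis
      using w by (intro exI[of _ "(?v', e')"]) (auto simp: Q_def ve)
  qed
  obtain f where f: "\<And>k. P k (f k)" "\<And>k. Q (f k) (f (Suc k))"
    using dependent_nat_choice[of P "\<lambda>k. Q", OF base step] by blast
  define v where "v = (\<lambda>k. fst (f k))"
  define e where "e = (\<lambda>k. snd (f k))"
  have v: "v k \<in> test_functions U" "\<And>x. x \<in> U \<Longrightarrow> G x + jacobian (v k) (at x) \<in> K"
    and e: "0 < e k" "e k \<le> 1 / 2 ^ k"
    and ort: "\<And>w. w \<in> test_functions U \<Longrightarrow> (\<And>x. norm (w x) \<le> 2 * e k) \<Longrightarrow>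
        \<bar>LINT x|lebesgue. jacobian (v k) (at x) \<bullet> jacobian w (at x)\<bar> \<le> 1 / 2 ^ k" for k
    using f(1)[of k] by (auto simp: P_def v_def e_def split: prod.splits)
  have e_half: "e (Suc k) \<le> e k / 2" for k using f(2)[of k] by (simp add: Q_def e_def)
  have "\<exists>w\<in>adm (v k) (e k). v (Suc k) = (\<lambda>x. v k x + w x) \<and>
      (\<forall>w'\<in>adm (v k) (e k). energy w' \<le> 2 * energy w)" for k
    using f(2)[of k] by (simp add: Q_def v_def e_def)
  then obtain w where w: "\<And>k. w k \<in> adm (v k) (e k)" "\<And>k. v (Suc k) = (\<lambda>x. v k x + w k x)"
      "\<And>k w'. w' \<in> adm (v k) (e k) \<Longrightarrow> energy w' \<le> 2 * energy (w k)"
    by metis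
  have wn: "norm (w k x) \<le> e k" for k x using w(1)[of k] by (simp add: adm_def)
  \<comment> \<open>The subtracted last term makes the induction work: a further step costs
    \<open>e (k + j)\<close>, and halving the amplitude refunds exactly as much.\<close>
  have osc: "norm (v (k + j) x - v k x) \<le> 2 * e k - 2 * e (k + j)" for k j x
  proof (induction j)
    case (Suc j)
    have "norm (v (k + Suc j) x - v k x) \<le> norm (v (k + j) x - v k x) + norm (w (k + j) x)"
      using norm_triangle_ineq[of "v (k + j) x - v k x" "w (k + j) x"] by (simp add: w(2) algebra_simps)
    then show ?case using Suc wn[of "k + j" x] e_half[of "k + j"] by simp
  qed simp
  have osc': "norm (v l x - v k x) \<le> 2 * e k" if "k \<le> l" for k l x
    using osc[of k "l - k" x] e(1)[of l] that by simp
  have jv: "norm (jacobian (v k) (at x)) \<le> 2 * R" for k x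
  proof (cases "x \<in> U")
    case True
    then show ?thesis using jb[of "G x" "v k" x] v(2) G(2) by auto
  qed (use test_functions_outside(2)[OF v(1)] R(1) in simp)
  have en: "energy (v k) \<le> E" for k
    unfolding E_def by (intro energy_bound[OF v(1) lmU] jv)
  have pyth: "energy (\<lambda>x. v l x - v k x) \<le> energy (v l) - energy (v k) + 2 / 2 ^ k" if "k \<le> l" for k l
  proof -
    let ?d = "\<lambda>x. v l x - v k x"
    have d: "?d \<in> test_functions U" by (rule test_functions_diff[OF v(1) v(1)])
    have "energy (v l) = energy (v k) + 2 * (LINT x|lebesgue. jacobian (v k) (at x) \<bullet> jacobian ?d (at x)) + energy ?d"
      using energy_add[OF v(1)[of k] d] by simp
    then show ?thesis using ort[OF d osc'[OF that]] by simp
  qed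
  \<comment> \<open>Step k may lower the energy by at most 2 / 2^k. Subtracting 4 / 2^k, the sum of
    these losses from k onwards, leaves an increasing sequence.\<close>
  define b where "b = (\<lambda>k. energy (v k) - 4 / 2 ^ k)"
  have "incseq b"
  proof (rule incseq_SucI)
    show "b k \<le> b (Suc k)" for k
      using pyth[of k "Suc k"] energy_nonneg[of "\<lambda>x. v (Suc k) x - v k x"]
      by (simp add: b_def)
  qed
  moreover have "b k \<le> E" for k
  proof -
    have "0 \<le> 4 / (2 :: real) ^ k" by simp
    then show ?thesis using en[of k] unfolding b_def by linarith
  qed
  ultimately obtain L where "b \<longlonglongrightarrow> L" using incseq_convergent by blast
  moreover have pow: "(\<lambda>k. c / (2 :: real) ^ k) \<longlonglongrightarrow> 0" for c :: real
    using tendsto_mult[OF tendsto_const[of c] LIMSEQ_power_zero[of "1/2::real"]]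
    by (simp add: power_divide)
  ultimately have "(\<lambda>k. b k + 4 / 2 ^ k) \<longlonglongrightarrow> L + 0" by (intro tendsto_add)
  then have lim: "(\<lambda>k. energy (v k)) \<longlonglongrightarrow> L" by (simp add: b_def)
  have cauchy: "\<exists>N. \<forall>k\<ge>N. \<forall>l\<ge>k. energy (\<lambda>x. v l x - v k x) < \<delta>" if "\<delta> > 0" for \<delta>
  proof -
    obtain N1 where N1: "\<And>k. k \<ge> N1 \<Longrightarrow> \<bar>energy (v k) - L\<bar> < \<delta> / 4"
      using LIMSEQ_D[OF lim, of "\<delta> / 4"] \<open>\<delta> > 0\<close> by auto
    obtain N2 where N2: "\<And>k. k \<ge> N2 \<Longrightarrow> 2 / 2 ^ k < \<delta> / 4"
      using LIMSEQ_D[OF pow[of 2], of "\<delta> / 4"] \<open>\<delta> > 0\<close> by auto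
    have "energy (\<lambda>x. v l x - v k x) < \<delta>" if "k \<ge> max N1 N2" "l \<ge> k" for k l
      using pyth[OF that(2)] N1[of k] N1[of l] N2[of k] that \<open>\<delta> > 0\<close> by linarith
    then show ?thesis by blast
  qed
  have gain: "(\<lambda>k. measure lebesgue {x\<in>U. splits K c (G x + jacobian (v k) (at x))}) \<longlonglongrightarrow> 0" if c: "c > 0" for c
  proof (rule Lim_null_comparison)
    \<comment> \<open>The 16 is the 8 of the energy gain, doubled because \<open>w k\<close> has at
      least half the energy of any competitor.\<close>
    have le: "measure lebesgue {x\<in>U. splits K c (G x + jacobian (v k) (at x))}
        \<le> 16 / (bump_mass TYPE('n) * c\<^sup>2) * energy (w k)" for k
    proof -
      have cont: "continuous_on U (\<lambda>x. G x + jacobian (v k) (at x))"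
        using continuous_on_subset[OF test_functions_continuous_jacobian[OF v(1)] subset_UNIV]
        by (intro continuous_on_add G(1))
      have img: "(\<lambda>x. G x + jacobian (v k) (at x)) ` U \<subseteq> K" using v(2) by blast
      obtain z where z: "z \<in> test_functions U" "\<And>x. norm (z x) \<le> e k"
          "\<And>x. x \<in> U \<Longrightarrow> G x + jacobian (v k) (at x) + jacobian z (at x) \<in> K"
          "bump_mass TYPE('n) / 8 * c\<^sup>2 *
            measure lebesgue {x\<in>U. splits K c (G x + jacobian (v k) (at x))} \<le> energy z"
        by (rule energy_gain[OF K(1) U cont img c e(1)[of k]]) (rule that)
      have "energy z \<le> 2 * energy (w k)" using z by (intro w(3)) (simp add: adm_def)
      then show ?thesis using z(4) c bump_mass_pos[where 'n='n] by (simp add: field_simps)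
    qed
    then show "\<forall>\<^sub>F k in sequentially. norm (measure lebesgue {x\<in>U. splits K c (G x + jacobian (v k) (at x))})
        \<le> 16 / (bump_mass TYPE('n) * c\<^sup>2) * energy (w k)"
      by simp
    have "(\<lambda>k. energy (w k)) \<longlonglongrightarrow> 0"
    proof (rule LIMSEQ_I)
      fix \<delta> :: real assume "\<delta> > 0"
      then obtain N where N: "\<forall>k\<ge>N. \<forall>l\<ge>k. energy (\<lambda>x. v l x - v k x) < \<delta>" using cauchy by blast
      have "(\<lambda>x. v (Suc k) x - v k x) = w k" for k by (simp add: w(2))
      then have "energy (w k) < \<delta>" if "k \<ge> N" for k
        using N that by (metis le_SucI order_refl)
      then show "\<exists>N. \<forall>k\<ge>N. norm (energy (w k) - 0) < \<delta>"
        by (intro exI[of _ N]) (simp add: abs_of_nonneg[OF energy_nonneg])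
    qed
    then show "(\<lambda>k. 16 / (bump_mass TYPE('n) * c\<^sup>2) * energy (w k)) \<longlonglongrightarrow> 0"
      by (rule tendsto_mult_right_zero)
  qed
  obtain S where S: "compact S" "\<And>x. x \<notin> S \<Longrightarrow> v 0 x = 0"
    using test_functions_support[OF v(1)[of 0]] by metis
  obtain M where M: "M > 0" "\<And>x. norm (v 0 x) \<le> M"
    using bounded_compact_support[OF test_functions_continuous[OF v(1)] S] by blast
  show thesis
  proof (rule that[of v "M + 2 + 2 * R"])
    show "norm (v k x) \<le> M + 2 + 2 * R" for k x
      using norm_triangle_ineq[of "v k x - v 0 x" "v 0 x"] osc'[of 0 k x] e(2)[of 0] M(2)[of x] R(1) by simp
    show "norm (jacobian (v k) (at x)) \<le> M + 2 + 2 * R" for k x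
      using jv[of k x] M(1) by simp
    show "norm (v l x - v k x) \<le> 2 / 2 ^ k" if "k \<le> l" for k l x
      using osc'[OF that, of x] e(2)[of k] by simp
  qed (use v cauchy gain in auto)
qed

text \<open>Along a subsequence with summable errors, Borel-Cantelli gives convergence of the
  gradients at almost every point and, at the same points, eventual failure to split at scales
  tending to zero. The limit may lie outside the open set \<open>K\<close>, which is why the
  approximating gradients \<open>\<xi> k x\<close> are part of the conclusion.\<close>

theorem convex_integration:
  fixes G :: "real^'n \<Rightarrow> real^'n^'m"
  assumes K: "open K" "bounded K" and \<Omega>: "open \<Omega>" "bounded \<Omega>" and U: "open U" "U \<subseteq> \<Omega>"
    and G: "continuous_on U G" "G ` U \<subseteq> K"
  obtains v V \<xi> where "v \<in> W1_inf_0 \<Omega>" "has_weak_gradient \<Omega> v V"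
    "AE x in lebesgue. x \<notin> U \<longrightarrow> V x = 0" "\<And>k x. x \<in> U \<Longrightarrow> \<xi> k x \<in> K"
    "AE x in lebesgue. x \<in> U \<longrightarrow> (\<lambda>k. \<xi> k x) \<longlonglongrightarrow> G x + V x \<and> (\<forall>c>0. \<forall>\<^sub>F k in sequentially. \<not> splits K c (\<xi> k x))"
proof -
  have bU: "bounded U" using \<Omega>(2) U(2) bounded_subset by blast
  have lmU: "U \<in> lmeasurable" using U(1) bU by (simp add: lmeasurable_open)
  obtain v :: "nat \<Rightarrow> real^'n \<Rightarrow> real^'m" and B where
    v: "\<And>k. v k \<in> test_functions U" "\<And>k x. x \<in> U \<Longrightarrow> G x + jacobian (v k) (at x) \<in> K"
    and B: "\<And>k x. norm (v k x) \<le> B" "\<And>k x. norm (jacobian (v k) (at x)) \<le> B"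
    and unif: "\<And>k l x. k \<le> l \<Longrightarrow> norm (v l x - v k x) \<le> 2 / 2 ^ k"
    and cauchy: "\<And>\<delta>. \<delta> > 0 \<Longrightarrow> \<exists>N. \<forall>k\<ge>N. \<forall>l\<ge>k. energy (\<lambda>x. v l x - v k x) < \<delta>"
    and null: "\<And>c. c > 0 \<Longrightarrow> (\<lambda>k. measure lebesgue {x\<in>U. splits K c (G x + jacobian (v k) (at x))}) \<longlonglongrightarrow> 0"
    by (rule convex_integration_sequence[OF K U(1) bU G]) (rule that)
  have "\<exists>N. \<forall>k\<ge>N. \<forall>l\<ge>k. energy (\<lambda>x. v l x - v k x) < 1 / 16 ^ i" for i :: nat
    by (rule cauchy) simp
  then obtain N where N: "\<And>i k l. N i \<le> k \<Longrightarrow> k \<le> l \<Longrightarrow> energy (\<lambda>x. v l x - v k x) < 1 / 16 ^ i" by metis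
  define m where "m = (\<lambda>i k. measure lebesgue {x\<in>U. splits K (1 / real (Suc i)) (G x + jacobian (v k) (at x))})"
  have "\<exists>M. \<forall>k\<ge>M. m i k < 1 / 2 ^ i" for i
    using LIMSEQ_D[OF null[of "1 / real (Suc i)"], of "1 / 2 ^ i"] by (simp add: m_def)
  then obtain M where M: "\<And>i k. M i \<le> k \<Longrightarrow> m i k < 1 / 2 ^ i" by metis
  \<comment> \<open>Partial sums of positive terms make \<open>r\<close> strictly increasing and
    keep it above both thresholds.\<close>
  define r where "r = (\<lambda>i. \<Sum>j\<le>i. Suc (N j + M j))"
  have r: "strict_mono r" by (rule strict_mono_Suc_iff[THEN iffD2]) (simp add: r_def)
  have "Suc (N i + M i) \<le> r i" for i
    unfolding r_def by (rule member_le_sum) auto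
  then have rN: "N i \<le> r i" and rM: "M i \<le> r i" for i
    using Suc_leD add_leD1 add_leD2 by (meson le_trans)+
  define \<psi> where "\<psi> = (\<lambda>i. v (r i))"
  define J where "J = (\<lambda>i x. jacobian (\<psi> i) (at x))"
  have tf: "\<psi> i \<in> test_functions U" for i by (simp add: \<psi>_def v(1))
  have J_cont: "continuous_on UNIV (J i)" for i
    unfolding J_def by (rule test_functions_continuous_jacobian[OF tf])
  have J0: "J i x = 0" if "x \<notin> U" for i x
    unfolding J_def by (rule test_functions_outside(2)[OF tf that])
  have mJ: "J i \<in> borel_measurable lebesgue" for i
    unfolding J_def by (rule borel_measurable_integrable[OF test_functions_jacobian_integrable[OF tf]])
  \<comment> \<open>The squared increments are cut at 4^-i while their integral is below 16^-i.
    Markov's inequality then bounds the measure by 4^-i, and off \<open>A i\<close> the increments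
    have norm below 2^-i, which is summable.\<close>
  define A where "A = (\<lambda>i. {x\<in>U. 1 / 4 ^ i \<le> (J (Suc i) x - J i x) \<bullet> (J (Suc i) x - J i x)})"
  define D where "D = (\<lambda>i. {x\<in>U. splits K (1 / real (Suc i)) (G x + J i x)})"
  have sA: "A i \<in> sets lebesgue" for i
  proof -
    have "closed ((\<lambda>x. (J (Suc i) x - J i x) \<bullet> (J (Suc i) x - J i x)) -` {1 / 4 ^ i..})"
      using J_cont by (intro continuous_closed_vimage) (auto intro!: continuous_intros simp: continuous_on_eq_continuous_at)
    then have "closed {x. 1 / 4 ^ i \<le> (J (Suc i) x - J i x) \<bullet> (J (Suc i) x - J i x)}"
      by (simp add: vimage_def)
    then have "U \<inter> {x. 1 / 4 ^ i \<le> (J (Suc i) x - J i x) \<bullet> (J (Suc i) x - J i x)} \<in> sets lebesgue"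
      using U(1) by (intro sets.Int) auto
    then show ?thesis by (simp add: A_def Int_def)
  qed
  have sD: "D i \<in> sets lebesgue" for i
  proof -
    have "continuous_on U (\<lambda>x. G x + J i x)"
      using continuous_on_subset[OF J_cont subset_UNIV] by (intro continuous_on_add G(1))
    then have "open (U \<inter> (\<lambda>x. G x + J i x) -` {\<xi>. splits K (1 / real (Suc i)) \<xi>})"
      using U(1) open_splits[OF K(1)] by (rule continuous_open_preimage)
    moreover have "U \<inter> (\<lambda>x. G x + J i x) -` {\<xi>. splits K (1 / real (Suc i)) \<xi>} = D i"
      by (auto simp: D_def)
    ultimately show ?thesis by auto
  qed
  have mA: "measure lebesgue (A i) \<le> 1 / 2 ^ i" for i
  proof -
    let ?w = "\<lambda>x. \<psi> (Suc i) x - \<psi> i x"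
    have w: "?w \<in> test_functions U" by (rule test_functions_diff[OF tf tf])
    have Jw: "jacobian ?w (at x) = J (Suc i) x - J i x" for x
      unfolding J_def by (rule jacobian_diff[OF tf tf])
    have eq: "A i = {x\<in>space lebesgue. 1 / 4 ^ i \<le> jacobian ?w (at x) \<bullet> jacobian ?w (at x)}"
    proof (intro set_eqI iffI)
      fix x assume "x \<in> {x\<in>space lebesgue. 1 / 4 ^ i \<le> jacobian ?w (at x) \<bullet> jacobian ?w (at x)}"
      moreover have "x \<in> U"
      proof (rule ccontr)
        assume "x \<notin> U"
        then have "jacobian ?w (at x) = 0" by (simp add: Jw J0)
        with calculation have "1 / 4 ^ i \<le> (0 :: real)" by (metis (mono_tags, lifting) inner_zero_left mem_Collect_eq)
        moreover have "0 < 1 / (4 :: real) ^ i" by simp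
        ultimately show False by linarith
      qed
      ultimately show "x \<in> A i" by (simp add: A_def Jw)
    qed (simp add: A_def Jw)
    have "measure lebesgue (A i) \<le> (LINT x|lebesgue. jacobian ?w (at x) \<bullet> jacobian ?w (at x)) / (1 / 4 ^ i)"
      unfolding eq
      by (rule integral_Markov_inequality_measure[where A="{}"])
        (use test_functions_inner_jacobian_integrable[OF w w] in auto)
    also have "\<dots> \<le> (1 / 16 ^ i) / (1 / 4 ^ i)"
      using N[OF rN, of i "r (Suc i)"] strict_mono_leD[OF r, of i "Suc i"]
      unfolding energy_def \<psi>_def by (intro divide_right_mono) auto
    also have "\<dots> = 1 / 4 ^ i"
      by (simp add: field_simps flip: power_mult_distrib)
    also have "\<dots> \<le> 1 / 2 ^ i"
      by (intro divide_left_mono power_mono) auto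
    finally show ?thesis .
  qed
  have mD: "measure lebesgue (D i) \<le> 1 / 2 ^ i" for i
    using M[OF rM, of i] unfolding m_def D_def J_def \<psi>_def by simp
  have AD: "A i \<union> D i \<subseteq> U" for i by (auto simp: A_def D_def)
  have "AE x in lebesgue. \<forall>\<^sub>F i in sequentially. x \<in> space lebesgue - (A i \<union> D i)"
  proof (rule borel_cantelli_AE1)
    show "A i \<union> D i \<in> sets lebesgue" for i using sA sD by auto
    then have "A i \<union> D i \<in> lmeasurable" for i
      using fmeasurableI2[OF lmU AD] by blast
    then show "emeasure lebesgue (A i \<union> D i) < \<infinity>" for i
      by (metis fmeasurableD2 infinity_ennreal_def less_top)
    show "summable (\<lambda>i. measure lebesgue (A i \<union> D i))"
    proof (rule summable_comparison_test[OF exI[of _ 0]], intro allI impI)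
      have "measure lebesgue (A i \<union> D i) \<le> 1 / 2 ^ i + 1 / 2 ^ i" for i
        using measure_Un_le[OF sA sD, of i i] mA[of i] mD[of i] by simp
      then show "norm (measure lebesgue (A i \<union> D i)) \<le> 2 * (1 / 2) ^ i" for i
        by (simp add: power_divide)
      show "summable (\<lambda>i. 2 * (1 / 2 :: real) ^ i)"
        by (intro summable_mult summable_geometric) simp
    qed
  qed
  then have good: "AE x in lebesgue. \<forall>\<^sub>F i in sequentially. x \<notin> A i \<and> x \<notin> D i" by simp
  \<comment> \<open>Defined at every point and measurable; where the Jacobians diverge, which
    happens only on a null set, the value is arbitrary.\<close>
  define V where "V = (\<lambda>x. lim (\<lambda>i. J i x))"
  have mV: "V \<in> borel_measurable lebesgue"
    unfolding V_def by (rule borel_measurable_lim_metric[OF mJ])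
  have lim: "(\<lambda>i. J i x) \<longlonglongrightarrow> V x" if ev: "\<forall>\<^sub>F i in sequentially. x \<notin> A i \<and> x \<notin> D i" for x
  proof (cases "x \<in> U")
    case True
    have "summable (\<lambda>i. J (Suc i) x - J i x)"
    proof (rule summable_comparison_test_ev)
      show "\<forall>\<^sub>F i in sequentially. norm (J (Suc i) x - J i x) \<le> (1 / 2) ^ i"
        using ev
      proof eventually_elim
        case (elim i)
        have "((1 / 2 :: real) ^ i)\<^sup>2 = 1 / 4 ^ i"
          by (simp add: power_divide power2_eq_square flip: power_mult_distrib)
        then have "(norm (J (Suc i) x - J i x))\<^sup>2 < ((1 / 2) ^ i)\<^sup>2"
          using elim True by (simp add: A_def power2_norm_eq_inner not_le)
        then show ?case using power2_less_imp_less[of "norm (J (Suc i) x - J i x)" "(1 / 2) ^ i"] by simp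
      qed
      show "summable (\<lambda>i. (1 / 2 :: real) ^ i)" by (intro summable_geometric) simp
    qed
    then have "convergent (\<lambda>n. \<Sum>i<n. J (Suc i) x - J i x)" by (simp add: summable_iff_convergent)
    then have "convergent (\<lambda>n. J n x - J 0 x)" by (simp only: sum_lessThan_telescope[of "\<lambda>i. J i x"])
    then have "convergent (\<lambda>n. (J n x - J 0 x) + J 0 x)" by (intro convergent_add convergent_const)
    then have "convergent (\<lambda>n. J n x)" by simp
    then show ?thesis unfolding V_def by (simp add: convergent_LIMSEQ_iff)
  next
    case False
    then show ?thesis by (simp add: V_def J0)
  qed
  have "convergent (\<lambda>k. v k x)" for x
  proof (rule Cauchy_convergent, rule CauchyI')
    fix e :: real assume "e > 0"
    then obtain n where n: "(1/2) ^ n < e / 2" using real_arch_pow_inv[of "e/2" "1/2"] by auto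
    show "\<exists>n. \<forall>k\<ge>n. \<forall>l>k. dist (v k x) (v l x) < e"
    proof (intro exI allI impI)
      fix k l assume "n \<le> k" "k < l"
      have "norm (v k x - v l x) \<le> 2 / 2 ^ k" using unif[of k l x] \<open>k < l\<close> by (simp add: norm_minus_commute)
      also have "\<dots> \<le> 2 / 2 ^ n" using \<open>n \<le> k\<close> by (intro divide_left_mono power_increasing) auto
      also have "\<dots> < e" using n by (simp add: power_divide)
      finally show "dist (v k x) (v l x) < e" by (simp add: dist_norm)
    qed
  qed
  then have vlim: "(\<lambda>k. v k x) \<longlonglongrightarrow> lim (\<lambda>k. v k x)" for x by (simp add: convergent_LIMSEQ_iff)
  have \<psi>lim: "(\<lambda>i. \<psi> i x) \<longlonglongrightarrow> lim (\<lambda>k. v k x)" for x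
    using LIMSEQ_subseq_LIMSEQ[OF vlim r, of x] by (simp add: o_def \<psi>_def)
  have AElim: "AE x in lebesgue. (\<lambda>i. jacobian (\<psi> i) (at x)) \<longlonglongrightarrow> V x"
    using good by eventually_elim (use lim in \<open>simp add: J_def\<close>)
  have B': "norm (\<psi> i x) \<le> B" "norm (jacobian (\<psi> i) (at x)) \<le> B" for i x
    by (simp_all add: \<psi>_def B)
  note fin = limit_of_test_functions[OF \<Omega> test_functions_mono[OF U(2) tf] B' \<psi>lim mV AElim]
  show thesis
  proof (rule that[of "\<lambda>x. lim (\<lambda>k. v k x)" V "\<lambda>i x. G x + J i x"])
    show "(\<lambda>x. lim (\<lambda>k. v k x)) \<in> W1_inf_0 \<Omega>" "has_weak_gradient \<Omega> (\<lambda>x. lim (\<lambda>k. v k x)) V"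
      by (rule fin)+
    show "AE x in lebesgue. x \<notin> U \<longrightarrow> V x = 0"
      using good
    proof eventually_elim
      case (elim x)
      then show ?case using lim[OF elim] by (auto simp: J0 LIMSEQ_const_iff)
    qed
    show "G x + J k x \<in> K" if "x \<in> U" for k x
      using v(2)[OF that] by (simp add: J_def \<psi>_def)
    show "AE x in lebesgue. x \<in> U \<longrightarrow> (\<lambda>k. G x + J k x) \<longlonglongrightarrow> G x + V x \<and>
        (\<forall>c>0. \<forall>\<^sub>F k in sequentially. \<not> splits K c (G x + J k x))"
      using good
    proof eventually_elim
      case (elim x)
      have "\<forall>\<^sub>F k in sequentially. \<not> splits K c (G x + J k x)" if "x \<in> U" "c > 0" for c
      proof -
        obtain m where m: "1 / real (Suc m) < c" using nat_approx_posE[OF \<open>c > 0\<close>] by blast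
        show ?thesis
          using elim eventually_ge_at_top[of m]
        proof eventually_elim
          case (elim k)
          have "1 / real (Suc k) \<le> 1 / real (Suc m)" using elim by (intro divide_left_mono) auto
          then have "1 / real (Suc k) \<le> c" using m by simp
          then show ?case using elim \<open>x \<in> U\<close> splits_antimono by (auto simp: D_def)
        qed
      qed
      then show ?case using lim[OF elim] by (auto intro: tendsto_add)
    qed
  qed
qed

subsection \<open>Singular values\<close>

text \<open>Cauchy-Schwarz in each row; the norm of a matrix is here the Frobenius norm.\<close>

lemma norm_matrix_vector_le:
  fixes A :: "real^'n^'m"
  shows "norm (A *v x) \<le> norm A * norm x"
proof -
  have "norm (A *v x) \<le> L2_set (\<lambda>i. norm (A $ i) * norm x) UNIV"
    unfolding norm_vec_def[of "A *v x"]
    by (intro L2_set_mono) (auto simp: matrix_vector_mul_component Cauchy_Schwarz_ineq2)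
  also have "\<dots> = norm A * norm x"
    by (simp add: L2_set_left_distrib[symmetric] norm_vec_def[of A] flip: L2_set_left_distrib)
  finally show ?thesis .
qed

text \<open>For small t of the sign of b the linear term wins. The single value t = b / C, with a
  positive C above c, already shows this.\<close>

lemma linear_le_quadratic_imp_0:
  fixes b c :: real
  assumes "\<And>t. 2 * t * b \<le> t\<^sup>2 * c"
  shows "b = 0"
proof (rule ccontr)
  assume "b \<noteq> 0"
  define C where "C = \<bar>c\<bar> + 1"
  have C: "C > 0" "c \<le> C" by (auto simp: C_def)
  have "2 * (b / C) * b \<le> (b / C)\<^sup>2 * c" by (rule assms)
  also have "\<dots> \<le> (b / C)\<^sup>2 * C" using C by (intro mult_left_mono) auto
  also have "\<dots> = (b / C) * b" using C by (simp add: power2_eq_square)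
  finally have "(b / C) * b \<le> 0" by simp
  moreover have "(b / C) * b > 0" using C \<open>b \<noteq> 0\<close> by (simp add: zero_less_mult_iff zero_less_divide_iff) linarith
  ultimately show False by simp
qed

text \<open>First-order condition at a maximiser: comparing v with v + t x, the term linear in t has
  to vanish. The subspace allows a second use on the orthogonal complement of the first
  maximiser.\<close>

lemma maximal_stretch_orthogonal:
  fixes A :: "real^'n^'m"
  assumes v: "norm v = 1" and max: "\<And>y. y \<in> S \<Longrightarrow> norm y = 1 \<Longrightarrow> norm (A *v y) \<le> norm (A *v v)"
    and S: "subspace S" "v \<in> S" "x \<in> S" and x: "x \<bullet> v = 0"
  shows "(A *v x) \<bullet> (A *v v) = 0"
proof (rule linear_le_quadratic_imp_0)
  fix t :: real
  let ?l = "norm (A *v v)"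
  define y where "y = v + t *\<^sub>R x"
  have y: "y \<in> S" using S unfolding y_def by (intro subspace_add subspace_scale)
  have le: "norm (A *v y) \<le> ?l * norm y"
  proof (cases "y = 0")
    case False
    have "norm (A *v ((1 / norm y) *\<^sub>R y)) \<le> ?l"
      using False by (intro max subspace_scale S(1) y) auto
    then show ?thesis using False by (simp add: matrix_vector_mult_scaleR field_simps)
  qed simp
  have "(norm (A *v y))\<^sup>2 \<le> (?l * norm y)\<^sup>2" using le by (intro power_mono) auto
  then have "(A *v y) \<bullet> (A *v y) \<le> ?l\<^sup>2 * (y \<bullet> y)"
    by (simp add: power_mult_distrib power2_norm_eq_inner)
  moreover have "(A *v y) \<bullet> (A *v y) = ?l\<^sup>2 + 2 * t * ((A *v x) \<bullet> (A *v v)) + t\<^sup>2 * ((A *v x) \<bullet> (A *v x))"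
    by (simp add: y_def matrix_vector_right_distrib matrix_vector_mult_scaleR inner_add_left inner_add_right
        power2_norm_eq_inner inner_commute[of "A *v v" "A *v x"] power2_eq_square[of t] algebra_simps)
  moreover have "y \<bullet> y = 1 + t\<^sup>2 * (x \<bullet> x)"
    using v x by (simp add: y_def inner_add_left inner_add_right inner_commute[of v x] power2_eq_square[of t] norm_eq_1)
  ultimately have "?l\<^sup>2 + 2 * t * ((A *v x) \<bullet> (A *v v)) + t\<^sup>2 * ((A *v x) \<bullet> (A *v x)) \<le> ?l\<^sup>2 * (1 + t\<^sup>2 * (x \<bullet> x))"
    by simp
  moreover have "?l\<^sup>2 * (1 + t\<^sup>2 * (x \<bullet> x)) = ?l\<^sup>2 + t\<^sup>2 * (?l\<^sup>2 * (x \<bullet> x))"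
    by (simp add: distrib_left mult_ac)
  moreover have "0 \<le> t\<^sup>2 * ((A *v x) \<bullet> (A *v x))" by simp
  ultimately show "2 * t * ((A *v x) \<bullet> (A *v v)) \<le> t\<^sup>2 * (?l\<^sup>2 * (x \<bullet> x))"
    by linarith
qed

lemma unit_vector_orthogonal:
  fixes v :: "real^3"
  obtains u where "norm u = 1" "u \<bullet> v = 0"
proof -
  have "dim (span {v}) < DIM(real^3)"
    using dim_le_card[of "{v}" "{v}"] by (simp add: dim_span span_base)
  then obtain y where "y \<noteq> 0" "\<And>x. x \<in> span {v} \<Longrightarrow> orthogonal y x"
    using orthogonal_to_subspace_exists[of "{v}"] by (metis dim_span)
  then have "y \<bullet> v = 0" by (simp add: orthogonal_def span_base)
  then show ?thesis using \<open>y \<noteq> 0\<close> that[of "(1 / norm y) *\<^sub>R y"] by simp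
qed

definition columns3 :: "real^3 \<Rightarrow> real^3 \<Rightarrow> real^3 \<Rightarrow> real^3^3" where
  "columns3 u1 u2 u3 = (\<chi> i j. (if j = 1 then u1 else if j = 2 then u2 else u3) $ i)"

definition diagonal3 :: "real \<Rightarrow> real \<Rightarrow> real \<Rightarrow> real^3^3" where
  "diagonal3 l1 l2 l3 = (\<chi> i j. if i = j then (if j = 1 then l1 else if j = 2 then l2 else l3) else 0)"

lemma orthogonal_columns3:
  assumes "norm u1 = 1" "norm u2 = 1" "norm u3 = 1" "u1 \<bullet> u2 = 0" "u1 \<bullet> u3 = 0" "u2 \<bullet> u3 = 0"
  shows "orthogonal_matrix (columns3 u1 u2 u3)"
proof -
  have "column j (columns3 u1 u2 u3) = (if j = 1 then u1 else if j = 2 then u2 else u3)" for j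
    by (simp add: column_def columns3_def vec_eq_iff)
  then show ?thesis
    using assms unfolding orthogonal_matrix_orthonormal_columns forall_3
    by (simp add: orthogonal_def inner_commute)
qed

text \<open>The right singular vectors arise by maximising the stretch over the unit sphere and
  again over the unit circle orthogonal to the maximiser; their cross product is the third.
  Maximality makes the images orthogonal, and the positive determinant makes them nonzero, so they
  can be normalised.\<close>

lemma singular_value_decomposition:
  fixes \<xi> :: "real^3^3"
  assumes "det \<xi> > 0"
  obtains U V l1 l2 l3 where "orthogonal_matrix U" "orthogonal_matrix V"
    "\<xi> = U ** diagonal3 l1 l2 l3 ** transpose V" "0 < l1" "l1 \<le> l2" "l2 \<le> l3"
proof -
  have cont: "continuous_on S (\<lambda>x. norm (\<xi> *v x))" for S
    by (intro continuous_intros matrix_vector_mult_linear_continuous_on)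
  have "\<exists>x\<in>sphere 0 1. \<forall>y\<in>sphere 0 1. norm (\<xi> *v y) \<le> norm (\<xi> *v x)"
    by (intro continuous_attains_sup cont) auto
  then obtain v3 where v3: "norm v3 = 1" "\<And>y. norm y = 1 \<Longrightarrow> norm (\<xi> *v y) \<le> norm (\<xi> *v v3)" by auto
  let ?P = "{x. v3 \<bullet> x = 0}"
  obtain u where u: "norm u = 1" "u \<bullet> v3 = 0" using unit_vector_orthogonal .
  have "closed ?P" by (rule closed_hyperplane)
  then have "compact (sphere 0 1 \<inter> ?P)" by (intro compact_Int_closed) auto
  moreover have "u \<in> sphere 0 1 \<inter> ?P" using u by (simp add: inner_commute)
  ultimately have "\<exists>x\<in>sphere 0 1 \<inter> ?P. \<forall>y\<in>sphere 0 1 \<inter> ?P. norm (\<xi> *v y) \<le> norm (\<xi> *v x)"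
    by (intro continuous_attains_sup cont) auto
  then obtain v2 where v2: "norm v2 = 1" "v3 \<bullet> v2 = 0"
      "\<And>y. norm y = 1 \<Longrightarrow> v3 \<bullet> y = 0 \<Longrightarrow> norm (\<xi> *v y) \<le> norm (\<xi> *v v2)" by auto
  define v1 where "v1 = cross3 v2 v3"
  have v1: "norm v1 = 1" "v1 \<bullet> v2 = 0" "v1 \<bullet> v3 = 0"
    using norm_cross_dot[of v2 v3] v2(1,2) v3(1) power2_eq_1_iff[of "norm (cross3 v2 v3)"] norm_ge_zero[of "cross3 v2 v3"]
    by (auto simp: v1_def dot_cross_self inner_commute simp del: norm_ge_zero)
  have sub: "subspace ?P" by (rule subspace_hyperplane)
  have o1: "(\<xi> *v v1) \<bullet> (\<xi> *v v3) = 0"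
    by (rule maximal_stretch_orthogonal[OF v3(1), where S=UNIV]) (use v3 v1 in auto)
  have o2: "(\<xi> *v v2) \<bullet> (\<xi> *v v3) = 0"
    by (rule maximal_stretch_orthogonal[OF v3(1), where S=UNIV]) (use v3 v2 in \<open>auto simp: inner_commute\<close>)
  have o3: "(\<xi> *v v1) \<bullet> (\<xi> *v v2) = 0"
    by (rule maximal_stretch_orthogonal[OF v2(1) _ sub]) (use v2 v1 in \<open>auto simp: inner_commute\<close>)
  define l1 where "l1 = norm (\<xi> *v v1)"
  define l2 where "l2 = norm (\<xi> *v v2)"
  define l3 where "l3 = norm (\<xi> *v v3)"
  have "\<xi> *v x \<noteq> 0" if "norm x = 1" for x
  proof
    assume "\<xi> *v x = 0"
    then have "x = 0" using assms by (metis det_nz_iff_inj less_irrefl inj_matrix_vector_mult injD matrix_vector_mult_0_right invertible_det_nz)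
    then show False using that by simp
  qed
  then have l: "0 < l1" "0 < l2" "0 < l3" using v1(1) v2(1) v3(1) by (auto simp: l1_def l2_def l3_def)
  have ll: "l1 \<le> l2" "l2 \<le> l3"
    using v2(3)[OF v1(1)] v1(3) v3(2)[OF v2(1)] by (auto simp: l1_def l2_def l3_def inner_commute)
  define V where "V = columns3 v1 v2 v3"
  define U where "U = columns3 ((1 / l1) *\<^sub>R (\<xi> *v v1)) ((1 / l2) *\<^sub>R (\<xi> *v v2)) ((1 / l3) *\<^sub>R (\<xi> *v v3))"
  have oV: "orthogonal_matrix V"
    unfolding V_def using v1 v2 v3 by (intro orthogonal_columns3) (auto simp: inner_commute)
  have oU: "orthogonal_matrix U"
    unfolding U_def using l o1 o2 o3 by (intro orthogonal_columns3) (auto simp: l1_def l2_def l3_def)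
  have "\<xi> ** V = U ** diagonal3 l1 l2 l3"
    using l by (simp add: U_def V_def columns3_def diagonal3_def matrix_matrix_mult_def vec_eq_iff
        forall_3 sum_3 matrix_vector_mult_def)
  then have "\<xi> ** (V ** transpose V) = U ** diagonal3 l1 l2 l3 ** transpose V"
    by (simp add: matrix_mul_assoc)
  then have "\<xi> = U ** diagonal3 l1 l2 l3 ** transpose V"
    using oV by (simp add: orthogonal_matrix_def)
  then show thesis using that oU oV l(1) ll by blast
qed

text \<open>The extreme roots agree because each is a root of the other product. The middle one
  follows from the coefficient of t^2, which is read off from the values at -1, 0 and 1.\<close>

lemma ordered_roots_unique:
  fixes a b c x y z :: real
  assumes eq: "\<And>t. (t - a) * (t - b) * (t - c) = (t - x) * (t - y) * (t - z)"
    and "a \<le> b" "b \<le> c" "x \<le> y" "y \<le> z"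
  shows "a = x \<and> b = y \<and> c = z"
proof -
  have "a = x \<or> a = y \<or> a = z" "x = a \<or> x = b \<or> x = c" "c = x \<or> c = y \<or> c = z" "z = a \<or> z = b \<or> z = c"
    using eq[of a] eq[of x] eq[of c] eq[of z] by auto
  then have "a = x" "c = z" using assms(2-5) by auto
  moreover have "a + b + c = x + y + z"
    using eq[of 0] eq[of 1] eq[of "-1"] by (simp add: algebra_simps)
  ultimately show ?thesis by simp
qed

lemma diagonal3_simps:
  "transpose (diagonal3 a b c) = diagonal3 a b c"
  "diagonal3 a b c ** diagonal3 x y z = diagonal3 (a * x) (b * y) (c * z)"
  "det (diagonal3 a b c) = a * b * c"
  "mat t - diagonal3 a b c = diagonal3 (t - a) (t - b) (t - c)"
  "v \<bullet> (diagonal3 a b c *v v) = a * (v $ 1)\<^sup>2 + b * (v $ 2)\<^sup>2 + c * (v $ 3)\<^sup>2"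
  by (simp_all add: diagonal3_def transpose_def matrix_matrix_mult_def matrix_vector_mult_def vec_eq_iff
      forall_3 sum_3 det_3 mat_def inner_vec_def power2_eq_square)

text \<open>Singular values are defined by two definite descriptions, so uniqueness is needed twice:
  for the positive semidefinite square root and for the ordered eigenvalues.\<close>

lemma singular_values3_decomposition:
  fixes U V :: "real^3^3"
  assumes U: "orthogonal_matrix U" and V: "orthogonal_matrix V" and l: "0 < l1" "l1 \<le> l2" "l2 \<le> l3"
  shows "singular_values3 (U ** diagonal3 l1 l2 l3 ** transpose V) = (l1, l2, l3)"
proof -
  let ?D = "diagonal3 l1 l2 l3"
  let ?\<xi> = "U ** ?D ** transpose V" and ?S = "U ** ?D ** transpose U"
  have UU: "transpose U ** U = mat 1" "U ** transpose U = mat 1" and VV: "transpose V ** V = mat 1"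
    using U V by (auto simp: orthogonal_matrix_def)
  have A: "?\<xi> ** transpose ?\<xi> = U ** (?D ** ?D) ** transpose U"
  proof -
    have "?\<xi> ** transpose ?\<xi> = U ** ?D ** (transpose V ** V) ** ?D ** transpose U"
      by (simp add: matrix_transpose_mul diagonal3_simps(1) matrix_mul_assoc)
    then show ?thesis by (simp add: VV matrix_mul_assoc)
  qed
  have SS: "?S ** ?S = ?\<xi> ** transpose ?\<xi>"
  proof -
    have "?S ** ?S = U ** ?D ** (transpose U ** U) ** ?D ** transpose U"
      by (simp add: matrix_mul_assoc)
    then show ?thesis by (simp add: A UU matrix_mul_assoc)
  qed
  have psdS: "psd ?S"
    unfolding psd_def
  proof (intro conjI allI)
    show "transpose ?S = ?S" by (simp add: matrix_transpose_mul diagonal3_simps(1) matrix_mul_assoc)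
    fix x :: "real^3"
    have "x \<bullet> (?S *v x) = (transpose U *v x) \<bullet> (?D *v (transpose U *v x))"
      by (simp add: matrix_vector_mul_assoc[symmetric] dot_lmul_matrix[symmetric] vector_transpose_matrix
          flip: transpose_matrix_vector)
    also have "\<dots> \<ge> 0" unfolding diagonal3_simps using l by simp
    finally show "0 \<le> x \<bullet> (?S *v x)" .
  qed
  have uniq: "T = ?S" if T: "psd T" "T ** T = ?\<xi> ** transpose ?\<xi>" for T
  proof -
    have TT: "T ** T ** U = U ** (?D ** ?D)"
      unfolding T(2) A by (simp add: UU flip: matrix_mul_assoc)
    have col: "T *v (U *v axis i 1) = U *v (?D *v axis i 1)" for i
    proof -
      define l where "l = (if i = 1 then l1 else if i = 2 then l2 else l3)"
      have lpos: "l > 0" using assms(3-5) by (simp add: l_def)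
      have Di: "?D *v axis i 1 = l *\<^sub>R axis i 1"
        using exhaust_3[of i] by (auto simp: diagonal3_def l_def matrix_vector_mult_def vec_eq_iff forall_3 sum_3 axis_def)
      define u where "u = U *v axis i 1"
      \<comment> \<open>As T^2 u = l^2 u, the defect satisfies T w = - l w. Since \<open>T\<close>
        is positive semidefinite and l > 0, it vanishes.\<close>
      define w where "w = T *v u - l *\<^sub>R u"
      have "T *v (T *v u) = (T ** T ** U) *v axis i 1" unfolding u_def matrix_vector_mul_assoc matrix_mul_assoc ..
      also have "\<dots> = U *v (?D *v (?D *v axis i 1))" unfolding TT by (simp only: matrix_vector_mul_assoc matrix_mul_assoc)
      also have "\<dots> = (l * l) *\<^sub>R u" by (simp add: Di matrix_vector_mult_scaleR u_def)
      finally have "T *v w = - l *\<^sub>R w"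
        by (simp add: w_def matrix_vector_mult_diff_distrib matrix_vector_mult_scaleR algebra_simps)
      moreover have "0 \<le> w \<bullet> (T *v w)" using T(1) by (simp add: psd_def)
      ultimately have "l * (w \<bullet> w) \<le> 0" by simp
      then have "w \<bullet> w \<le> 0" using lpos by (simp add: mult_le_0_iff)
      then have "w = 0" using inner_ge_zero[of w] by (metis inner_eq_zero_iff order_antisym)
      then show ?thesis by (simp add: w_def u_def Di matrix_vector_mult_scaleR)
    qed
    have "T ** U = U ** ?D"
    proof -
      have "column i (T ** U) = column i (U ** ?D)" for i
      proof -
        have c: "column i (A ** B) = A *v (B *v axis i 1)" for A B :: "real^3^3"
          unfolding matrix_vector_mul_assoc unfolding matrix_vector_mult_basis ..
        show ?thesis unfolding c by (rule col)
      qed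
      then show ?thesis by (simp add: column_def vec_eq_iff)
    qed
    then have "T ** U ** transpose U = ?S" by simp
    then show ?thesis by (simp add: UU flip: matrix_mul_assoc)
  qed
  have sqrt: "psd_sqrt (?\<xi> ** transpose ?\<xi>) = ?S"
    unfolding psd_sqrt_def
  proof (rule the_equality)
    show "psd ?S \<and> ?S ** ?S = ?\<xi> ** transpose ?\<xi>" using psdS SS by (rule conjI)
    show "T = ?S" if "psd T \<and> T ** T = ?\<xi> ** transpose ?\<xi>" for T
      using that by (intro uniq) (rule conjunct1, assumption, rule conjunct2)
  qed
  have char: "det (mat t - ?S) = (t - l1) * (t - l2) * (t - l3)" for t
  proof -
    have "mat t - ?S = U ** (mat t - ?D) ** transpose U"
    proof -
      have "U ** mat t ** transpose U = mat t"
      proof -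
        have "U ** mat t = t *\<^sub>R U"
          by (simp add: matrix_matrix_mult_def mat_def vec_eq_iff if_distrib cong: if_cong)
        moreover have "(t *\<^sub>R U) ** transpose U = t *\<^sub>R (U ** transpose U)"
          by (simp add: matrix_matrix_mult_def vec_eq_iff sum_distrib_left mult.assoc)
        moreover have "t *\<^sub>R mat 1 = (mat t :: real^3^3)" by (simp add: mat_def vec_eq_iff)
        ultimately show ?thesis using UU(2) by simp
      qed
      moreover have "A ** (B - C) = A ** B - A ** C" "(B - C) ** A = B ** A - C ** A" for A B C :: "real^3^3"
        by (simp_all add: matrix_matrix_mult_def vec_eq_iff right_diff_distrib left_diff_distrib sum_subtractf)
      ultimately show ?thesis by simp
    qed
    moreover have "det U * det U = 1"
      using arg_cong[OF UU(2), of det] by (simp add: det_mul)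
    ultimately show ?thesis
      by (simp add: det_mul diagonal3_simps(3,4))
  qed
  have "eigenvalues3 ?S = (l1, l2, l3)"
    unfolding eigenvalues3_def
  proof (rule the_equality)
    show "case (l1, l2, l3) of (l1, l2, l3) \<Rightarrow> l1 \<le> l2 \<and> l2 \<le> l3 \<and>
        (\<forall>t. det (mat t - ?S) = (t - l1) * (t - l2) * (t - l3))"
      using l char by simp
    fix p :: "real \<times> real \<times> real"
    obtain x y z where p: "p = (x, y, z)" by (cases p)
    assume "case p of (l1, l2, l3) \<Rightarrow> l1 \<le> l2 \<and> l2 \<le> l3 \<and>
        (\<forall>t. det (mat t - ?S) = (t - l1) * (t - l2) * (t - l3))"
    then have "x \<le> y" "y \<le> z" "\<And>t. (t - x) * (t - y) * (t - z) = (t - l1) * (t - l2) * (t - l3)"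
      using char by (auto simp: p)
    then show "p = (l1, l2, l3)" using ordered_roots_unique l(2,3) p by blast
  qed
  then show ?thesis by (simp add: singular_values3_def sqrt)
qed

subsection \<open>Matrices with determinant and stretches controlled by a segment\<close>

lemma norm_orthogonal_mult:
  fixes U :: "real^'n^'n"
  assumes "orthogonal_matrix U"
  shows "norm (U *v x) = norm x"
  using assms orthogonal_transformation_norm[of "(*v) U" x]
  by (simp add: orthogonal_transformation_matrix matrix_of_matrix_vector_mul)

lemma norm_orthogonal_conjugate:
  fixes U V M :: "real^'n^'n"
  assumes "orthogonal_matrix U"
  shows "norm ((U ** M ** transpose V) *v x) = norm (M *v (transpose V *v x))"
  using norm_orthogonal_mult[OF assms] by (simp only: matrix_vector_mul_assoc[symmetric])

lemma norm_square_3: "(norm (y :: real^3))\<^sup>2 = (y $ 1)\<^sup>2 + (y $ 2)\<^sup>2 + (y $ 3)\<^sup>2"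
  unfolding power2_norm_eq_inner inner_vec_def sum_3 by (simp add: power2_eq_square)

lemma det_orthogonal_conjugate_pos:
  fixes U V M :: "real^3^3"
  assumes "orthogonal_matrix U" "orthogonal_matrix V" "0 < det (U ** M ** transpose V)" "0 < det M"
  shows "det U * det V = 1"
proof -
  have "det U = 1 \<or> det U = - 1" "det V = 1 \<or> det V = - 1"
    using assms(1,2) det_orthogonal_matrix by blast+
  then show ?thesis using assms(3,4) by (auto simp: det_mul)
qed

lemma norm_diagonal3: "(norm (diagonal3 l1 l2 l3 *v y))\<^sup>2 = (l1 * y $ 1)\<^sup>2 + (l2 * y $ 2)\<^sup>2 + (l3 * y $ 3)\<^sup>2"
  by (simp add: norm_square_3 diagonal3_def matrix_vector_mult_def sum_3)

text \<open>Unit vectors attaining the extreme stretches are included because they carry strict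
  bounds on all stretches over to \<open>l1\<close> and \<open>l3\<close>. The relation between the
  determinants allows the middle factor to be modified in the same frames with control of the
  determinant.\<close>

lemma singular_values3_stretch:
  fixes \<xi> :: "real^3^3"
  assumes "det \<xi> > 0"
  obtains U V l1 l2 l3 where "orthogonal_matrix U" "orthogonal_matrix V"
    "\<xi> = U ** diagonal3 l1 l2 l3 ** transpose V" "det U * det V = 1"
    "singular_values3 \<xi> = (l1, l2, l3)" "0 < l1" "l1 \<le> l2" "l2 \<le> l3" "det \<xi> = l1 * l2 * l3"
    "\<And>x. norm x = 1 \<Longrightarrow> l1 \<le> norm (\<xi> *v x)" "\<And>x. norm x = 1 \<Longrightarrow> norm (\<xi> *v x) \<le> l3"
    "norm (\<xi> *v (V *v axis 1 1)) = l1" "norm (\<xi> *v (V *v axis 3 1)) = l3"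
    "norm (V *v axis 1 1) = 1" "norm (V *v axis 3 1) = 1"
proof -
  obtain U V l1 l2 l3 where UV: "orthogonal_matrix U" "orthogonal_matrix V"
    and \<xi>: "\<xi> = U ** diagonal3 l1 l2 l3 ** transpose V" and l: "0 < l1" "l1 \<le> l2" "l2 \<le> l3"
    by (rule singular_value_decomposition[OF assms]) (rule that)
  have oV: "orthogonal_matrix (transpose V)" using UV(2) by (simp add: orthogonal_matrix_transpose)
  have norm: "norm (\<xi> *v x) = norm (diagonal3 l1 l2 l3 *v (transpose V *v x))" for x
    unfolding \<xi> by (rule norm_orthogonal_conjugate[OF UV(1)])
  have dUV: "det U * det V = 1"
    using det_orthogonal_conjugate_pos[OF UV, of "diagonal3 l1 l2 l3"] assms l
    by (simp add: \<xi>[symmetric] diagonal3_simps(3))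
  have VV: "transpose V *v (V *v y) = y" for y
    using UV(2) by (simp add: matrix_vector_mul_assoc orthogonal_matrix_def)
  show thesis
  proof (rule that[OF UV \<xi> dUV])
    show "singular_values3 \<xi> = (l1, l2, l3)"
      unfolding \<xi> by (rule singular_values3_decomposition[OF UV l])
    show "det \<xi> = l1 * l2 * l3"
    proof -
      have "det \<xi> = (det U * det V) * (l1 * l2 * l3)"
        by (simp add: \<xi> det_mul diagonal3_simps(3) mult_ac)
      then show ?thesis by (simp add: dUV)
    qed
    show "l1 \<le> norm (\<xi> *v x)" "norm (\<xi> *v x) \<le> l3" if x: "norm x = 1" for x
    proof -
      define y where "y = transpose V *v x"
      have y: "(y $ 1)\<^sup>2 + (y $ 2)\<^sup>2 + (y $ 3)\<^sup>2 = 1"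
        using norm_orthogonal_mult[OF oV, of x] x by (simp add: y_def norm_square_3[symmetric])
      have "l1\<^sup>2 * ((y $ 1)\<^sup>2 + (y $ 2)\<^sup>2 + (y $ 3)\<^sup>2) \<le> (norm (\<xi> *v x))\<^sup>2"
        unfolding norm y_def[symmetric] norm_diagonal3 power_mult_distrib distrib_left
        using l by (intro add_mono mult_right_mono power_mono) auto
      then show "l1 \<le> norm (\<xi> *v x)"
        unfolding y using l by (auto intro: power2_le_imp_le)
      have "(norm (\<xi> *v x))\<^sup>2 \<le> l3\<^sup>2 * ((y $ 1)\<^sup>2 + (y $ 2)\<^sup>2 + (y $ 3)\<^sup>2)"
        unfolding norm y_def[symmetric] norm_diagonal3 power_mult_distrib distrib_left
        using l by (intro add_mono mult_right_mono power_mono) auto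
      then show "norm (\<xi> *v x) \<le> l3"
        unfolding y using l by (auto intro: power2_le_imp_le)
    qed
    have ax: "norm (diagonal3 l1 l2 l3 *v axis 1 1) = l1" "norm (diagonal3 l1 l2 l3 *v axis 3 1) = l3"
    proof -
      have "(norm (diagonal3 l1 l2 l3 *v axis 1 1))\<^sup>2 = l1\<^sup>2" "(norm (diagonal3 l1 l2 l3 *v axis 3 1))\<^sup>2 = l3\<^sup>2"
        unfolding norm_diagonal3 by (simp_all add: axis_def)
      then show "norm (diagonal3 l1 l2 l3 *v axis 1 1) = l1" "norm (diagonal3 l1 l2 l3 *v axis 3 1) = l3"
        using l by (simp_all add: power2_eq_iff_nonneg)
    qed
    show "norm (\<xi> *v (V *v axis 1 1)) = l1" "norm (\<xi> *v (V *v axis 3 1)) = l3"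
      unfolding norm VV by (rule ax)+
    show "norm (V *v axis 1 1) = 1" "norm (V *v axis 3 1) = 1"
      using norm_orthogonal_mult[OF UV(2)] by simp_all
  qed (rule l)+
qed

text \<open>The triangle inequality in squared form: the diagonal part stretches the vector (p, q)
  by at least l, and the shear moves the image by at most s times the length of the vector.\<close>

lemma shear_lower:
  fixes l m s \<sigma> p q :: real
  assumes "0 \<le> s" "s \<le> l" "l \<le> m" "\<bar>\<sigma>\<bar> \<le> s"
  shows "(l - s)\<^sup>2 * (p\<^sup>2 + q\<^sup>2) \<le> (l * p + \<sigma> * q)\<^sup>2 + (m * q)\<^sup>2"
proof -
  have pq: "2 * \<bar>p * q\<bar> \<le> p\<^sup>2 + q\<^sup>2"
    using sum_squares_bound[of "\<bar>p\<bar>" "\<bar>q\<bar>"] by (simp add: abs_mult)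
  have "\<bar>2 * l * (\<sigma> * (p * q))\<bar> = l * (\<bar>\<sigma>\<bar> * (2 * \<bar>p * q\<bar>))"
    using assms by (simp add: abs_mult)
  also have "\<dots> \<le> l * (s * (p\<^sup>2 + q\<^sup>2))"
    using assms pq by (intro mult_left_mono mult_mono) auto
  finally have "- (l * (s * (p\<^sup>2 + q\<^sup>2))) \<le> 2 * l * (\<sigma> * (p * q))" by linarith
  moreover have "(m * q)\<^sup>2 \<ge> l\<^sup>2 * q\<^sup>2"
    unfolding power_mult_distrib using assms by (intro mult_right_mono power_mono) auto
  moreover have "(l * p + \<sigma> * q)\<^sup>2 = l\<^sup>2 * p\<^sup>2 + 2 * l * (\<sigma> * (p * q)) + (\<sigma> * q)\<^sup>2"
    by (simp add: power2_eq_square algebra_simps)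
  ultimately have "l\<^sup>2 * p\<^sup>2 + l\<^sup>2 * q\<^sup>2 - l * (s * (p\<^sup>2 + q\<^sup>2)) \<le> (l * p + \<sigma> * q)\<^sup>2 + (m * q)\<^sup>2"
    using zero_le_power2[of "\<sigma> * q"] by linarith
  moreover have "l\<^sup>2 * p\<^sup>2 + l\<^sup>2 * q\<^sup>2 - l * (s * (p\<^sup>2 + q\<^sup>2)) - (l - s)\<^sup>2 * (p\<^sup>2 + q\<^sup>2) = s * (l - s) * (p\<^sup>2 + q\<^sup>2)"
    by (simp add: power2_eq_square algebra_simps)
  moreover have "0 \<le> s * (l - s) * (p\<^sup>2 + q\<^sup>2)" using assms by simp
  ultimately show ?thesis by linarith
qed

text \<open>The same triangle inequality from above, with the larger diagonal entry m.\<close>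

lemma shear_upper:
  fixes l m s \<sigma> p q :: real
  assumes "0 \<le> s" "0 \<le> l" "l \<le> m" "\<bar>\<sigma>\<bar> \<le> s"
  shows "(l * p + \<sigma> * q)\<^sup>2 + (m * q)\<^sup>2 \<le> (m + s)\<^sup>2 * (p\<^sup>2 + q\<^sup>2)"
proof -
  have pq: "2 * \<bar>p * q\<bar> \<le> p\<^sup>2 + q\<^sup>2"
    using sum_squares_bound[of "\<bar>p\<bar>" "\<bar>q\<bar>"] by (simp add: abs_mult)
  have "\<bar>2 * l * (\<sigma> * (p * q))\<bar> = l * (\<bar>\<sigma>\<bar> * (2 * \<bar>p * q\<bar>))"
    using assms by (simp add: abs_mult)
  also have "\<dots> \<le> m * (s * (p\<^sup>2 + q\<^sup>2))"
    using assms pq by (intro mult_mono) auto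
  finally have "2 * l * (\<sigma> * (p * q)) \<le> m * (s * (p\<^sup>2 + q\<^sup>2))" by linarith
  moreover have "l\<^sup>2 * p\<^sup>2 \<le> m\<^sup>2 * p\<^sup>2" using assms by (intro mult_right_mono power_mono) auto
  moreover have "(\<sigma> * q)\<^sup>2 \<le> s\<^sup>2 * (p\<^sup>2 + q\<^sup>2)"
  proof -
    have "\<bar>\<sigma>\<bar>\<^sup>2 * q\<^sup>2 \<le> s\<^sup>2 * (p\<^sup>2 + q\<^sup>2)" using assms by (intro mult_mono power_mono) auto
    then show ?thesis by (simp add: power_mult_distrib)
  qed
  moreover have "(l * p + \<sigma> * q)\<^sup>2 = l\<^sup>2 * p\<^sup>2 + 2 * l * (\<sigma> * (p * q)) + (\<sigma> * q)\<^sup>2"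
    by (simp add: power2_eq_square algebra_simps)
  ultimately have "(l * p + \<sigma> * q)\<^sup>2 + (m * q)\<^sup>2 \<le>
      m\<^sup>2 * p\<^sup>2 + m * (s * (p\<^sup>2 + q\<^sup>2)) + s\<^sup>2 * (p\<^sup>2 + q\<^sup>2) + (m * q)\<^sup>2" by linarith
  moreover have "(m + s)\<^sup>2 * (p\<^sup>2 + q\<^sup>2) - (m\<^sup>2 * p\<^sup>2 + m * (s * (p\<^sup>2 + q\<^sup>2)) + s\<^sup>2 * (p\<^sup>2 + q\<^sup>2) + (m * q)\<^sup>2)
      = m * s * (p\<^sup>2 + q\<^sup>2)"
    by (simp add: power2_eq_square algebra_simps)
  moreover have "0 \<le> m * s * (p\<^sup>2 + q\<^sup>2)" using assms by simp
  ultimately show ?thesis by linarith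
qed

lemma rank_one_conjugate:
  fixes U V :: "real^'n^'n"
  shows "rank_one (U *v a) (V *v b) = U ** rank_one a b ** transpose V"
  by (simp add: matrix_eq rank_one_mult_vec matrix_vector_mul_assoc[symmetric] matrix_vector_mult_scaleR
      dot_lmul_matrix[symmetric] transpose_matrix_vector flip: matrix_vector_mul_assoc)
    (metis dot_lmul_matrix vector_transpose_matrix transpose_matrix_vector)

locale segment3 =
  fixes a1 a2 a3 b1 b2 b3 :: real
  assumes a: "0 < a1" "a1 \<le> a2" "a2 \<le> a3" and b: "b1 \<le> b2" "b2 \<le> b3"
    and ab: "a1 < b1" "a2 < b2" "a3 < b3"
begin

definition \<alpha>1 :: "real \<Rightarrow> real" where "\<alpha>1 t = a1 + t * (b1 - a1)"
definition \<alpha>2 :: "real \<Rightarrow> real" where "\<alpha>2 t = a2 + t * (b2 - a2)"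
definition \<alpha>3 :: "real \<Rightarrow> real" where "\<alpha>3 t = a3 + t * (b3 - a3)"
definition d :: "real \<Rightarrow> real" where "d t = \<alpha>1 t * \<alpha>2 t * \<alpha>3 t"

text \<open>The largest singular value is below \<open>\<alpha>3\<close> and, as the determinant is \<open>\<alpha>1 \<alpha>2 \<alpha>3\<close>, the product
  of the two largest is below \<open>\<alpha>2 \<alpha>3\<close> exactly when the smallest is above \<open>\<alpha>1\<close>.\<close>

definition inner_hull :: "(real^3^3) set" where
  "inner_hull = {\<xi>. \<exists>t\<in>{0<..<1}. det \<xi> = d t \<and>
     (\<forall>x. norm x = 1 \<longrightarrow> \<alpha>1 t < norm (\<xi> *v x) \<and> norm (\<xi> *v x) < \<alpha>3 t)}"

lemma alpha_mono: "s < t \<Longrightarrow> \<alpha>1 s < \<alpha>1 t" "s < t \<Longrightarrow> \<alpha>2 s < \<alpha>2 t" "s < t \<Longrightarrow> \<alpha>3 s < \<alpha>3 t"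
  using ab by (auto simp: \<alpha>1_def \<alpha>2_def \<alpha>3_def)

lemma alpha_order:
  assumes "0 \<le> t" "t \<le> 1"
  shows "a1 \<le> \<alpha>1 t" "\<alpha>1 t \<le> \<alpha>2 t" "\<alpha>2 t \<le> \<alpha>3 t" "\<alpha>3 t \<le> b3"
proof -
  have conv: "\<alpha>1 t = (1 - t) * a1 + t * b1" "\<alpha>2 t = (1 - t) * a2 + t * b2" "\<alpha>3 t = (1 - t) * a3 + t * b3"
    by (simp_all add: \<alpha>1_def \<alpha>2_def \<alpha>3_def algebra_simps)
  show "\<alpha>1 t \<le> \<alpha>2 t" "\<alpha>2 t \<le> \<alpha>3 t"
    unfolding conv using assms a b by (auto intro!: add_mono mult_left_mono)
  show "a1 \<le> \<alpha>1 t" using assms ab by (simp add: \<alpha>1_def)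
  have "t * (b3 - a3) \<le> 1 * (b3 - a3)" using assms ab by (intro mult_right_mono) auto
  then show "\<alpha>3 t \<le> b3" by (simp add: \<alpha>3_def)
qed

lemma alpha_pos: "0 \<le> t \<Longrightarrow> t \<le> 1 \<Longrightarrow> 0 < \<alpha>1 t \<and> 0 < \<alpha>2 t \<and> 0 < \<alpha>3 t"
  using alpha_order[of t] a by linarith

text \<open>Makes the parameter recoverable from the determinant, which is what turns the hull into
  an open set.\<close>

lemma d_mono: "0 \<le> s \<Longrightarrow> s < t \<Longrightarrow> t \<le> 1 \<Longrightarrow> d s < d t"
  unfolding d_def using alpha_mono[of s t] alpha_pos[of s] alpha_pos[of t]
  by (intro mult_strict_mono) auto

lemma d_pos: "0 \<le> t \<Longrightarrow> t \<le> 1 \<Longrightarrow> 0 < d t"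
  using alpha_pos[of t] by (simp add: d_def)

lemma continuous_alpha: "continuous_on S \<alpha>1" "continuous_on S \<alpha>3" "continuous_on S d"
  unfolding \<alpha>1_def[abs_def] \<alpha>2_def[abs_def] \<alpha>3_def[abs_def] d_def[abs_def]
  by (intro continuous_intros)+

lemma hull_det_pos: "\<xi> \<in> inner_hull \<Longrightarrow> 0 < det \<xi>"
  by (auto simp: inner_hull_def intro!: d_pos)

lemma hullI:
  assumes "0 < t" "t < 1" "det \<xi> = d t" "\<alpha>1 t < m" "M < \<alpha>3 t"
    "\<And>x. norm x = 1 \<Longrightarrow> m \<le> norm (\<xi> *v x)" "\<And>x. norm x = 1 \<Longrightarrow> norm (\<xi> *v x) \<le> M"
  shows "\<xi> \<in> inner_hull"
  unfolding inner_hull_def using assms by (auto intro!: bexI[of _ t] intro: less_le_trans le_less_trans)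

lemma isotropic_set_eq_hull:
  "isotropic_set (\<Union>t\<in>{0<..<1}. {(x1, x2, x3). x1 * x2 * x3 = \<alpha>1 t * \<alpha>2 t * \<alpha>3 t \<and>
     0 < x1 \<and> x1 \<le> x2 \<and> x2 \<le> x3 \<and> x3 < \<alpha>3 t \<and> x2 * x3 < \<alpha>2 t * \<alpha>3 t}) = inner_hull" (is "isotropic_set ?\<Lambda> = _")
proof (intro set_eqI iffI)
  fix \<xi> :: "real^3^3"
  {
    fix l1 l2 l3 t :: real
    assume l: "0 < l1" "l1 \<le> l2" "l2 \<le> l3" and t: "0 < t" "t < 1" and prod: "l1 * l2 * l3 = \<alpha>1 t * \<alpha>2 t * \<alpha>3 t"
    have pos: "0 < \<alpha>1 t" "0 < \<alpha>2 t * \<alpha>3 t" "0 < l2 * l3"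
      using alpha_pos[of t] t l by auto
    have prod': "l1 * (l2 * l3) = \<alpha>1 t * (\<alpha>2 t * \<alpha>3 t)" using prod by (simp add: mult_ac)
    have "l2 * l3 < \<alpha>2 t * \<alpha>3 t \<longleftrightarrow> \<alpha>1 t < l1"
    proof
      assume "l2 * l3 < \<alpha>2 t * \<alpha>3 t"
      then have "l1 * (l2 * l3) < l1 * (\<alpha>2 t * \<alpha>3 t)" using l(1) by (rule mult_strict_left_mono)
      then show "\<alpha>1 t < l1" unfolding prod' mult_less_cancel_right_pos[OF pos(2)] .
    next
      assume "\<alpha>1 t < l1"
      then have "\<alpha>1 t * (l2 * l3) < l1 * (l2 * l3)" using pos(3) by (rule mult_strict_right_mono)
      then show "l2 * l3 < \<alpha>2 t * \<alpha>3 t" unfolding prod' mult_less_cancel_left_pos[OF pos(1)] .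
    qed
  } note iff = this
  show "\<xi> \<in> inner_hull" if "\<xi> \<in> isotropic_set ?\<Lambda>"
  proof -
    have det: "0 < det \<xi>" and sv: "singular_values3 \<xi> \<in> ?\<Lambda>" using that by (auto simp: isotropic_set_def)
    obtain U V l1 l2 l3 where "orthogonal_matrix U" "orthogonal_matrix V"
      "\<xi> = U ** diagonal3 l1 l2 l3 ** transpose V" "det U * det V = 1"
      and l: "singular_values3 \<xi> = (l1, l2, l3)" "0 < l1" "l1 \<le> l2" "l2 \<le> l3" "det \<xi> = l1 * l2 * l3"
      "\<And>x. norm x = 1 \<Longrightarrow> l1 \<le> norm (\<xi> *v x)" "\<And>x. norm x = 1 \<Longrightarrow> norm (\<xi> *v x) \<le> l3"
      by (rule singular_values3_stretch[OF det]) (rule that)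
    obtain t where t: "0 < t" "t < 1" "l1 * l2 * l3 = \<alpha>1 t * \<alpha>2 t * \<alpha>3 t" "l3 < \<alpha>3 t" "l2 * l3 < \<alpha>2 t * \<alpha>3 t"
      using sv l(1) by auto
    show ?thesis
      by (rule hullI[OF t(1,2) _ _ t(4) l(6,7)]) (use iff[OF l(2-4) t(1-3)] t l(5) in \<open>auto simp: d_def\<close>)
  qed
  show "\<xi> \<in> isotropic_set ?\<Lambda>" if \<xi>: "\<xi> \<in> inner_hull"
  proof -
    obtain t where t: "0 < t" "t < 1" "det \<xi> = d t"
      "\<And>x. norm x = 1 \<Longrightarrow> \<alpha>1 t < norm (\<xi> *v x) \<and> norm (\<xi> *v x) < \<alpha>3 t"
      using \<xi> by (auto simp: inner_hull_def)
    obtain U V l1 l2 l3 where "orthogonal_matrix U" "orthogonal_matrix V"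
      "\<xi> = U ** diagonal3 l1 l2 l3 ** transpose V" "det U * det V = 1"
      and l: "singular_values3 \<xi> = (l1, l2, l3)" "0 < l1" "l1 \<le> l2" "l2 \<le> l3" "det \<xi> = l1 * l2 * l3"
      "\<And>x. norm x = 1 \<Longrightarrow> l1 \<le> norm (\<xi> *v x)" "\<And>x. norm x = 1 \<Longrightarrow> norm (\<xi> *v x) \<le> l3"
      "norm (\<xi> *v (V *v axis 1 1)) = l1" "norm (\<xi> *v (V *v axis 3 1)) = l3"
      "norm (V *v axis 1 1) = 1" "norm (V *v axis 3 1) = 1"
      by (rule singular_values3_stretch[OF hull_det_pos[OF \<xi>]]) (rule that)
    \<comment> \<open>Strictness is kept because the extreme stretches are attained at unit
      vectors.\<close>
    have "\<alpha>1 t < l1" "l3 < \<alpha>3 t" using t(4)[OF l(10)] t(4)[OF l(11)] l(8,9) by auto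
    then show ?thesis
      using iff[OF l(2-4) t(1,2)] l t hull_det_pos[OF \<xi>] by (auto simp: isotropic_set_def d_def intro!: bexI[of _ t])
  qed
qed

text \<open>The columns are images of unit vectors, hence no longer than \<open>b3\<close>.\<close>

lemma bounded_hull: "bounded inner_hull"
proof (rule boundedI)
  fix \<xi> assume "\<xi> \<in> inner_hull"
  then obtain t where t: "0 < t" "t < 1" "\<And>x. norm x = 1 \<Longrightarrow> norm (\<xi> *v x) < \<alpha>3 t"
    by (auto simp: inner_hull_def)
  have ent: "\<bar>\<xi> $ i $ j\<bar> \<le> b3" for i j
  proof -
    have "\<xi> $ i $ j = (\<xi> *v axis j 1) $ i" by (simp add: matrix_vector_mult_basis column_def)
    then have "\<bar>\<xi> $ i $ j\<bar> \<le> norm (\<xi> *v axis j 1)" using component_le_norm_cart by metis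
    also have "\<dots> \<le> b3" using t(3)[of "axis j 1"] alpha_order(4)[of t] t(1,2) by simp
    finally show ?thesis .
  qed
  have "norm \<xi> \<le> (\<Sum>i\<in>UNIV. norm (\<xi> $ i))" unfolding norm_vec_def by (rule L2_set_le_sum) simp
  also have "\<dots> \<le> (\<Sum>i\<in>(UNIV :: 3 set). \<Sum>j\<in>(UNIV :: 3 set). b3)"
    by (intro sum_mono order_trans[OF norm_le_l1_cart] ent)
  finally show "norm \<xi> \<le> (\<Sum>i\<in>(UNIV :: 3 set). \<Sum>j\<in>(UNIV :: 3 set). b3)" .
qed

text \<open>A perturbation changes every stretch by at most its norm, but it changes the determinant
  as well, and the parameter has to follow. The intermediate value theorem finds a nearby parameter
  with the new determinant; the slack in the strict bounds covers both movements.\<close>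

lemma open_hull: "open inner_hull"
proof (subst open_subopen, intro ballI)
  fix \<xi>0 assume "\<xi>0 \<in> inner_hull"
  then obtain t where t: "0 < t" "t < 1" "det \<xi>0 = d t"
      "\<And>x. norm x = 1 \<Longrightarrow> \<alpha>1 t < norm (\<xi>0 *v x) \<and> norm (\<xi>0 *v x) < \<alpha>3 t"
    by (auto simp: inner_hull_def)
  obtain U V l1 l2 l3 where "orthogonal_matrix U" "orthogonal_matrix V"
    "\<xi>0 = U ** diagonal3 l1 l2 l3 ** transpose V" "det U * det V = 1"
    and l: "singular_values3 \<xi>0 = (l1, l2, l3)" "0 < l1" "l1 \<le> l2" "l2 \<le> l3" "det \<xi>0 = l1 * l2 * l3"
    "\<And>x. norm x = 1 \<Longrightarrow> l1 \<le> norm (\<xi>0 *v x)" "\<And>x. norm x = 1 \<Longrightarrow> norm (\<xi>0 *v x) \<le> l3"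
    "norm (\<xi>0 *v (V *v axis 1 1)) = l1" "norm (\<xi>0 *v (V *v axis 3 1)) = l3"
    "norm (V *v axis 1 1) = 1" "norm (V *v axis 3 1) = 1"
    by (rule singular_values3_stretch[OF hull_det_pos[OF \<open>\<xi>0 \<in> inner_hull\<close>]]) (rule that)
  have gap: "\<alpha>1 t < l1" "l3 < \<alpha>3 t" using t(4)[OF l(10)] t(4)[OF l(11)] l(8,9) by auto
  \<comment> \<open>Half of the smaller slack: one \<open>e\<close> for the perturbation of the
    matrix, one for the shift of the bounds with the parameter.\<close>
  define e where "e = min (l1 - \<alpha>1 t) (\<alpha>3 t - l3) / 2"
  have e: "e > 0" "\<alpha>1 t + 2 * e \<le> l1" "l3 + 2 * e \<le> \<alpha>3 t" using gap by (auto simp: e_def min_def field_simps)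
  define D where "D = max (b1 - a1) (b3 - a3)"
  have D: "D > 0" "b1 - a1 \<le> D" "b3 - a3 \<le> D" using ab by (auto simp: D_def)
  \<comment> \<open>Within distance \<open>h\<close> of \<open>t\<close> the bounds \<alpha>1 and
    \<alpha>3 move by at most \<open>e\<close>, and the parameter stays inside (0,1).\<close>
  define h where "h = min (e / D) (min (t / 2) ((1 - t) / 2))"
  have "h > 0" using e(1) D(1) t(1,2) by (simp add: h_def)
  moreover have "h \<le> e / D" "h \<le> t / 2" "h \<le> (1 - t) / 2" unfolding h_def by linarith+
  ultimately have h: "h > 0" "h \<le> e / D" "h \<le> t / 2" "h \<le> (1 - t) / 2" .
  have hD: "h * D \<le> e" using h(2) D(1) by (simp add: field_simps)
  have h1: "h * (b1 - a1) \<le> e" using mult_left_mono[OF D(2), of h] h(1) hD by linarith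
  have h3: "h * (b3 - a3) \<le> e" using mult_left_mono[OF D(3), of h] h(1) hD by linarith
  have th: "0 < t - h" "t + h < 1" using h t by auto
  let ?T = "ball \<xi>0 e \<inter> (\<lambda>\<xi>. det \<xi>) -` {d (t - h)<..<d (t + h)}"
  have "continuous_on UNIV (\<lambda>\<xi> :: real^3^3. det \<xi>)"
    unfolding det_3 by (intro continuous_intros)
  then have "open ((\<lambda>\<xi> :: real^3^3. det \<xi>) -` {d (t - h)<..<d (t + h)})"
    by (intro open_vimage) auto
  then have "open ?T" by (intro open_Int open_ball)
  moreover have "\<xi>0 \<in> ?T"
    using e t(3) d_mono[of "t - h" t] d_mono[of t "t + h"] th h(1) t(1,2) by simp
  moreover have "?T \<subseteq> inner_hull"
  proof
    fix \<xi> assume \<xi>: "\<xi> \<in> ?T"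
    have "\<exists>s. t - h \<le> s \<and> s \<le> t + h \<and> d s = det \<xi>"
      using \<xi> h(1) by (intro IVT' continuous_alpha) auto
    then obtain s where s: "t - h \<le> s" "s \<le> t + h" "d s = det \<xi>" by blast
    have s': "0 < s" "s < 1" using s th by auto
    have dist: "norm (\<xi> - \<xi>0) < e" using \<xi> by (simp add: dist_norm norm_minus_commute)
    have close: "norm (\<xi> *v x - \<xi>0 *v x) \<le> norm (\<xi> - \<xi>0)" if "norm x = 1" for x
      using norm_matrix_vector_le[of "\<xi> - \<xi>0" x] that by (simp add: matrix_vector_mult_diff_rdistrib)
    show "\<xi> \<in> inner_hull"
    proof (rule hullI[OF s' s(3)[symmetric]])
      have "s * (b1 - a1) \<le> (t + h) * (b1 - a1)" using s ab by (intro mult_right_mono) auto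
      then have "\<alpha>1 s \<le> \<alpha>1 t + e" using h1 by (simp add: \<alpha>1_def distrib_right)
      then show "\<alpha>1 s < l1 - norm (\<xi> - \<xi>0)" using e dist by linarith
      have "(t - h) * (b3 - a3) \<le> s * (b3 - a3)" using s ab by (intro mult_right_mono) auto
      then have "\<alpha>3 t - e \<le> \<alpha>3 s" using h3 by (simp add: \<alpha>3_def left_diff_distrib)
      then show "l3 + norm (\<xi> - \<xi>0) < \<alpha>3 s" using e dist by linarith
      fix x :: "real^3" assume x: "norm x = 1"
      show "l1 - norm (\<xi> - \<xi>0) \<le> norm (\<xi> *v x)"
        using close[OF x] l(6)[OF x] norm_triangle_ineq2[of "\<xi>0 *v x" "\<xi> *v x"]
        by (simp add: norm_minus_commute)
      show "norm (\<xi> *v x) \<le> l3 + norm (\<xi> - \<xi>0)"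
        using close[OF x] l(7)[OF x] norm_triangle_ineq2[of "\<xi> *v x" "\<xi>0 *v x"] by simp
    qed
  qed
  ultimately show "\<exists>T. open T \<and> \<xi>0 \<in> T \<and> T \<subseteq> inner_hull" by blast
qed

end

section \<open>Rank-one segments inside the hull\<close>

lemma rank_one_scaleR_left: "rank_one (s *\<^sub>R a) n = s *\<^sub>R rank_one a n"
  by (simp add: rank_one_def vec_eq_iff)

text \<open>Along columns of the singular frames a rank-one segment amounts to varying one entry of
  the middle factor.\<close>

lemma shear_conjugate:
  fixes U V D :: "real^'n^'n"
  shows "U ** D ** transpose V + \<tau> *\<^sub>R rank_one (s *\<^sub>R (U *v axis i 1)) (V *v axis j 1) =
    U ** (D + (\<tau> * s) *\<^sub>R rank_one (axis i 1) (axis j 1)) ** transpose V"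
proof -
  have scale: "A ** (c *\<^sub>R B) = c *\<^sub>R (A ** B)" "(c *\<^sub>R B) ** A = c *\<^sub>R (B ** A)" for A B :: "real^'n^'n" and c
    by (simp_all add: matrix_matrix_mult_def vec_eq_iff sum_distrib_left mult_ac)
  have add: "A ** (B + C) = A ** B + A ** C" "(B + C) ** A = B ** A + C ** A" for A B C :: "real^'n^'n"
    by (simp_all add: matrix_matrix_mult_def vec_eq_iff distrib_left distrib_right sum.distrib)
  show ?thesis
    by (simp add: rank_one_scaleR_left rank_one_conjugate add scale)
qed

text \<open>One entry above the diagonal keeps the matrix triangular, so the determinant is
  unchanged, and the coordinate outside the plane of the shear decouples.\<close>

lemma matrix_shear_simps:
  "det (diagonal3 l1 l2 l3 + \<sigma> *\<^sub>R rank_one (axis 2 1) (axis 3 1)) = l1 * l2 * l3"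
  "det (diagonal3 l1 l2 l3 + \<sigma> *\<^sub>R rank_one (axis 1 1) (axis 2 1)) = l1 * l2 * l3"
  "(norm ((diagonal3 l1 l2 l3 + \<sigma> *\<^sub>R rank_one (axis 2 1) (axis 3 1)) *v y))\<^sup>2 =
    (l1 * y $ 1)\<^sup>2 + ((l2 * y $ 2 + \<sigma> * y $ 3)\<^sup>2 + (l3 * y $ 3)\<^sup>2)"
  "(norm ((diagonal3 l1 l2 l3 + \<sigma> *\<^sub>R rank_one (axis 1 1) (axis 2 1)) *v y))\<^sup>2 =
    ((l1 * y $ 1 + \<sigma> * y $ 2)\<^sup>2 + (l2 * y $ 2)\<^sup>2) + (l3 * y $ 3)\<^sup>2"
  unfolding norm_square_3
  by (simp_all add: det_3 diagonal3_def rank_one_def axis_def matrix_vector_mult_def sum_3)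

context segment3
begin

text \<open>Moving by \<open>a1 * \<delta> / (4 * b3)\<close> in the plane of two neighbouring singular directions must not
  violate the constraint on the middle singular value. If the largest one stays below \<open>\<alpha>3\<close> by \<open>\<delta>\<close>, the
  determinant pushes the middle one away from \<open>\<alpha>1\<close>, and conversely.\<close>

lemma margin_above:
  assumes t: "0 \<le> t" "t \<le> 1" and \<delta>: "0 < \<delta>" and l: "0 < l1" "l1 \<le> l2" "0 < l3" "l3 \<le> \<alpha>3 t - \<delta>" "l1 * l2 * l3 = d t"
  shows "\<alpha>1 t + a1 * \<delta> / (4 * b3) < l2"
proof (rule ccontr)
  define s where "s = a1 * \<delta> / (4 * b3)"
  assume "\<not> \<alpha>1 t + a1 * \<delta> / (4 * b3) < l2"
  then have l2: "l2 \<le> \<alpha>1 t + s" by (simp add: s_def)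
  note ord = alpha_order[OF t] and pos = alpha_pos[OF t]
  have b3: "0 < b3" using ord pos by linarith
  have s: "0 < s" using a b3 \<delta> by (simp add: s_def)
  \<comment> \<open>The quotient a1 / b3 bounds \<alpha>1 / \<alpha>3 from below for all parameters
    at once, so the length of the shear depends on \<delta> only.\<close>
  have s3: "s * \<alpha>3 t \<le> \<alpha>1 t * \<delta> / 4"
  proof -
    have "s * \<alpha>3 t \<le> s * b3" using s ord by (intro mult_left_mono) auto
    also have "\<dots> = a1 * \<delta> / 4" using b3 by (simp add: s_def)
    also have "\<dots> \<le> \<alpha>1 t * \<delta> / 4" using ord \<delta> by simp
    finally show ?thesis .
  qed
  have "\<alpha>1 t * \<delta> \<le> \<alpha>1 t * \<alpha>3 t" using l pos by (intro mult_left_mono) auto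
  then have "s * \<alpha>3 t \<le> \<alpha>1 t / 4 * \<alpha>3 t" using s3 by simp
  then have s1: "s \<le> \<alpha>1 t / 4" using pos by (simp only: mult_le_cancel_right_pos)
  \<comment> \<open>Under the assumption to be refuted, \<open>l1\<close> and \<open>l2\<close> are
    both at most \<alpha>1 + s, while \<open>l3\<close> is below \<alpha>3 by \<delta>. The product
    is then less than \<alpha>1 \<alpha>1 \<alpha>3 and so less than the determinant.\<close>
  have "d t \<le> (\<alpha>1 t + s) * (\<alpha>1 t + s) * (\<alpha>3 t - \<delta>)"
    unfolding l(5)[symmetric] using l l2 by (intro mult_mono mult_nonneg_nonneg) auto
  also have "\<dots> = \<alpha>1 t * \<alpha>1 t * \<alpha>3 t - \<alpha>1 t * \<alpha>1 t * \<delta> + (2 * \<alpha>1 t * (s * \<alpha>3 t) + s * (s * \<alpha>3 t)) - (2 * \<alpha>1 t + s) * s * \<delta>"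
    by (simp add: algebra_simps)
  also have "\<dots> \<le> \<alpha>1 t * \<alpha>1 t * \<alpha>3 t - \<alpha>1 t * \<alpha>1 t * \<delta> + (2 * \<alpha>1 t * (\<alpha>1 t * \<delta> / 4) + \<alpha>1 t / 4 * (\<alpha>1 t * \<delta> / 4)) - 0"
    using s s1 s3 pos \<delta> by (intro diff_mono add_mono mult_mono) auto
  also have "\<dots> = \<alpha>1 t * \<alpha>1 t * \<alpha>3 t - 7 / 16 * (\<alpha>1 t * \<alpha>1 t * \<delta>)" by (simp add: field_simps)
  also have "\<dots> < \<alpha>1 t * \<alpha>1 t * \<alpha>3 t" using pos \<delta> by simp
  also have "\<dots> \<le> d t"
    unfolding d_def using ord pos by (intro mult_right_mono mult_left_mono) auto
  finally show False by simp
qed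

lemma margin_below:
  assumes t: "0 \<le> t" "t \<le> 1" and \<delta>: "0 < \<delta>" and l: "\<alpha>1 t + \<delta> \<le> l1" "l1 \<le> l2" "l2 \<le> l3" "l3 < \<alpha>3 t" "l1 * l2 * l3 = d t"
  shows "l2 + a1 * \<delta> / (4 * b3) < \<alpha>3 t"
proof (rule ccontr)
  define s where "s = a1 * \<delta> / (4 * b3)"
  assume "\<not> l2 + a1 * \<delta> / (4 * b3) < \<alpha>3 t"
  then have l2: "\<alpha>3 t - s \<le> l2" by (simp add: s_def)
  note ord = alpha_order[OF t] and pos = alpha_pos[OF t]
  have b3: "0 < b3" using ord pos by linarith
  have s: "0 < s" using a b3 \<delta> by (simp add: s_def)
  have s4: "s \<le> \<delta> / 4"
  proof -
    have "a1 * \<delta> \<le> b3 * \<delta>" using ord \<delta> by (intro mult_right_mono) auto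
    then show ?thesis using b3 by (simp add: s_def field_simps)
  qed
  have p: "0 < \<alpha>3 t - s" using s4 l ord pos \<delta> by linarith
  \<comment> \<open>Here \<open>l2\<close> and \<open>l3\<close> are both at least \<alpha>3 - s,
    while \<open>l1\<close> exceeds \<alpha>1 by \<delta>. The product is then larger than \<alpha>1
    \<alpha>3 \<alpha>3, although \<alpha>2 \<le> \<alpha>3 keeps the determinant below
    that.\<close>
  have "\<alpha>1 t * \<alpha>3 t * \<alpha>3 t < (\<alpha>1 t + \<delta>) * (\<alpha>3 t - s) * (\<alpha>3 t - s)"
  proof -
    have "2 * s * (\<alpha>1 t + \<delta>) < \<delta> * \<alpha>3 t"
      using s4 l pos \<delta> s by (intro mult_strict_mono) auto
    then have "2 * s * (\<alpha>1 t + \<delta>) * \<alpha>3 t < \<delta> * \<alpha>3 t * \<alpha>3 t" using pos by simp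
    moreover have "(\<alpha>1 t + \<delta>) * (\<alpha>3 t - s) * (\<alpha>3 t - s) =
        \<alpha>1 t * \<alpha>3 t * \<alpha>3 t + \<delta> * \<alpha>3 t * \<alpha>3 t - 2 * s * (\<alpha>1 t + \<delta>) * \<alpha>3 t + (\<alpha>1 t + \<delta>) * s\<^sup>2"
      by (simp add: power2_eq_square algebra_simps)
    moreover have "0 \<le> (\<alpha>1 t + \<delta>) * s\<^sup>2" using pos \<delta> by simp
    ultimately show ?thesis by linarith
  qed
  also have "\<dots> \<le> l1 * l2 * l3"
    using l l2 p pos \<delta> by (intro mult_mono mult_nonneg_nonneg) auto
  also have "\<dots> = d t" by (rule l(5))
  also have "\<dots> \<le> \<alpha>1 t * \<alpha>3 t * \<alpha>3 t"
    unfolding d_def using ord pos by (intro mult_right_mono mult_left_mono) auto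
  finally show False by simp
qed

text \<open>With a margin at the top the plane of the two largest singular values is sheared: the
  largest may grow by s, the middle one may fall by s, and the smallest direction is untouched. With
  a margin at the bottom it is the plane of the two smallest, and the largest direction is
  untouched.\<close>

lemma shear_splits:
  assumes t: "0 < t" "t < 1" "det \<xi> = d t"
      "\<And>x. norm x = 1 \<Longrightarrow> \<alpha>1 t < norm (\<xi> *v x) \<and> norm (\<xi> *v x) < \<alpha>3 t"
    and \<delta>: "0 < \<delta>"
    and margin: "(\<forall>x. norm x = 1 \<longrightarrow> norm (\<xi> *v x) \<le> \<alpha>3 t - \<delta>) \<or> (\<forall>x. norm x = 1 \<longrightarrow> \<alpha>1 t + \<delta> \<le> norm (\<xi> *v x))"
  shows "splits inner_hull (a1 * \<delta> / (4 * b3)) \<xi>"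
proof -
  define s where "s = a1 * \<delta> / (4 * b3)"
  have t01: "0 \<le> t" "t \<le> 1" using t by auto
  note ord = alpha_order[OF t01] and pos = alpha_pos[OF t01]
  have b3: "0 < b3" using ord pos by linarith
  have s: "0 < s" using a b3 \<delta> by (simp add: s_def)
  have s4: "s \<le> \<delta> / 4"
  proof -
    have "a1 * \<delta> \<le> b3 * \<delta>" using ord \<delta> by (intro mult_right_mono) auto
    then show ?thesis using b3 by (simp add: s_def field_simps)
  qed
  have det: "0 < det \<xi>" using t(3) d_pos[OF t01] by simp
  obtain U V l1 l2 l3 where UV: "orthogonal_matrix U" "orthogonal_matrix V"
    and \<xi>: "\<xi> = U ** diagonal3 l1 l2 l3 ** transpose V" and dUV: "det U * det V = 1"
    and l: "singular_values3 \<xi> = (l1, l2, l3)" "0 < l1" "l1 \<le> l2" "l2 \<le> l3" "det \<xi> = l1 * l2 * l3"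
    "\<And>x. norm x = 1 \<Longrightarrow> l1 \<le> norm (\<xi> *v x)" "\<And>x. norm x = 1 \<Longrightarrow> norm (\<xi> *v x) \<le> l3"
    "norm (\<xi> *v (V *v axis 1 1)) = l1" "norm (\<xi> *v (V *v axis 3 1)) = l3"
    "norm (V *v axis 1 1) = 1" "norm (V *v axis 3 1) = 1"
    by (rule singular_values3_stretch[OF det]) (rule that)
  have l1: "\<alpha>1 t < l1" using t(4)[OF l(10)] l(8) by simp
  have l3: "l3 < \<alpha>3 t" using t(4)[OF l(11)] l(9) by simp
  have oV: "orthogonal_matrix (transpose V)" using UV(2) by (simp add: orthogonal_matrix_transpose)
  have unit: "(y $ 1)\<^sup>2 + (y $ 2)\<^sup>2 + (y $ 3)\<^sup>2 = 1" if "y = transpose V *v x" "norm x = 1" for x y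
    using norm_orthogonal_mult[OF oV, of x] that by (simp add: norm_square_3[symmetric])
  \<comment> \<open>Orthogonal factors preserve norms, and their determinants multiply to 1, so only
    the middle factor has to be checked.\<close>
  have conj: "U ** M ** transpose V \<in> inner_hull"
    if M: "det M = l1 * l2 * l3" and mM: "\<alpha>1 t < p" "q < \<alpha>3 t" "0 \<le> p" "0 \<le> q"
      "\<And>y. (y $ 1)\<^sup>2 + (y $ 2)\<^sup>2 + (y $ 3)\<^sup>2 = 1 \<Longrightarrow> p\<^sup>2 \<le> (norm (M *v y))\<^sup>2 \<and> (norm (M *v y))\<^sup>2 \<le> q\<^sup>2" for M p q
  proof (rule hullI[OF t(1,2) _ mM(1,2)])
    have "det (U ** M ** transpose V) = (det U * det V) * det M" by (simp add: det_mul mult_ac)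
    then show "det (U ** M ** transpose V) = d t" using M l(5) t(3) by (simp add: dUV)
    fix x :: "real^3" assume x: "norm x = 1"
    show "p \<le> norm ((U ** M ** transpose V) *v x)" "norm ((U ** M ** transpose V) *v x) \<le> q"
      unfolding norm_orthogonal_conjugate[OF UV(1)]
      using mM(5)[OF unit[OF refl x]] mM(3,4) power2_le_imp_le norm_ge_zero by blast+
  qed
  show ?thesis
  proof (cases "\<forall>x. norm x = 1 \<longrightarrow> norm (\<xi> *v x) \<le> \<alpha>3 t - \<delta>")
    case True
    then have l3': "l3 \<le> \<alpha>3 t - \<delta>" using l(9,11) by metis
    have l2: "\<alpha>1 t + s < l2"
      unfolding s_def by (rule margin_above[OF t01 \<delta> l(2,3) _ l3']) (use l t(3) in auto)
    have sh: "U ** (diagonal3 l1 l2 l3 + (\<tau> * s) *\<^sub>R rank_one (axis 2 1) (axis 3 1)) ** transpose V \<in> inner_hull"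
      if "\<tau> \<in> {-1..1}" for \<tau>
    proof (rule conj[OF matrix_shear_simps(1)])
      have \<sigma>: "\<bar>\<tau> * s\<bar> \<le> s" using that s mult_right_mono[of "\<bar>\<tau>\<bar>" 1 s] by (auto simp: abs_mult)
      \<comment> \<open>The least stretch is bounded by that of the untouched first direction or by
        that of the sheared plane, whichever is smaller.\<close>
      show "\<alpha>1 t < min l1 (l2 - s)" "l3 + s < \<alpha>3 t" "0 \<le> min l1 (l2 - s)" "0 \<le> l3 + s"
        using l1 l2 l3' s s4 \<delta> pos l by auto
      fix y :: "real^3" assume y: "(y $ 1)\<^sup>2 + (y $ 2)\<^sup>2 + (y $ 3)\<^sup>2 = 1"
      let ?r = "(l2 * y $ 2 + (\<tau> * s) * y $ 3)\<^sup>2 + (l3 * y $ 3)\<^sup>2"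
      have low: "(l2 - s)\<^sup>2 * ((y $ 2)\<^sup>2 + (y $ 3)\<^sup>2) \<le> ?r"
        using s l2 pos l by (intro shear_lower \<sigma>) auto
      have up: "?r \<le> (l3 + s)\<^sup>2 * ((y $ 2)\<^sup>2 + (y $ 3)\<^sup>2)"
        using s l by (intro shear_upper \<sigma>) auto
      have "(min l1 (l2 - s))\<^sup>2 = (min l1 (l2 - s))\<^sup>2 * ((y $ 1)\<^sup>2) + (min l1 (l2 - s))\<^sup>2 * ((y $ 2)\<^sup>2 + (y $ 3)\<^sup>2)"
        using y by (simp add: distrib_left[symmetric] add.assoc[symmetric])
      also have "\<dots> \<le> l1\<^sup>2 * (y $ 1)\<^sup>2 + (l2 - s)\<^sup>2 * ((y $ 2)\<^sup>2 + (y $ 3)\<^sup>2)"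
        using l l2 pos by (intro add_mono mult_right_mono power_mono) auto
      also have "\<dots> \<le> (l1 * y $ 1)\<^sup>2 + ?r" using low by (simp add: power_mult_distrib)
      finally have 1: "(min l1 (l2 - s))\<^sup>2 \<le> (l1 * y $ 1)\<^sup>2 + ?r" .
      have "(l1 * y $ 1)\<^sup>2 + ?r \<le> (l3 + s)\<^sup>2 * ((y $ 1)\<^sup>2) + (l3 + s)\<^sup>2 * ((y $ 2)\<^sup>2 + (y $ 3)\<^sup>2)"
        unfolding power_mult_distrib[of l1] using l s by (intro add_mono up mult_right_mono power_mono) auto
      also have "\<dots> = (l3 + s)\<^sup>2" using y by (simp add: distrib_left[symmetric] add.assoc[symmetric])
      finally show "(min l1 (l2 - s))\<^sup>2 \<le> (norm ((diagonal3 l1 l2 l3 + (\<tau> * s) *\<^sub>R rank_one (axis 2 1) (axis 3 1)) *v y))\<^sup>2 \<and>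
          (norm ((diagonal3 l1 l2 l3 + (\<tau> * s) *\<^sub>R rank_one (axis 2 1) (axis 3 1)) *v y))\<^sup>2 \<le> (l3 + s)\<^sup>2"
        using 1 unfolding matrix_shear_simps by (rule conjI[rotated])
    qed
    show ?thesis
      unfolding splits_def s_def[symmetric]
    proof (intro exI conjI ballI)
      show "norm (V *v axis 3 1) = 1" by (rule l(11))
      show "s \<le> norm (s *\<^sub>R (U *v axis 2 1))" using s norm_orthogonal_mult[OF UV(1)] by simp
      show "\<xi> + \<tau> *\<^sub>R rank_one (s *\<^sub>R (U *v axis 2 1)) (V *v axis 3 1) \<in> inner_hull" if "\<tau> \<in> {-1..1}" for \<tau>
        unfolding \<xi> shear_conjugate by (rule sh[OF that])
    qed
  next
    case False
    then have l1': "\<alpha>1 t + \<delta> \<le> l1" using margin l(8,10) by metis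
    have l2: "l2 + s < \<alpha>3 t"
      unfolding s_def by (rule margin_below[OF t01 \<delta> l1' l(3,4) l3]) (use l t(3) in auto)
    have sh: "U ** (diagonal3 l1 l2 l3 + (\<tau> * s) *\<^sub>R rank_one (axis 1 1) (axis 2 1)) ** transpose V \<in> inner_hull"
      if "\<tau> \<in> {-1..1}" for \<tau>
    proof (rule conj[OF matrix_shear_simps(2)])
      have \<sigma>: "\<bar>\<tau> * s\<bar> \<le> s" using that s mult_right_mono[of "\<bar>\<tau>\<bar>" 1 s] by (auto simp: abs_mult)
      show "\<alpha>1 t < l1 - s" "max l3 (l2 + s) < \<alpha>3 t" "0 \<le> l1 - s" "0 \<le> max l3 (l2 + s)"
        using l1' l2 l3 s s4 \<delta> pos l by auto
      fix y :: "real^3" assume y: "(y $ 1)\<^sup>2 + (y $ 2)\<^sup>2 + (y $ 3)\<^sup>2 = 1"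
      let ?r = "(l1 * y $ 1 + (\<tau> * s) * y $ 2)\<^sup>2 + (l2 * y $ 2)\<^sup>2"
      have low: "(l1 - s)\<^sup>2 * ((y $ 1)\<^sup>2 + (y $ 2)\<^sup>2) \<le> ?r"
        using s s4 l1' \<delta> pos l by (intro shear_lower \<sigma>) auto
      have up: "?r \<le> (l2 + s)\<^sup>2 * ((y $ 1)\<^sup>2 + (y $ 2)\<^sup>2)"
        using s l by (intro shear_upper \<sigma>) auto
      have "(l1 - s)\<^sup>2 = (l1 - s)\<^sup>2 * ((y $ 1)\<^sup>2 + (y $ 2)\<^sup>2) + (l1 - s)\<^sup>2 * (y $ 3)\<^sup>2"
        using y by (simp add: distrib_left[symmetric])
      also have "\<dots> \<le> ?r + l3\<^sup>2 * (y $ 3)\<^sup>2"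
        using l l1' s s4 \<delta> pos by (intro add_mono low mult_right_mono power_mono) auto
      finally have 1: "(l1 - s)\<^sup>2 \<le> ?r + (l3 * y $ 3)\<^sup>2" by (simp add: power_mult_distrib)
      have "?r + (l3 * y $ 3)\<^sup>2 \<le> (l2 + s)\<^sup>2 * ((y $ 1)\<^sup>2 + (y $ 2)\<^sup>2) + l3\<^sup>2 * (y $ 3)\<^sup>2"
        unfolding power_mult_distrib[of l3] by (intro add_mono up order_refl)
      also have "\<dots> \<le> (max l3 (l2 + s))\<^sup>2 * ((y $ 1)\<^sup>2 + (y $ 2)\<^sup>2) + (max l3 (l2 + s))\<^sup>2 * (y $ 3)\<^sup>2"
        using l s by (intro add_mono mult_right_mono power_mono) auto
      also have "\<dots> = (max l3 (l2 + s))\<^sup>2" using y by (simp add: distrib_left[symmetric])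
      finally show "(l1 - s)\<^sup>2 \<le> (norm ((diagonal3 l1 l2 l3 + (\<tau> * s) *\<^sub>R rank_one (axis 1 1) (axis 2 1)) *v y))\<^sup>2 \<and>
          (norm ((diagonal3 l1 l2 l3 + (\<tau> * s) *\<^sub>R rank_one (axis 1 1) (axis 2 1)) *v y))\<^sup>2 \<le> (max l3 (l2 + s))\<^sup>2"
        using 1 unfolding matrix_shear_simps by (rule conjI[rotated])
    qed
    show ?thesis
      unfolding splits_def s_def[symmetric]
    proof (intro exI conjI ballI)
      show "norm (V *v axis 2 1) = 1" using norm_orthogonal_mult[OF UV(2)] by simp
      show "s \<le> norm (s *\<^sub>R (U *v axis 1 1))" using s norm_orthogonal_mult[OF UV(1)] by simp
      show "\<xi> + \<tau> *\<^sub>R rank_one (s *\<^sub>R (U *v axis 1 1)) (V *v axis 2 1) \<in> inner_hull" if "\<tau> \<in> {-1..1}" for \<tau>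
        unfolding \<xi> shear_conjugate by (rule sh[OF that])
    qed
  qed
qed

text \<open>If the limit had a margin at either bound, its approximants would eventually have a
  fixed margin and would split at a fixed scale. Hence both extreme singular values lie on the
  segment, at the same limit parameter, and the determinant leaves only \<alpha>2 for the middle
  one.\<close>

lemma limit_of_unsplit:
  fixes \<xi> :: "nat \<Rightarrow> real^3^3"
  assumes K: "\<And>k. \<xi> k \<in> inner_hull" and lim: "\<xi> \<longlonglongrightarrow> X"
    and unsplit: "\<And>c. c > 0 \<Longrightarrow> \<forall>\<^sub>F k in sequentially. \<not> splits inner_hull c (\<xi> k)"
  shows "0 < det X \<and> (\<exists>t\<in>{0..1}. singular_values3 X = (\<alpha>1 t, \<alpha>2 t, \<alpha>3 t))"
proof -
  have "\<exists>t. 0 < t \<and> t < 1 \<and> det (\<xi> k) = d t \<and>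
      (\<forall>x. norm x = 1 \<longrightarrow> \<alpha>1 t < norm (\<xi> k *v x) \<and> norm (\<xi> k *v x) < \<alpha>3 t)" for k
    using K[of k] by (auto simp: inner_hull_def)
  then obtain t where t: "\<And>k. 0 < t k" "\<And>k. t k < 1" "\<And>k. det (\<xi> k) = d (t k)"
    "\<And>k x. norm x = 1 \<Longrightarrow> \<alpha>1 (t k) < norm (\<xi> k *v x) \<and> norm (\<xi> k *v x) < \<alpha>3 (t k)" by metis
  have "\<forall>k. t k \<in> {0..1}" using t(1,2) by (auto intro: less_imp_le)
  \<comment> \<open>The parameters lie in the open interval, but \<tau> may be an endpoint; this is
    where the endpoints of the segment enter.\<close>
  then obtain \<tau> r where \<tau>: "\<tau> \<in> {0..1}" and r: "strict_mono r" and tr: "(t \<circ> r) \<longlonglongrightarrow> \<tau>"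
    using compact_Icc[of 0 "1::real"] unfolding compact_def by blast
  have \<tau>01: "0 \<le> \<tau>" "\<tau> \<le> 1" using \<tau> by auto
  note pos = alpha_pos[OF \<tau>01]
  have Y: "(\<lambda>k. \<xi> (r k)) \<longlonglongrightarrow> X" using LIMSEQ_subseq_LIMSEQ[OF lim r] by (simp add: o_def)
  have cal: "(\<lambda>k. f (t (r k))) \<longlonglongrightarrow> f \<tau>" if "continuous_on UNIV f" for f :: "real \<Rightarrow> real"
    using continuous_on_tendsto_compose[OF that tr] by (simp add: o_def)
  have vec: "(\<lambda>k. norm (\<xi> (r k) *v x)) \<longlonglongrightarrow> norm (X *v x)" for x
  proof (intro tendsto_norm)
    have "(\<lambda>k. \<xi> (r k) *v x - X *v x) \<longlonglongrightarrow> 0"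
    proof (rule Lim_null_comparison)
      show "\<forall>\<^sub>F k in sequentially. norm (\<xi> (r k) *v x - X *v x) \<le> norm (\<xi> (r k) - X) * norm x"
        using norm_matrix_vector_le[of "\<xi> (r _) - X" x]
        by (intro always_eventually) (simp add: matrix_vector_mult_diff_rdistrib)
      show "(\<lambda>k. norm (\<xi> (r k) - X) * norm x) \<longlonglongrightarrow> 0"
        using Y by (intro tendsto_mult_left_zero tendsto_norm_zero LIM_zero)
    qed
    then show "(\<lambda>k. \<xi> (r k) *v x) \<longlonglongrightarrow> X *v x" by (rule LIM_zero_cancel)
  qed
  have detX: "det X = d \<tau>"
  proof -
    have "(\<lambda>k. det (\<xi> (r k))) \<longlonglongrightarrow> det X"
      unfolding det_3 by (intro tendsto_intros Y)
    moreover have "(\<lambda>k. det (\<xi> (r k))) \<longlonglongrightarrow> d \<tau>" unfolding t(3) by (rule cal[OF continuous_alpha(3)])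
    ultimately show ?thesis by (rule LIMSEQ_unique)
  qed
  then have pX: "0 < det X" using d_pos[OF \<tau>01] by simp
  have bd: "\<alpha>1 \<tau> \<le> norm (X *v x)" "norm (X *v x) \<le> \<alpha>3 \<tau>" if "norm x = 1" for x
  proof -
    show "\<alpha>1 \<tau> \<le> norm (X *v x)"
      by (rule LIMSEQ_le[OF cal[OF continuous_alpha(1)] vec]) (use t(4)[OF that] in \<open>auto intro: less_imp_le\<close>)
    show "norm (X *v x) \<le> \<alpha>3 \<tau>"
      by (rule LIMSEQ_le[OF vec cal[OF continuous_alpha(2)]]) (use t(4)[OF that] in \<open>auto intro: less_imp_le\<close>)
  qed
  obtain U V l1 l2 l3 where "orthogonal_matrix U" "orthogonal_matrix V"
    "X = U ** diagonal3 l1 l2 l3 ** transpose V" "det U * det V = 1"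
    and l: "singular_values3 X = (l1, l2, l3)" "0 < l1" "l1 \<le> l2" "l2 \<le> l3" "det X = l1 * l2 * l3"
    "\<And>x. norm x = 1 \<Longrightarrow> l1 \<le> norm (X *v x)" "\<And>x. norm x = 1 \<Longrightarrow> norm (X *v x) \<le> l3"
    "norm (X *v (V *v axis 1 1)) = l1" "norm (X *v (V *v axis 3 1)) = l3"
    "norm (V *v axis 1 1) = 1" "norm (V *v axis 3 1) = 1"
    by (rule singular_values3_stretch[OF pX]) (rule that)
  have l1: "\<alpha>1 \<tau> \<le> l1" and l3: "l3 \<le> \<alpha>3 \<tau>" using bd(1)[OF l(10)] bd(2)[OF l(11)] l(8,9) by auto
  have close: "norm (\<xi> (r k) *v x - X *v x) \<le> norm (\<xi> (r k) - X)" if "norm x = 1" for k x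
    using norm_matrix_vector_le[of "\<xi> (r k) - X" x] that by (simp add: matrix_vector_mult_diff_rdistrib)
  have no: "\<forall>\<^sub>F k in sequentially. \<not> splits inner_hull (a1 * \<delta> / (4 * b3)) (\<xi> (r k))" if "\<delta> > 0" for \<delta>
  proof (rule eventually_subseq[OF r], rule unsplit)
    show "0 < a1 * \<delta> / (4 * b3)" using a b ab that by simp
  qed
  have contra: False
    if \<delta>: "\<delta> > 0" and ev: "\<forall>\<^sub>F k in sequentially. (\<forall>x. norm x = 1 \<longrightarrow> norm (\<xi> (r k) *v x) \<le> \<alpha>3 (t (r k)) - \<delta>) \<or>
        (\<forall>x. norm x = 1 \<longrightarrow> \<alpha>1 (t (r k)) + \<delta> \<le> norm (\<xi> (r k) *v x))" for \<delta>
  proof -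
    have "\<forall>\<^sub>F k in sequentially. False"
      using no[OF \<delta>] ev
    proof eventually_elim
      case (elim k)
      then show ?case using shear_splits[OF t(1)[of "r k"] t(2)[of "r k"] t(3)[of "r k"] t(4)[of _ "r k"] \<delta>] by blast
    qed
    then show False by simp
  qed
  have near: "\<forall>\<^sub>F k in sequentially. norm (\<xi> (r k) - X) < \<delta>" if "\<delta> > 0" for \<delta>
    using tendstoD[OF Y that] by (simp add: dist_norm)
  have "l3 = \<alpha>3 \<tau>"
  proof (rule ccontr)
    assume "l3 \<noteq> \<alpha>3 \<tau>"
    \<comment> \<open>A third of the gap is lost to the distance from the limit matrix, a third to
      the motion of the bound, and a third remains as margin.\<close>
    define \<delta> where "\<delta> = (\<alpha>3 \<tau> - l3) / 3"
    have "l3 < \<alpha>3 \<tau>" using \<open>l3 \<noteq> \<alpha>3 \<tau>\<close> l3 by simp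
    then have \<delta>: "\<delta> > 0" "l3 = \<alpha>3 \<tau> - 3 * \<delta>" by (simp_all add: \<delta>_def field_simps)
    have "\<forall>\<^sub>F k in sequentially. \<alpha>3 \<tau> - \<delta> < \<alpha>3 (t (r k))"
      using order_tendstoD(1)[OF cal[OF continuous_alpha(2)]] \<delta>(1) by simp
    then have "\<forall>\<^sub>F k in sequentially. (\<forall>x. norm x = 1 \<longrightarrow> norm (\<xi> (r k) *v x) \<le> \<alpha>3 (t (r k)) - \<delta>) \<or>
        (\<forall>x. norm x = 1 \<longrightarrow> \<alpha>1 (t (r k)) + \<delta> \<le> norm (\<xi> (r k) *v x))"
      using near[OF \<delta>(1)]
    proof eventually_elim
      case (elim k)
      have "norm (\<xi> (r k) *v x) \<le> \<alpha>3 (t (r k)) - \<delta>" if "norm x = 1" for x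
        using close[OF that, of k] l(7)[OF that] norm_triangle_ineq2[of "\<xi> (r k) *v x" "X *v x"] elim \<delta>(2) by linarith
      then show ?case by blast
    qed
    then show False by (rule contra[OF \<delta>(1)])
  qed
  moreover have "l1 = \<alpha>1 \<tau>"
  proof (rule ccontr)
    assume "l1 \<noteq> \<alpha>1 \<tau>"
    define \<delta> where "\<delta> = (l1 - \<alpha>1 \<tau>) / 3"
    have "\<alpha>1 \<tau> < l1" using \<open>l1 \<noteq> \<alpha>1 \<tau>\<close> l1 by simp
    then have \<delta>: "\<delta> > 0" "l1 = \<alpha>1 \<tau> + 3 * \<delta>" by (simp_all add: \<delta>_def field_simps)
    have "\<forall>\<^sub>F k in sequentially. \<alpha>1 (t (r k)) < \<alpha>1 \<tau> + \<delta>"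
      using order_tendstoD(2)[OF cal[OF continuous_alpha(1)]] \<delta>(1) by simp
    then have "\<forall>\<^sub>F k in sequentially. (\<forall>x. norm x = 1 \<longrightarrow> norm (\<xi> (r k) *v x) \<le> \<alpha>3 (t (r k)) - \<delta>) \<or>
        (\<forall>x. norm x = 1 \<longrightarrow> \<alpha>1 (t (r k)) + \<delta> \<le> norm (\<xi> (r k) *v x))"
      using near[OF \<delta>(1)]
    proof eventually_elim
      case (elim k)
      have "\<alpha>1 (t (r k)) + \<delta> \<le> norm (\<xi> (r k) *v x)" if "norm x = 1" for x
        using close[OF that, of k] l(6)[OF that] norm_triangle_ineq2[of "X *v x" "\<xi> (r k) *v x"] elim \<delta>(2)
        by (simp add: norm_minus_commute)
      then show ?case by blast
    qed
    then show False by (rule contra[OF \<delta>(1)])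
  qed
  moreover have "l2 = \<alpha>2 \<tau>"
    using detX l(5) calculation pos by (simp add: d_def)
  ultimately show ?thesis using pX l(1) \<tau> by auto
qed

end

section \<open>Correction of the given map\<close>

lemma has_weak_gradient_add:
  fixes u v :: "real^'n \<Rightarrow> real^'m"
  assumes \<Omega>: "open \<Omega>" and u: "has_weak_gradient \<Omega> u U" and v: "has_weak_gradient \<Omega> v V"
  shows "has_weak_gradient \<Omega> (\<lambda>x. u x + v x) (\<lambda>x. U x + V x)"
proof -
  have sets: "\<Omega> \<in> sets lebesgue" using \<Omega> by auto
  \<comment> \<open>Integrals of sums can be split only for integrable summands; a locally
    integrable function becomes integrable on multiplication by a test function.\<close>
  have test: "integrable (lebesgue_on \<Omega>) (\<lambda>x. f x * g x)"
    if f: "locally_integrable \<Omega> f" and g: "g \<in> test_functions \<Omega>" for f g :: "real^'n \<Rightarrow> real"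
  proof -
    obtain S where S: "compact S" "S \<subseteq> \<Omega>" "\<And>x. x \<notin> S \<Longrightarrow> g x = 0" "\<And>x h. x \<notin> S \<Longrightarrow> frechet_derivative g (at x) h = 0"
      by (rule test_functions_support[OF g]) (rule that)
    have "integrable lebesgue (\<lambda>x. f x * g x)"
    proof (rule integrable_mult_compact_support[OF S(1) _ test_functions_continuous[OF g] S(3)])
      show "integrable (lebesgue_on S) f" using f S(1,2) by (simp add: locally_integrable_def)
    qed
    moreover have "g x = 0" if "x \<notin> \<Omega>" for x using S(2,3) that by blast
    ultimately show ?thesis using integral_lebesgue_on_eq(2)[OF sets, of "\<lambda>x. f x * g x"] by simp
  qed
  have comp: "locally_integrable \<Omega> (\<lambda>x. f x $ i)" if "locally_integrable \<Omega> f"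
    for f :: "real^'n \<Rightarrow> 'b::euclidean_space^'k" and i
    using that unfolding locally_integrable_def
    by (blast intro: integrable_bounded_linear[OF bounded_linear_vec_nth])
  show ?thesis
    unfolding has_weak_gradient_def
  proof (intro conjI allI impI)
    show "locally_integrable \<Omega> (\<lambda>x. u x + v x)" "locally_integrable \<Omega> (\<lambda>x. U x + V x)"
      using u v by (auto simp: has_weak_gradient_def locally_integrable_def)
    fix \<psi> :: "real^'n \<Rightarrow> real" and i :: 'm and j :: 'n
    assume \<psi>: "\<psi> \<in> test_functions \<Omega>"
    let ?d = "\<lambda>x. frechet_derivative \<psi> (at x) (axis j 1)"
    have d: "?d \<in> test_functions \<Omega>" by (rule test_functions_partial[OF \<psi>])
    have "(LINT x|lebesgue_on \<Omega>. (u x + v x) $ i * ?d x) =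
        (LINT x|lebesgue_on \<Omega>. u x $ i * ?d x) + (LINT x|lebesgue_on \<Omega>. v x $ i * ?d x)"
      using test[OF comp d, of u i] test[OF comp d, of v i] u v
      by (simp add: has_weak_gradient_def distrib_right)
    also have "\<dots> = - (LINT x|lebesgue_on \<Omega>. U x $ i $ j * \<psi> x) - (LINT x|lebesgue_on \<Omega>. V x $ i $ j * \<psi> x)"
      using u v \<psi> by (simp add: has_weak_gradient_def)
    also have "\<dots> = - (LINT x|lebesgue_on \<Omega>. (U x + V x) $ i $ j * \<psi> x)"
      using test[OF comp[OF comp] \<psi>, of U i j] test[OF comp[OF comp] \<psi>, of V i j] u v
      by (simp add: has_weak_gradient_def distrib_right)
    finally show "(LINT x|lebesgue_on \<Omega>. (u x + v x) $ i * ?d x) = - (LINT x|lebesgue_on \<Omega>. (U x + V x) $ i $ j * \<psi> x)" .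
  qed
qed

theorem theorem4p12:
  fixes a1 a2 a3 b1 b2 b3 :: real
    and \<Lambda>E \<Lambda>K \<Gamma> relint\<Gamma> :: "(real \<times> real \<times> real) set"
    and E K :: "(real^3^3) set"
    and \<Omega> :: "(real^3) set"
    and \<phi> :: "real^3 \<Rightarrow> real^3"
    and D\<phi> :: "real^3 \<Rightarrow> real^3^3"
  assumes \<Lambda>E: "\<Lambda>E \<subseteq> {(x1, x2, x3). 0 < x1 \<and> x1 \<le> x2 \<and> x2 \<le> x3}"
    and E_def: "E = isotropic_set \<Lambda>E"
    and \<Gamma>_def: "\<Gamma> = (\<lambda>t. (a1 + t * (b1 - a1), a2 + t * (b2 - a2), a3 + t * (b3 - a3))) ` {0..1}"
    and \<Gamma>: "\<Gamma> \<subseteq> \<Lambda>E"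
    and "a1 < b1" "a2 < b2" "a3 < b3"
    and "(a1 < a2 \<and> a2 < a3) \<or> (b1 < b2 \<and> b2 < b3)"
    and relint_def:
      "relint\<Gamma> = (\<lambda>t. (a1 + t * (b1 - a1), a2 + t * (b2 - a2), a3 + t * (b3 - a3))) ` {0<..<1}"
    and \<Lambda>K_def: "\<Lambda>K = (\<Union>(\<alpha>1, \<alpha>2, \<alpha>3)\<in>relint\<Gamma>.
          {(x1, x2, x3). x1 * x2 * x3 = \<alpha>1 * \<alpha>2 * \<alpha>3 \<and>
             0 < x1 \<and> x1 \<le> x2 \<and> x2 \<le> x3 \<and> x3 < \<alpha>3 \<and> x2 * x3 < \<alpha>2 * \<alpha>3})"
    and K_def: "K = isotropic_set \<Lambda>K"
    and "bounded \<Omega>" "open \<Omega>"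
    and "\<phi> \<in> C1_piec \<Omega>"
    and "has_weak_gradient \<Omega> \<phi> D\<phi>"
    and "AE x in lebesgue_on \<Omega>. D\<phi> x \<in> E \<union> K"
  shows "\<exists>u Du. (\<lambda>x. u x - \<phi> x) \<in> W1_inf_0 \<Omega> \<and> has_weak_gradient \<Omega> u Du \<and>
           (AE x in lebesgue_on \<Omega>. Du x \<in> E)"
proof -
  have mem: "(a1 + t * (b1 - a1), a2 + t * (b2 - a2), a3 + t * (b3 - a3)) \<in> \<Lambda>E" if "t \<in> {0..1}" for t
    using \<Gamma> that unfolding \<Gamma>_def by blast
  have "0 < a1" "a1 \<le> a2" "a2 \<le> a3" "b1 \<le> b2" "b2 \<le> b3"
    using \<Lambda>E mem[of 0] mem[of 1] by auto
  then interpret segment3 a1 a2 a3 b1 b2 b3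
    using assms(5-7) by unfold_locales auto
  have K: "K = inner_hull"
  proof -
    have "\<Lambda>K = (\<Union>t\<in>{0<..<1}. {(x1, x2, x3). x1 * x2 * x3 = \<alpha>1 t * \<alpha>2 t * \<alpha>3 t \<and>
        0 < x1 \<and> x1 \<le> x2 \<and> x2 \<le> x3 \<and> x3 < \<alpha>3 t \<and> x2 * x3 < \<alpha>2 t * \<alpha>3 t})"
      unfolding \<Lambda>K_def relint_def by (simp add: \<alpha>1_def \<alpha>2_def \<alpha>3_def)
    then show ?thesis by (simp only: K_def isotropic_set_eq_hull)
  qed
  have E: "X \<in> E" if "0 < det X \<and> (\<exists>t\<in>{0..1}. singular_values3 X = (\<alpha>1 t, \<alpha>2 t, \<alpha>3 t))" for X
    using that mem by (auto simp: E_def isotropic_set_def \<alpha>1_def \<alpha>2_def \<alpha>3_def)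
  obtain \<omega> :: "nat \<Rightarrow> (real^3) set" where \<omega>: "\<And>k. open (\<omega> k)" "\<And>k. \<omega> k \<subseteq> \<Omega>" "\<And>k. \<phi> \<in> C1_closure (\<omega> k)"
      and null: "\<Omega> - (\<Union>k. \<omega> k) \<in> null_sets lebesgue"
    using \<open>\<phi> \<in> C1_piec \<Omega>\<close> unfolding C1_piec_def by blast
  define G where "G = (\<lambda>x. jacobian \<phi> (at x))"
  have G_cont: "continuous_on (\<omega> k) G" for k
  proof -
    obtain g where g: "continuous_on (closure (\<omega> k)) g" "\<And>x. x \<in> \<omega> k \<Longrightarrow> (\<phi> has_derivative (\<lambda>h. g x *v h)) (at x)"
      using \<omega>(3)[of k] unfolding C1_closure_def by blast
    have "continuous_on (\<omega> k) g" using g(1) closure_subset by (rule continuous_on_subset)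
    then show ?thesis
      by (rule continuous_on_eq) (simp add: G_def jacobian_eqI[OF g(2)])
  qed
  define O' where "O' = (\<Union>k. \<omega> k)"
  have "open O'" unfolding O'_def using \<omega>(1) by auto
  have G_O: "continuous_on O' G"
    unfolding O'_def using \<omega>(1) G_cont by (intro continuous_on_open_UN) auto
  \<comment> \<open>All pieces are treated together: the gradient is continuous on their union, so
    one application of convex integration to the open set \<open>W\<close> yields the whole
    correction.\<close>
  define W where "W = O' \<inter> G -` inner_hull"
  have W: "open W" "W \<subseteq> \<Omega>"
    unfolding W_def using continuous_open_preimage[OF G_O \<open>open O'\<close> open_hull] \<omega>(2) by (auto simp: O'_def)
  have GW: "continuous_on W G" "G ` W \<subseteq> inner_hull"
    using continuous_on_subset[OF G_O] by (auto simp: W_def)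
  obtain v V \<xi> where v: "v \<in> W1_inf_0 \<Omega>" "has_weak_gradient \<Omega> v V" "AE x in lebesgue. x \<notin> W \<longrightarrow> V x = 0"
    and \<xi>: "\<And>k x. x \<in> W \<Longrightarrow> \<xi> k x \<in> inner_hull"
      "AE x in lebesgue. x \<in> W \<longrightarrow> (\<lambda>k. \<xi> k x) \<longlonglongrightarrow> G x + V x \<and>
        (\<forall>c>0. \<forall>\<^sub>F k in sequentially. \<not> splits inner_hull c (\<xi> k x))"
    by (rule convex_integration[OF open_hull bounded_hull \<open>open \<Omega>\<close> \<open>bounded \<Omega>\<close> W GW]) (rule that)
  \<comment> \<open>The given weak gradient is determined only up to null sets; on each of the
    countably many pieces it is identified with the classical one.\<close>
  have "AE x in lebesgue. \<forall>k. x \<in> \<omega> k \<longrightarrow> D\<phi> x = G x"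
    unfolding AE_all_countable G_def
    using weak_gradient_eq_jacobian[OF \<open>has_weak_gradient \<Omega> \<phi> D\<phi>\<close> \<open>open \<Omega>\<close> \<omega>] by blast
  moreover have "AE x in lebesgue. x \<notin> \<Omega> - O'"
    using null unfolding O'_def by (rule AE_not_in)
  moreover have "AE x in lebesgue. x \<in> \<Omega> \<longrightarrow> D\<phi> x \<in> E \<union> K"
    using assms(16) \<open>open \<Omega>\<close> by (subst (asm) AE_restrict_space_iff) auto
  ultimately have "AE x in lebesgue. x \<in> \<Omega> \<longrightarrow> D\<phi> x + V x \<in> E"
    using v(3) \<xi>(2)
  proof eventually_elim
    case (elim x)
    show ?case
    proof
      assume x: "x \<in> \<Omega>"
      then have "x \<in> O'" using elim(2) by blast
      then have D: "D\<phi> x = G x" using elim(1) by (auto simp: O'_def)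
      show "D\<phi> x + V x \<in> E"
      proof (cases "x \<in> W")
        case True
        then show ?thesis
          unfolding D using elim(5) \<xi>(1) by (intro E limit_of_unsplit[of "\<lambda>k. \<xi> k x"]) auto
      next
        case False
        \<comment> \<open>Off \<open>W\<close> the given gradient must already be in
          \<open>E\<close>, and there the correction has zero gradient.\<close>
        then have "D\<phi> x \<notin> K" using \<open>x \<in> O'\<close> by (auto simp: W_def K D)
        then show ?thesis using elim(3,4) x False by auto
      qed
    qed
  qed
  then have "AE x in lebesgue_on \<Omega>. D\<phi> x + V x \<in> E"
    using \<open>open \<Omega>\<close> by (subst AE_restrict_space_iff) auto
  moreover have "has_weak_gradient \<Omega> (\<lambda>x. \<phi> x + v x) (\<lambda>x. D\<phi> x + V x)"
    by (rule has_weak_gradient_add[OF \<open>open \<Omega>\<close> \<open>has_weak_gradient \<Omega> \<phi> D\<phi>\<close> v(2)])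
  moreover have "(\<lambda>x. (\<phi> x + v x) - \<phi> x) \<in> W1_inf_0 \<Omega>" using v(1) by simp
  ultimately show ?thesis
    by (intro exI[of _ "\<lambda>x. \<phi> x + v x"] exI[of _ "\<lambda>x. D\<phi> x + V x"] conjI)
qed

end
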